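(* Let $N=3$, $3<q<5$, and let $\rho\ge0$ be locally bounded on $\mathbb R^3$ such that $\rho^{-1}(0)$ has non-empty interior, $|\{x\in\mathbb R^3:\rho(x)\le\overline M\}|<\infty$ for some $\overline M>0$, and $\rho(x)\to\rho_\infty>\overline M$ as $|x|\to\infty$. Let $\lambda_0,\lambda_1>0$ be the constants described in the context. Then, for all $\lambda\ge\max(\lambda_0,\lambda_1)$, $I_\lambda$ satisfies the Palais-Smale condition at the mountain-pass level $c_\lambda$.
   Context: Notation: $|A|$ is Lebesgue measure, $\omega=(N-2)|\mathbb S^{N-1}|$ with $N=3$. For $\lambda>0$, $E(\mathbb R^3)=\{u\in W^{1,1}_{\mathrm{loc}}(\mathbb R^3):\|u\|_{E(\mathbb R^3)}<\infty\}$ with $$\|u\|_{E(\mathbb R^3)}=\Big(\int_{\mathbb R^3}(|\nabla u|^2+u^2)\,dx+\lambda\Big(\int_{\mathbb R^3}\int_{\mathbb R^3}\frac{u^2(x)\rho(x)u^2(y)\rho(y)}{|x-y|}\,dx\,dy\Big)^{1/2}\Big)^{1/2},$$ $$I_\lambda(u)=\frac12\int_{\mathbb R^3}(|\nabla u|^2+u^2)+\frac{\lambda^2}{4}\int_{\mathbb R^3}\int_{\mathbb R^3}\frac{u^2(x)\rho(x)u^2(y)\rho(y)}{\omega|x-y|}\,dx\,dy-\frac1{q+1}\int_{\mathbb R^3}|u|^{q+1},$$ $$c_\lambda=\inf_{\gamma\in\bar\Gamma_\lambda}\max_{t\in[0,1]}I_\lambda(\gamma(t)),\qquad \bar\Gamma_\lambda=\{\gamma\in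 C([0,1];E(\mathbb R^3)):\gamma(0)=0,\ I_\lambda(\gamma(1))<0\}.$$ A Palais-Smale sequence for $I_\lambda$ at level $c$ is a sequence $(u_n)\subset E(\mathbb R^3)$ with $I_\lambda(u_n)\to c$ and $I_\lambda'(u_n)\to0$ in the dual of $E(\mathbb R^3)$; $I_\lambda$ satisfies the Palais-Smale condition at level $c$ if every such sequence is relatively compact in $E(\mathbb R^3)$. The constants $\lambda_0=\lambda_0(q,\overline M)$, $\lambda_1=\lambda_1(q,\overline M)$ are positive constants (which exist for the given $\rho$, $q$) with the following properties: (a) there is $\alpha_0=\alpha_0(q)>0$ such that, whenever $\lambda\ge\lambda_0$ and $u\in E(\mathbb R^3)$ is the weak limit of a Palais-Smale sequence for $I_\lambda$ at level $c_\lambda$, then $\int_{\mathbb R^3}|u|^3>\alpha_0$; (b) whenever $\lambda\ge\max(\lambda_0,\lambda_1)$ and $u$ is the nontrivial weak limit in $E(\mathbb R^3)$ of a Palais-Smale sequence for $I_\lambda$ at level $c_\lambda$, then $I_\lambda(u)=c_\lambda$. *)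

theory Defs
  imports "HOL-Analysis.Analysis"
begin

type_synonym R3 = "real ^ 3"

text \<open>
  Elements of the function spaces are represented by functions rather than by classes modulo
  equality almost everywhere; every notion below is invariant under changing functions on null
  sets, and \<open>E_norm\<close> is accordingly only a seminorm on functions.
\<close>

subsection \<open>Weak gradients and the space \<open>W\<^sup>1\<^sup>,\<^sup>1\<^sub>l\<^sub>o\<^sub>c\<close>\<close>

fun C_k :: "nat \<Rightarrow> (R3 \<Rightarrow> real) \<Rightarrow> bool" where
  "C_k 0 f \<longleftrightarrow> continuous_on UNIV f"
| "C_k (Suc k) f \<longleftrightarrow>
     (\<forall>x. f differentiable (at x)) \<and> (\<forall>v. C_k k (\<lambda>x. frechet_derivative f (at x) v))"

definition test_function :: "(R3 \<Rightarrow> real) \<Rightarrow> bool" where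
  "test_function \<phi> \<longleftrightarrow> (\<forall>k. C_k k \<phi>) \<and> compact (closure {x. \<phi> x \<noteq> 0})"

definition locally_integrable :: "(R3 \<Rightarrow> 'a::euclidean_space) \<Rightarrow> bool" where
  "locally_integrable f \<longleftrightarrow> (\<forall>K. compact K \<longrightarrow> f absolutely_integrable_on K)"

definition has_weak_gradient :: "(R3 \<Rightarrow> real) \<Rightarrow> (R3 \<Rightarrow> R3) \<Rightarrow> bool" where
  "has_weak_gradient u g \<longleftrightarrow> locally_integrable g \<and>
     (\<forall>\<phi> i. test_function \<phi> \<longrightarrow>
        (LINT x|lebesgue. u x * frechet_derivative \<phi> (at x) (axis i 1)) =
        - (LINT x|lebesgue. g x $ i * \<phi> x))"

definition W11loc :: "(R3 \<Rightarrow> real) set" where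
  "W11loc = {u. locally_integrable u \<and> (\<exists>g. has_weak_gradient u g)}"

text \<open>The weak gradient is determined up to a null set; the choice below is immaterial.\<close>

definition weak_grad :: "(R3 \<Rightarrow> real) \<Rightarrow> R3 \<Rightarrow> R3" where
  "weak_grad u = (SOME g. has_weak_gradient u g)"

subsection \<open>The space \<open>E\<close>\<close>

definition H1_energy :: "(R3 \<Rightarrow> real) \<Rightarrow> ennreal" where
  "H1_energy u = (\<integral>\<^sup>+x. ennreal ((norm (weak_grad u x))\<^sup>2 + (u x)\<^sup>2) \<partial>lebesgue)"

definition Coulomb_energy :: "(R3 \<Rightarrow> real) \<Rightarrow> (R3 \<Rightarrow> real) \<Rightarrow> ennreal" where
  "Coulomb_energy \<rho> u =
     (\<integral>\<^sup>+x. (\<integral>\<^sup>+y. ennreal ((u x)\<^sup>2 * \<rho> x * (u y)\<^sup>2 * \<rho> y / norm (x - y)) \<partial>lebesgue) \<partial>lebesgue)"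

text \<open>
  For \<open>lam > 0\<close> the extended-valued norm of \<open>u\<close> is finite iff both energies are, so the set \<open>E\<close>
  does not depend on \<open>lam\<close>; only the norm does.
\<close>

definition E_space :: "(R3 \<Rightarrow> real) \<Rightarrow> (R3 \<Rightarrow> real) set" where
  "E_space \<rho> = {u \<in> W11loc. H1_energy u < \<infinity> \<and> Coulomb_energy \<rho> u < \<infinity>}"

definition E_norm :: "(R3 \<Rightarrow> real) \<Rightarrow> real \<Rightarrow> (R3 \<Rightarrow> real) \<Rightarrow> real" where
  "E_norm \<rho> lam u =
     sqrt (enn2real (H1_energy u) + lam * sqrt (enn2real (Coulomb_energy \<rho> u)))"

definition E_topology :: "(R3 \<Rightarrow> real) \<Rightarrow> real \<Rightarrow> (R3 \<Rightarrow> real) topology" where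
  "E_topology \<rho> lam = topology (\<lambda>U. U \<subseteq> E_space \<rho> \<and>
     (\<forall>u\<in>U. \<exists>r>0. \<forall>v\<in>E_space \<rho>. E_norm \<rho> lam (\<lambda>x. v x - u x) < r \<longrightarrow> v \<in> U))"

lemma openin_E_topology:
  "openin (E_topology \<rho> lam) U \<longleftrightarrow> U \<subseteq> E_space \<rho> \<and>
     (\<forall>u\<in>U. \<exists>r>0. \<forall>v\<in>E_space \<rho>. E_norm \<rho> lam (\<lambda>x. v x - u x) < r \<longrightarrow> v \<in> U)"
proof -
  let ?P = "\<lambda>U. U \<subseteq> E_space \<rho> \<and>
     (\<forall>u\<in>U. \<exists>r>0. \<forall>v\<in>E_space \<rho>. E_norm \<rho> lam (\<lambda>x. v x - u x) < r \<longrightarrow> v \<in> U)"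
  have "?P (S \<inter> T)" if S: "?P S" and T: "?P T" for S T
  proof (intro conjI ballI)
    show "S \<inter> T \<subseteq> E_space \<rho>" using S by blast
  next
    fix u assume u: "u \<in> S \<inter> T"
    obtain r where r: "r > 0" "\<forall>v\<in>E_space \<rho>. E_norm \<rho> lam (\<lambda>x. v x - u x) < r \<longrightarrow> v \<in> S"
      using S u by blast
    obtain s where s: "s > 0" "\<forall>v\<in>E_space \<rho>. E_norm \<rho> lam (\<lambda>x. v x - u x) < s \<longrightarrow> v \<in> T"
      using T u by blast
    show "\<exists>r>0. \<forall>v\<in>E_space \<rho>. E_norm \<rho> lam (\<lambda>x. v x - u x) < r \<longrightarrow> v \<in> S \<inter> T"
      using r s by (intro exI[of _ "min r s"]) auto
  qed
  moreover have "?P (\<Union>\<K>)" if "\<forall>K\<in>\<K>. ?P K" for \<K>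
    using that by (meson Sup_le_iff UnionE UnionI)
  ultimately have "istopology ?P"
    unfolding istopology_def by blast
  then show ?thesis
    unfolding E_topology_def by (simp add: topology_inverse')
qed

definition E_dual :: "(R3 \<Rightarrow> real) \<Rightarrow> real \<Rightarrow> ((R3 \<Rightarrow> real) \<Rightarrow> real) set" where
  "E_dual \<rho> lam = {F.
     (\<forall>u\<in>E_space \<rho>. \<forall>v\<in>E_space \<rho>. \<forall>a b. F (\<lambda>x. a * u x + b * v x) = a * F u + b * F v) \<and>
     (\<exists>C. \<forall>u\<in>E_space \<rho>. \<bar>F u\<bar> \<le> C * E_norm \<rho> lam u)}"

definition E_dual_norm :: "(R3 \<Rightarrow> real) \<Rightarrow> real \<Rightarrow> ((R3 \<Rightarrow> real) \<Rightarrow> real) \<Rightarrow> real" where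
  "E_dual_norm \<rho> lam F = (SUP u\<in>{u \<in> E_space \<rho>. E_norm \<rho> lam u \<le> 1}. \<bar>F u\<bar>)"

definition E_weak_limit ::
  "(R3 \<Rightarrow> real) \<Rightarrow> real \<Rightarrow> (nat \<Rightarrow> R3 \<Rightarrow> real) \<Rightarrow> (R3 \<Rightarrow> real) \<Rightarrow> bool" where
  "E_weak_limit \<rho> lam v u \<longleftrightarrow> u \<in> E_space \<rho> \<and> (\<forall>F\<in>E_dual \<rho> lam. (\<lambda>n. F (v n)) \<longlonglongrightarrow> F u)"

subsection \<open>The functional, its mountain-pass level and Palais-Smale sequences\<close>

text \<open>The constant \<open>\<omega> = (N - 2) \<bar>S\<^sup>N\<^sup>-\<^sup>1\<bar>\<close> for \<open>N = 3\<close>, the unit sphere having area \<open>4 \<pi>\<close>.\<close>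

definition omega :: real where
  "omega = 4 * pi"

definition I_fun :: "(R3 \<Rightarrow> real) \<Rightarrow> real \<Rightarrow> real \<Rightarrow> (R3 \<Rightarrow> real) \<Rightarrow> real" where
  "I_fun \<rho> q lam u =
     1 / 2 * enn2real (H1_energy u)
     + lam\<^sup>2 / 4 * (enn2real (Coulomb_energy \<rho> u) / omega)
     - 1 / (q + 1) * (LINT x|lebesgue. \<bar>u x\<bar> powr (q + 1))"

definition I_paths :: "(R3 \<Rightarrow> real) \<Rightarrow> real \<Rightarrow> real \<Rightarrow> (real \<Rightarrow> R3 \<Rightarrow> real) set" where
  "I_paths \<rho> q lam = {\<gamma>.
     continuous_map (top_of_set {0..1}) (E_topology \<rho> lam) \<gamma> \<and>
     (AE x in lebesgue. \<gamma> 0 x = 0) \<and> I_fun \<rho> q lam (\<gamma> 1) < 0}"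

definition mp_level :: "(R3 \<Rightarrow> real) \<Rightarrow> real \<Rightarrow> real \<Rightarrow> real" where
  "mp_level \<rho> q lam = (INF \<gamma>\<in>I_paths \<rho> q lam. SUP t\<in>{0..1}. I_fun \<rho> q lam (\<gamma> t))"

text \<open>\<open>F\<close> is the Frechet derivative of the functional at \<open>u\<close>, as an element of the dual of \<open>E\<close>.\<close>

definition has_E_derivative ::
  "(R3 \<Rightarrow> real) \<Rightarrow> real \<Rightarrow> real \<Rightarrow> (R3 \<Rightarrow> real) \<Rightarrow> ((R3 \<Rightarrow> real) \<Rightarrow> real) \<Rightarrow> bool" where
  "has_E_derivative \<rho> q lam u F \<longleftrightarrow> F \<in> E_dual \<rho> lam \<and>
     (\<forall>e>0. \<exists>d>0. \<forall>h\<in>E_space \<rho>. E_norm \<rho> lam h < d \<longrightarrow>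
        \<bar>I_fun \<rho> q lam (\<lambda>x. u x + h x) - I_fun \<rho> q lam u - F h\<bar> \<le> e * E_norm \<rho> lam h)"

definition PS_sequence ::
  "(R3 \<Rightarrow> real) \<Rightarrow> real \<Rightarrow> real \<Rightarrow> real \<Rightarrow> (nat \<Rightarrow> R3 \<Rightarrow> real) \<Rightarrow> bool" where
  "PS_sequence \<rho> q lam c v \<longleftrightarrow>
     (\<forall>n. v n \<in> E_space \<rho>) \<and> (\<lambda>n. I_fun \<rho> q lam (v n)) \<longlonglongrightarrow> c \<and>
     (\<exists>D. (\<forall>n. has_E_derivative \<rho> q lam (v n) (D n)) \<and> (\<lambda>n. E_dual_norm \<rho> lam (D n)) \<longlonglongrightarrow> 0)"

definition PS_condition :: "(R3 \<Rightarrow> real) \<Rightarrow> real \<Rightarrow> real \<Rightarrow> real \<Rightarrow> bool" where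
  "PS_condition \<rho> q lam c \<longleftrightarrow>
     (\<forall>v. PS_sequence \<rho> q lam c v \<longrightarrow>
        compactin (E_topology \<rho> lam) (E_topology \<rho> lam closure_of range v))"

end

theory Submission
  imports Defs
begin

text \<open>
  A locally bounded density with a limit at infinity is bounded, so the Coulomb energy is at most a
  constant times the fourth power of the \<open>H\<^sup>1\<close> norm; hence \<open>E\<close> is \<open>H\<^sup>1\<close> with an equivalent norm and
  strong \<open>H\<^sup>1\<close> convergence suffices.

  Let \<open>v\<close> be a Palais-Smale sequence at level \<open>c\<close>. In \<open>I(v n) - I'(v n)(v n) / (q + 1)\<close> the norm and the
  Coulomb energy have positive coefficients because \<open>q > 3\<close>; so \<open>v\<close> is bounded, and a subsequence
  converges weakly and almost everywhere to some \<open>u\<close>, which is nontrivial and satisfies \<open>I(u) = c\<close>.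
  Passing to the limit in \<open>I'(v n)(u)\<close>, with Fatou's lemma in the Coulomb term, gives \<open>I'(u)(u) \<le> 0\<close>,
  whence \<open>c \<le> a \<parallel>u\<parallel>\<^sup>2 + b D(u)\<close>, whereas \<open>a \<parallel>v n\<parallel>\<^sup>2 + b D(v n)\<close> tends to \<open>c\<close>. By lower
  semicontinuity of both terms, \<open>\<parallel>v n\<parallel>\<close> tends to \<open>\<parallel>u\<parallel>\<close>, so the convergence is strong.

  The subcritical Sobolev inequality and local compactness both come from averages over dyadic cubes
  of side \<open>2 ^ -k\<close>: these are at \<open>L\<^sup>2\<close> distance \<open>O(2 ^ -k)\<close> from \<open>u\<close>, are bounded by \<open>O(2 ^ (k / 2))\<close>
  by telescoping, and each of them is a continuous linear functional of \<open>u\<close>.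
\<close>

section \<open>Test functions and the fundamental lemma of the calculus of variations\<close>

text \<open>The obstacle is loss of mass at infinity: \<open>\<rho>\<close> has a positive limit
  there, so the Coulomb energy and the power term need not converge along a bounded sequence. The
  assumption I(u) = c on weak limits excludes such a loss. Here a = 1/2 - 1/(q+1) and b =
  (lam^2/omega) (1/4 - 1/(q+1)); if part of the norm escaped, a ||u||^2 + b D(u) would fall strictly
  below c. One-sided information on the Coulomb energy, which Fatou supplies, therefore suffices.
  The power term is passed to the limit only after testing with the fixed function u, whose own
  decay controls the tails. A Palais-Smale sequence carries its derivatives along, and their values
  are read off from difference quotients in a single direction. Elements of \<open>E\<close> are
  functions rather than classes, so norms are seminorms throughout: Hilbert space theory is set up
  for semi-inner products, and compactness of the closure is a covering argument in a topology that
  does not separate functions equal almost everywhere.\<close>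

lemma C_k_SucI:
  assumes "\<And>x. (f has_derivative f' x) (at x)" "\<And>v. C_k k (\<lambda>x. f' x v)"
  shows "C_k (Suc k) f"
proof -
  have "frechet_derivative f (at x) = f' x" for x
    using assms(1) frechet_derivative_at by metis
  then show ?thesis
    using assms by (auto simp: differentiable_def)
qed

lemma C_k_Suc_derivative:
  assumes "C_k (Suc k) f"
  obtains f' where "\<And>x. (f has_derivative f' x) (at x)" "\<And>v. C_k k (\<lambda>x. f' x v)"
  using assms by (intro that[of "\<lambda>x. frechet_derivative f (at x)"]) (auto simp: frechet_derivative_works)

lemma C_k_SucD: "C_k (Suc k) f \<Longrightarrow> C_k k f"
proof (induction k arbitrary: f)
  case 0
  then show ?case
    by (auto intro!: continuous_at_imp_continuous_on differentiable_imp_continuous_within)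
next
  case (Suc k)
  from Suc.prems obtain f' where f': "\<And>x. (f has_derivative f' x) (at x)" "\<And>v. C_k (Suc k) (\<lambda>x. f' x v)"
    by (rule C_k_Suc_derivative) blast
  show ?case
    by (rule C_k_SucI[OF f'(1)]) (rule Suc.IH[OF f'(2)])
qed

lemma C_k_const: "C_k k (\<lambda>x. c)"
proof (induction k arbitrary: c)
  case (Suc k)
  show ?case by (rule C_k_SucI[of _ "\<lambda>x v. 0"]) (auto intro: Suc)
qed auto

lemma C_k_add: "C_k k f \<Longrightarrow> C_k k g \<Longrightarrow> C_k k (\<lambda>x. f x + g x)"
proof (induction k arbitrary: f g)
  case 0
  then show ?case by (auto intro: continuous_intros)
next
  case (Suc k)
  from Suc.prems(1) obtain f' where f': "\<And>x. (f has_derivative f' x) (at x)" "\<And>v. C_k k (\<lambda>x. f' x v)"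
    by (rule C_k_Suc_derivative) blast
  from Suc.prems(2) obtain g' where g': "\<And>x. (g has_derivative g' x) (at x)" "\<And>v. C_k k (\<lambda>x. g' x v)"
    by (rule C_k_Suc_derivative) blast
  show ?case
    by (rule C_k_SucI[OF has_derivative_add[OF f'(1) g'(1)]]) (rule Suc.IH[OF f'(2) g'(2)])
qed

lemma C_k_mult: "C_k k f \<Longrightarrow> C_k k g \<Longrightarrow> C_k k (\<lambda>x. f x * g x)"
proof (induction k arbitrary: f g)
  case 0
  then show ?case by (auto intro: continuous_intros)
next
  case (Suc k)
  from Suc.prems(1) obtain f' where f': "\<And>x. (f has_derivative f' x) (at x)" "\<And>v. C_k k (\<lambda>x. f' x v)"
    by (rule C_k_Suc_derivative) blast
  from Suc.prems(2) obtain g' where g': "\<And>x. (g has_derivative g' x) (at x)" "\<And>v. C_k k (\<lambda>x. g' x v)"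
    by (rule C_k_Suc_derivative) blast
  show ?case
    by (rule C_k_SucI[OF has_derivative_mult[OF f'(1) g'(1)]])
       (intro C_k_add Suc.IH f'(2) g'(2) Suc.prems[THEN C_k_SucD])
qed

lemma C_k_prod: "finite A \<Longrightarrow> (\<And>i. i \<in> A \<Longrightarrow> C_k k (f i)) \<Longrightarrow> C_k k (\<lambda>x. \<Prod>i\<in>A. f i x)"
  by (induction A rule: finite_induct) (auto intro: C_k_const C_k_mult)

section \<open>Smooth bump functions on boxes\<close>

text \<open>One-variable profiles carry their derivative as an existential witness.
  \<open>C_k_coordinate\<close> composes them with affine functions of one coordinate, so smooth
  functions on \<open>R3\<close> can be built as finite products of such factors.\<close>

fun C_k1 :: "nat \<Rightarrow> (real \<Rightarrow> real) \<Rightarrow> bool" where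
  "C_k1 0 f \<longleftrightarrow> continuous_on UNIV f"
| "C_k1 (Suc k) f \<longleftrightarrow> (\<exists>f'. (\<forall>x. (f has_field_derivative f' x) (at x)) \<and> C_k1 k f')"

lemma C_k_coordinate: "C_k1 k f \<Longrightarrow> C_k k (\<lambda>x. f (a * (x $ i) + b))"
proof (induction k arbitrary: f)
  case 0
  then have "continuous_on UNIV (f \<circ> (\<lambda>x::R3. a * (x $ i) + b))"
    by (intro continuous_on_compose continuous_intros) (auto intro: continuous_on_subset)
  then show ?case by (simp add: o_def)
next
  case (Suc k)
  then obtain f' where f': "\<And>x. (f has_field_derivative f' x) (at x)" "C_k1 k f'" by auto
  have lin: "((\<lambda>x::R3. a * (x $ i) + b) has_derivative (\<lambda>v. a * (v $ i))) (at x)" for x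
    by (auto intro!: derivative_eq_intros bounded_linear_imp_has_derivative)
  have "((\<lambda>x::R3. f (a * (x $ i) + b)) has_derivative (\<lambda>v. f' (a * (x $ i) + b) * (a * (v $ i)))) (at x)" for x
    using has_derivative_compose[OF lin f'(1)[unfolded has_field_derivative_def]] .
  then show ?case
    by (rule C_k_SucI) (intro C_k_mult C_k_const Suc.IH f')
qed

text \<open>The classical flat functions p(1/x) exp(-1/x), extended by 0. Admitting every polynomial
  \<open>p\<close> makes the family closed under differentiation, so smoothness follows by an
  induction that generalises over \<open>p\<close>.\<close>

definition exp_flat :: "real poly \<Rightarrow> real \<Rightarrow> real" where
  "exp_flat p x = (if x > 0 then poly p (1 / x) * exp (- (1 / x)) else 0)"

lemma poly_exp_decay: "((\<lambda>t::real. poly p t * exp (- t)) \<longlongrightarrow> 0) at_top"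
proof -
  have "((\<lambda>t::real. \<Sum>i\<le>degree p. coeff p i * (t ^ i / exp t)) \<longlongrightarrow> (\<Sum>i\<le>degree p. coeff p i * 0)) at_top"
    by (intro tendsto_intros tendsto_power_div_exp_0)
  then show ?thesis
    by (simp add: poly_altdef sum_distrib_right exp_minus divide_inverse mult.assoc)
qed

text \<open>With t = 1/x and dt/dx = -t^2, the derivative of p(t) exp(-t) is t^2 (p(t) - p'(t))
  exp(-t). At 0 the right difference quotient is t p(t) exp(-t), which tends to 0 as t grows, and
  the left one is constantly 0.\<close>

lemma exp_flat_deriv:
  "(exp_flat p has_field_derivative exp_flat (monom 1 2 * (p - pderiv p)) x) (at x)"
proof -
  consider "x < 0" | "x > 0" | "x = 0" by linarith
  then show ?thesis
  proof cases
    case 1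
    have "((\<lambda>x::real. 0) has_field_derivative 0) (at x)" by simp
    then have "(exp_flat p has_field_derivative 0) (at x)"
      by (rule has_field_derivative_transform_within_open[of _ _ _ "{..<0}"])
         (use 1 in \<open>auto simp: exp_flat_def\<close>)
    then show ?thesis using 1 by (simp add: exp_flat_def)
  next
    case 2
    have "((\<lambda>x. poly p (1 / x) * exp (- (1 / x))) has_field_derivative
        exp_flat (monom 1 2 * (p - pderiv p)) x) (at x)"
      using 2 by (auto intro!: derivative_eq_intros DERIV_chain2[OF poly_DERIV]
          simp: exp_flat_def poly_monom divide_simps power2_eq_square) (simp add: algebra_simps)
    then show ?thesis
      by (rule has_field_derivative_transform_within_open[of _ _ _ "{0<..}"])
         (use 2 in \<open>auto simp: exp_flat_def\<close>)
  next
    case 3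
    have "((\<lambda>t. poly (pCons 0 p) t * exp (- t)) \<longlongrightarrow> 0) at_top" by (rule poly_exp_decay)
    then have "((\<lambda>h::real. poly (pCons 0 p) (inverse h) * exp (- inverse h)) \<longlongrightarrow> 0) (at_right 0)"
      by (rule filterlim_compose) (rule filterlim_inverse_at_top_right)
    then have r: "((\<lambda>h. exp_flat p h / h) \<longlongrightarrow> 0) (at_right 0)"
      by (rule Lim_transform_eventually)
         (auto simp: eventually_at_filter exp_flat_def divide_simps)
    have l: "((\<lambda>h. exp_flat p h / h) \<longlongrightarrow> 0) (at_left 0)"
      by (rule Lim_transform_eventually[OF tendsto_const])
         (auto simp: eventually_at_filter exp_flat_def)
    have "((\<lambda>h. exp_flat p h / h) \<longlongrightarrow> 0) (at 0)"
      using l r filterlim_split_at by blast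
    then show ?thesis using 3
      by (simp add: DERIV_def) (simp add: exp_flat_def)
  qed
qed

lemma C_k1_exp_flat: "C_k1 k (exp_flat p)"
proof (induction k arbitrary: p)
  case 0
  show ?case
    by (auto intro!: continuous_at_imp_continuous_on DERIV_isCont[OF exp_flat_deriv])
next
  case (Suc k)
  then show ?case using exp_flat_deriv by auto
qed

text \<open>A factor is exp(-1/(n y)), where y is the coordinate distance to a face, if y > 0, and 0
  otherwise; it tends to 1 for y > 0 as \<open>n\<close> grows. So the bumps stay below the
  indicator of the open box and converge to it pointwise, as dominated convergence requires.\<close>

definition box_bump :: "R3 \<Rightarrow> R3 \<Rightarrow> nat \<Rightarrow> R3 \<Rightarrow> real" where
  "box_bump a b n x = (\<Prod>i\<in>UNIV. exp_flat 1 (real n * (x $ i - a $ i)) * exp_flat 1 (real n * (b $ i - x $ i)))"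

lemma exp_flat_1_bounds: "0 \<le> exp_flat 1 x" "exp_flat 1 x \<le> 1"
  by (auto simp: exp_flat_def)

lemma exp_flat_1_tendsto: "(\<lambda>n. exp_flat 1 (real n * y)) \<longlonglongrightarrow> (if y > 0 then 1 else 0)"
proof (cases "y > 0")
  case True
  have "(\<lambda>n. exp (- (1 / y) * inverse (real n))) \<longlonglongrightarrow> exp (- (1 / y) * 0)"
    by (intro tendsto_intros lim_inverse_n)
  moreover have "eventually (\<lambda>n. exp (- (1 / y) * inverse (real n)) = exp_flat 1 (real n * y)) sequentially"
    using eventually_gt_at_top[of 0] by eventually_elim (use True in \<open>simp add: exp_flat_def divide_simps\<close>)
  ultimately show ?thesis using True by (simp add: Lim_transform_eventually)
next
  case False
  then have "exp_flat 1 (real n * y) = 0" for n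
    by (auto simp: exp_flat_def zero_less_mult_iff)
  then show ?thesis using False by simp
qed

lemma mem_box_R3: "x \<in> box a b \<longleftrightarrow> (\<forall>i. a $ i < x $ i \<and> x $ i < b $ i)" for x :: R3
  by (simp add: mem_box_cart)

lemma box_bump_bounds: "0 \<le> box_bump a b n x" "box_bump a b n x \<le> indicator (box a b) x"
proof -
  show "0 \<le> box_bump a b n x"
    unfolding box_bump_def by (intro prod_nonneg mult_nonneg_nonneg exp_flat_1_bounds ballI)
  show "box_bump a b n x \<le> indicator (box a b) x"
  proof (cases "x \<in> box a b")
    case True
    have "box_bump a b n x \<le> (\<Prod>i\<in>(UNIV::3 set). 1)"
      unfolding box_bump_def
      by (intro prod_mono conjI mult_nonneg_nonneg exp_flat_1_bounds mult_le_one)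
    then show ?thesis using True by simp
  next
    case False
    then obtain i where "x $ i \<le> a $ i \<or> b $ i \<le> x $ i" by (auto simp: mem_box_R3 not_less)
    then have "exp_flat 1 (real n * (x $ i - a $ i)) * exp_flat 1 (real n * (b $ i - x $ i)) = 0"
      by (auto simp: exp_flat_def zero_less_mult_iff)
    then have "box_bump a b n x = 0"
      unfolding box_bump_def by (intro prod_zero) auto
    then show ?thesis by simp
  qed
qed

lemma box_bump_tendsto: "(\<lambda>n. box_bump a b n x) \<longlonglongrightarrow> indicator (box a b) x"
proof -
  have "(\<lambda>n. box_bump a b n x) \<longlonglongrightarrow> (\<Prod>i\<in>UNIV. (if x $ i - a $ i > 0 then 1 else 0) * (if b $ i - x $ i > 0 then 1 else 0))"
    unfolding box_bump_def by (intro tendsto_intros exp_flat_1_tendsto)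
  also have "(\<Prod>i\<in>UNIV. (if x $ i - a $ i > 0 then 1 else 0) * (if b $ i - x $ i > 0 then 1 else 0)) = (indicator (box a b) x :: real)"
    by (auto simp: mem_box_R3 indicator_def prod_zero_iff)
  finally show ?thesis .
qed

lemma test_function_box_bump: "test_function (box_bump a b n)"
  unfolding test_function_def
proof
  have "C_k k (\<lambda>x. \<Prod>i\<in>UNIV. exp_flat 1 (real n * (x $ i) + (- real n * a $ i)) * exp_flat 1 ((- real n) * (x $ i) + real n * b $ i))" for k
    by (intro C_k_prod C_k_mult C_k_coordinate C_k1_exp_flat) auto
  then show "\<forall>k. C_k k (box_bump a b n)"
    unfolding box_bump_def by (simp add: algebra_simps)
  have "{x. box_bump a b n x \<noteq> 0} \<subseteq> cbox a b"
  proof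
    fix x assume "x \<in> {x. box_bump a b n x \<noteq> 0}"
    then have "(indicator (box a b) x :: real) \<noteq> 0"
      using box_bump_bounds[where a=a and b=b and n=n and x=x] by (metis mem_Collect_eq order_antisym)
    then have "x \<in> box a b" by (simp add: indicator_eq_0_iff)
    then show "x \<in> cbox a b" using box_subset_cbox[of a b] by blast
  qed
  then have "closure {x. box_bump a b n x \<noteq> 0} \<subseteq> cbox a b"
    by (simp add: closure_minimal closed_cbox)
  then show "compact (closure {x. box_bump a b n x \<noteq> 0})"
    by (meson bounded_cbox bounded_closure bounded_subset closed_closure compact_eq_bounded_closed)
qed

section \<open>From vanishing against test functions to vanishing almost everywhere\<close>

lemma sigma_finite_lebesgue: "sigma_finite_measure (lebesgue :: 'a::euclidean_space measure)"
proof
  obtain A :: "'a set set" where A: "countable A" "A \<subseteq> sets lborel" "\<Union>A = space lborel" "\<forall>a\<in>A. emeasure lborel a \<noteq> \<infinity>"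
    using lborel.sigma_finite_countable by metis
  then show "\<exists>A::'a set set. countable A \<and> A \<subseteq> sets lebesgue \<and> \<Union>A = space lebesgue \<and> (\<forall>a\<in>A. emeasure lebesgue a \<noteq> \<infinity>)"
    by (intro exI[of _ A]) (auto simp: emeasure_completion subset_eq main_part_sets)
qed

lemma borel_measurable_lebesgueI: "f \<in> borel_measurable borel \<Longrightarrow> f \<in> borel_measurable lebesgue"
  by (simp add: measurable_completion)

lemma locally_integrable_indicator:
  "locally_integrable f \<Longrightarrow> compact K \<Longrightarrow> integrable lebesgue (\<lambda>x. indicator K x *\<^sub>R f x)"
  by (auto simp: locally_integrable_def set_integrable_def)

lemma locally_integrable_measurable:
  assumes "locally_integrable f"
  shows "f \<in> borel_measurable lebesgue"
proof (rule borel_measurable_LIMSEQ_metric)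
  show "(\<lambda>x. indicator (cball 0 (real n)) x *\<^sub>R f x) \<in> borel_measurable lebesgue" for n
    using locally_integrable_indicator[OF assms, of "cball 0 (real n)"] by auto
  show "(\<lambda>n. indicator (cball 0 (real n)) x *\<^sub>R f x) \<longlonglongrightarrow> f x" for x
  proof (rule tendsto_eventually)
    obtain m where "norm x \<le> real m" using real_arch_simple by blast
    then show "\<forall>\<^sub>F n in sequentially. indicator (cball 0 (real n)) x *\<^sub>R f x = f x"
      by (intro eventually_sequentiallyI[of m]) auto
  qed
qed

text \<open>Dominated convergence along the bumps, with |f| on the closed box as majorant. Boxes are
  the target because they form an intersection-stable generator of the Borel sets.\<close>

lemma integral_box_eq_0:
  fixes f :: "R3 \<Rightarrow> real"
  assumes f: "locally_integrable f"
    and 0: "\<And>\<phi>. test_function \<phi> \<Longrightarrow> (LINT x|lebesgue. f x * \<phi> x) = 0"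
  shows "integrable lebesgue (\<lambda>x. f x * indicator (box a b) x)"
    "(LINT x|lebesgue. f x * indicator (box a b) x) = 0"
proof -
  note [measurable] = locally_integrable_measurable[OF f]
  have w: "integrable lebesgue (\<lambda>x. norm (indicator (cbox a b) x *\<^sub>R f x))"
    by (intro integrable_norm locally_integrable_indicator f compact_cbox)
  have cont: "continuous_on UNIV (box_bump a b n)" for n
    using test_function_box_bump[of a b n] unfolding test_function_def by (metis C_k.simps(1))
  have m: "(\<lambda>x. f x * box_bump a b n x) \<in> borel_measurable lebesgue" for n
    by (intro borel_measurable_times locally_integrable_measurable f borel_measurable_lebesgueI
        borel_measurable_continuous_onI cont)
  have bnd: "norm (f x * box_bump a b n x) \<le> norm (indicator (cbox a b) x *\<^sub>R f x)" for n x
  proof -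
    have "\<bar>box_bump a b n x\<bar> \<le> indicator (box a b) x" 
      using box_bump_bounds[where a=a and b=b and n=n and x=x] by simp
    also have "\<dots> \<le> indicator (cbox a b) x" using box_subset_cbox[of a b] by (auto simp: indicator_def)
    finally show ?thesis by (simp add: abs_mult mult_mono mult.commute[of "\<bar>f x\<bar>"] mult_right_mono)
  qed
  have m2: "(\<lambda>x. f x * indicator (box a b) x) \<in> borel_measurable lebesgue"
    by (intro borel_measurable_times borel_measurable_indicator locally_integrable_measurable f) auto
  have lim: "AE x in lebesgue. (\<lambda>n. f x * box_bump a b n x) \<longlonglongrightarrow> f x * indicator (box a b) x"
    by (intro AE_I2 tendsto_intros box_bump_tendsto)
  have *: "(\<lambda>n. LINT x|lebesgue. f x * box_bump a b n x) \<longlonglongrightarrow> (LINT x|lebesgue. f x * indicator (box a b) x)"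
    by (rule integral_dominated_convergence[OF m2 m w lim]) (use bnd in auto)
  show "integrable lebesgue (\<lambda>x. f x * indicator (box a b) x)"
    by (rule integrable_dominated_convergence[OF m2 m w lim]) (use bnd in auto)
  show "(LINT x|lebesgue. f x * indicator (box a b) x) = 0"
    using * 0[OF test_function_box_bump] by (simp add: LIMSEQ_const_iff)
qed

lemma nn_integral_pos_neg_eq:
  fixes F :: "'a \<Rightarrow> real"
  assumes "integrable M F" "integral\<^sup>L M F = 0"
  shows "(\<integral>\<^sup>+x. ennreal (F x) \<partial>M) = (\<integral>\<^sup>+x. ennreal (- F x) \<partial>M)"
    "(\<integral>\<^sup>+x. ennreal (F x) \<partial>M) \<noteq> \<infinity>"
proof -
  have fin: "(\<integral>\<^sup>+x. ennreal (F x) \<partial>M) \<noteq> \<infinity>" "(\<integral>\<^sup>+x. ennreal (- F x) \<partial>M) \<noteq> \<infinity>"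
    using assms(1) by (auto simp: real_integrable_def)
  then show "(\<integral>\<^sup>+x. ennreal (F x) \<partial>M) \<noteq> \<infinity>" by simp
  have "enn2real (\<integral>\<^sup>+x. ennreal (F x) \<partial>M) = enn2real (\<integral>\<^sup>+x. ennreal (- F x) \<partial>M)"
    using assms by (simp add: real_lebesgue_integral_def)
  then show "(\<integral>\<^sup>+x. ennreal (F x) \<partial>M) = (\<integral>\<^sup>+x. ennreal (- F x) \<partial>M)"
    using fin by (metis ennreal_enn2real top.not_eq_extremum infinity_ennreal_def)
qed

text \<open>The positive and negative parts of \<open>f\<close>, cut off to a large box, are
  densities of two measures. They agree on all boxes, hence are equal, hence so are their densities
  almost everywhere.\<close>

lemma fundamental_lemma_variations:
  fixes f :: "R3 \<Rightarrow> real"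
  assumes f: "locally_integrable f"
    and 0: "\<And>\<phi>. test_function \<phi> \<Longrightarrow> (LINT x|lebesgue. f x * \<phi> x) = 0"
  shows "AE x in lebesgue. f x = 0"
proof -
  \<comment> \<open>Boxes generate only the Borel sets, so the comparison of measures is carried out
    for a Borel representative over \<open>lborel\<close>.\<close>
  obtain f' where [measurable]: "f' \<in> borel_measurable borel" and eq: "AE x in lborel. f x = f' x"
    using completion_ex_borel_measurable_real[OF locally_integrable_measurable[OF f]] by auto
  have [measurable]: "f' \<in> borel_measurable lebesgue" by (intro borel_measurable_lebesgueI) fact
  have eq': "AE x in lebesgue. f x = f' x" using eq by (rule AE_completion)
  note [measurable] = locally_integrable_measurable[OF f]
  have int: "integrable lborel (\<lambda>x. f' x * indicator (box a b) x)" "(LINT x|lborel. f' x * indicator (box a b) x) = 0" for a b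
  proof -
    have "integrable lebesgue (\<lambda>x. f' x * indicator (box a b) x)"
      using integral_box_eq_0(1)[OF f 0] by (rule integrable_cong_AE_imp) (use eq' in \<open>auto intro!: borel_measurable_times borel_measurable_indicator\<close>)
    then show "integrable lborel (\<lambda>x. f' x * indicator (box a b) x)"
      by (simp add: integrable_completion)
    have "(LINT x|lborel. f' x * indicator (box a b) x) = (LINT x|lebesgue. f' x * indicator (box a b) x)"
      by (simp add: integral_completion)
    also have "\<dots> = (LINT x|lebesgue. f x * indicator (box a b) x)"
      by (intro integral_cong_AE) (use eq' locally_integrable_measurable[OF f] in \<open>auto intro!: borel_measurable_times borel_measurable_indicator\<close>)
    finally show "(LINT x|lborel. f' x * indicator (box a b) x) = 0"
      using integral_box_eq_0(2)[OF f 0] by simp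
  qed
  define B :: "nat \<Rightarrow> R3 set" where "B n = box (- (real n *\<^sub>R One)) (real n *\<^sub>R One)" for n
  have main: "AE x in lborel. f' x * indicator (B N) x = 0" for N
  proof -
    define p where "p x = ennreal (f' x * indicator (B N) x)" for x
    define m where "m x = ennreal (- (f' x * indicator (B N) x))" for x
    have [measurable]: "p \<in> borel_measurable borel" "m \<in> borel_measurable borel" "B N \<in> sets borel"
      unfolding p_def m_def B_def by measurable
    have em: "emeasure (density lborel p) (box a b) = (\<integral>\<^sup>+x. ennreal (f' x * indicator (B N \<inter> box a b) x) \<partial>lborel)"
       "emeasure (density lborel m) (box a b) = (\<integral>\<^sup>+x. ennreal (- (f' x * indicator (B N \<inter> box a b) x)) \<partial>lborel)" for a b
      by (auto simp: emeasure_density p_def m_def indicator_def intro!: nn_integral_cong)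
    have "\<exists>c d. B N \<inter> box a b = box c d" for a b
      unfolding B_def by (auto simp: box_Int_box)
    then have e: "emeasure (density lborel p) (box a b) = emeasure (density lborel m) (box a b)"
       "emeasure (density lborel p) (box a b) \<noteq> \<infinity>" for a b
      using nn_integral_pos_neg_eq[OF int] by (metis em)+
    have "density lborel p = density lborel m"
    proof (rule measure_eqI_generator_eq)
      let ?E = "range (\<lambda>(a, b). box a b::R3 set)"
      show "Int_stable ?E" by (auto simp: Int_stable_def box_Int_box)
      show "?E \<subseteq> Pow UNIV" "sets (density lborel p) = sigma_sets UNIV ?E" "sets (density lborel m) = sigma_sets UNIV ?E"
        by (simp_all add: borel_eq_box)
      show "range B \<subseteq> ?E" "(\<Union>i. B i) = UNIV"
        unfolding B_def UN_box_eq_UNIV by auto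
      show "emeasure (density lborel p) (B i) \<noteq> \<infinity>" for i
        unfolding B_def by (rule e)
      show "emeasure (density lborel p) X = emeasure (density lborel m) X" if "X \<in> ?E" for X
        using that e by auto
    qed
    then have "AE x in lborel. p x = m x"
      by (intro sigma_finite_measure.density_unique[OF sigma_finite_lborel]) auto
    \<comment> \<open>At each point at most one of the truncated parts \<open>p\<close> and
      \<open>m\<close> is nonzero, so their equality forces both to vanish.\<close>
    then show ?thesis
      by eventually_elim (auto simp: p_def m_def ennreal_eq_0_iff indicator_def split: if_splits, metis ennreal_eq_0_iff ennreal_neg linear neg_0_le_iff_le neg_le_0_iff_le order_antisym)
  qed
  have all: "AE x in lborel. \<forall>N. f' x * indicator (B N) x = 0"
    using main unfolding AE_all_countable by blast
  have cover: "\<exists>N. x \<in> B N" for x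
    using UN_box_eq_UNIV unfolding B_def by blast
  from all have "AE x in lborel. f' x = 0"
    by eventually_elim (use cover in \<open>metis indicator_simps(1) mult.right_neutral\<close>)
  then show ?thesis using eq' AE_completion by fastforce
qed

section \<open>Weak gradients\<close>

lemma test_function_C_k: "test_function \<phi> \<Longrightarrow> C_k k \<phi>"
  by (simp add: test_function_def)

lemma test_function_continuous: "test_function \<phi> \<Longrightarrow> continuous_on UNIV \<phi>"
  using test_function_C_k[of \<phi> 0] by simp

lemma test_function_has_derivative:
  "test_function \<phi> \<Longrightarrow> (\<phi> has_derivative frechet_derivative \<phi> (at x)) (at x)"
  using test_function_C_k[of \<phi> "Suc 0"] by (simp add: frechet_derivative_works)

lemma test_function_support:
  assumes "test_function \<phi>"
  obtains K where "compact K" "\<And>x. x \<notin> K \<Longrightarrow> \<phi> x = 0"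
  using assms closure_subset[of "{x. \<phi> x \<noteq> 0}"]
  by (intro that[of "closure {x. \<phi> x \<noteq> 0}"]) (auto simp: test_function_def)

lemma test_functionI:
  assumes "\<And>k. C_k k \<phi>" "compact K" "\<And>x. x \<notin> K \<Longrightarrow> \<phi> x = 0"
  shows "test_function \<phi>"
proof -
  have "closure {x. \<phi> x \<noteq> 0} \<subseteq> K"
    using assms(2,3) by (intro closure_minimal) (auto simp: compact_imp_closed)
  then have "compact (closure {x. \<phi> x \<noteq> 0})"
    by (meson assms(2) bounded_subset closed_closure compact_eq_bounded_closed)
  then show ?thesis using assms(1) by (simp add: test_function_def)
qed

lemma test_function_bounded:
  assumes "test_function \<phi>"
  obtains B where "\<And>x. \<bar>\<phi> x\<bar> \<le> B"
proof -
  obtain K where K: "compact K" "\<And>x. x \<notin> K \<Longrightarrow> \<phi> x = 0"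
    using test_function_support[OF assms] by blast
  have "compact (\<phi> ` K)"
    using K(1) test_function_continuous[OF assms] by (intro compact_continuous_image) (auto intro: continuous_on_subset)
  then obtain B where B: "\<forall>y\<in>\<phi> ` K. norm y \<le> B"
    using compact_imp_bounded bounded_iff by metis
  have "\<bar>\<phi> x\<bar> \<le> max B 0" for x
    using B K(2)[of x] by (cases "x \<in> K") (auto simp: max_def)
  then show ?thesis by (rule that)
qed

lemma test_function_directional_derivative:
  assumes "test_function \<phi>"
  shows "test_function (\<lambda>x. frechet_derivative \<phi> (at x) v)"
proof -
  obtain K where K: "compact K" "\<And>x. x \<notin> K \<Longrightarrow> \<phi> x = 0"
    using test_function_support[OF assms] by blast
  show ?thesis
  proof (rule test_functionI[OF _ K(1)])
    show "C_k k (\<lambda>x. frechet_derivative \<phi> (at x) v)" for k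
      using test_function_C_k[OF assms, of "Suc k"] by simp
    fix x assume x: "x \<notin> K"
    have "((\<lambda>x. 0) has_derivative (\<lambda>v. 0)) (at x)" by simp
    then have "(\<phi> has_derivative (\<lambda>v. 0)) (at x)"
      by (rule has_derivative_transform_within_open[of _ _ _ _ "- K"])
         (use x K compact_imp_closed in \<open>auto simp: open_Compl\<close>)
    then have "frechet_derivative \<phi> (at x) = (\<lambda>v. 0)"
      using frechet_derivative_at by metis
    then show "frechet_derivative \<phi> (at x) v = 0" by simp
  qed
qed

lemma has_derivative_translate:
  assumes "\<And>x::R3. (f has_derivative f' x) (at x)"
  shows "((\<lambda>x. f (x + h)) has_derivative f' (x + h)) (at x)"
proof -
  have "((\<lambda>x. x + h) has_derivative (\<lambda>v. v)) (at x)"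
    by (auto intro!: derivative_eq_intros)
  from has_derivative_compose[OF this assms] show ?thesis .
qed

lemma C_k_translate: "C_k k f \<Longrightarrow> C_k k (\<lambda>x. f (x + h))"
proof (induction k arbitrary: f)
  case 0
  then have "continuous_on UNIV (f \<circ> (\<lambda>x::R3. x + h))"
    by (intro continuous_on_compose continuous_intros) (auto intro: continuous_on_subset)
  then show ?case by (simp add: o_def)
next
  case (Suc k)
  from Suc.prems obtain f' where f': "\<And>x. (f has_derivative f' x) (at x)" "\<And>v. C_k k (\<lambda>x. f' x v)"
    by (rule C_k_Suc_derivative) blast
  show ?case
    by (rule C_k_SucI[OF has_derivative_translate[OF f'(1)]]) (rule Suc.IH[OF f'(2)])
qed

lemma test_function_translate:
  assumes "test_function \<phi>"
  shows "test_function (\<lambda>x. \<phi> (x + h))"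
    "frechet_derivative (\<lambda>x. \<phi> (x + h)) (at x) = frechet_derivative \<phi> (at (x + h))"
proof -
  obtain K where K: "compact K" "\<And>x. x \<notin> K \<Longrightarrow> \<phi> x = 0"
    using test_function_support[OF assms] by blast
  show "test_function (\<lambda>x. \<phi> (x + h))"
  proof (rule test_functionI)
    show "C_k k (\<lambda>x. \<phi> (x + h))" for k
      by (rule C_k_translate[OF test_function_C_k[OF assms]])
    show "compact ((\<lambda>x. - h + x) ` K)" using K(1) by (rule compact_translation)
    fix x assume "x \<notin> (\<lambda>x. - h + x) ` K"
    then have "x + h \<notin> K" by (auto simp: image_iff algebra_simps)
    then show "\<phi> (x + h) = 0" by (rule K)
  qed
  show "frechet_derivative (\<lambda>x. \<phi> (x + h)) (at x) = frechet_derivative \<phi> (at (x + h))"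
    using has_derivative_translate[OF test_function_has_derivative[OF assms]] frechet_derivative_at
    by metis
qed

lemma locally_integrable_mult_test_function:
  fixes f :: "R3 \<Rightarrow> real"
  assumes f: "locally_integrable f" and \<phi>: "test_function \<phi>"
  shows "integrable lebesgue (\<lambda>x. f x * \<phi> x)"
proof -
  obtain K where K: "compact K" "\<And>x. x \<notin> K \<Longrightarrow> \<phi> x = 0"
    using test_function_support[OF \<phi>] by blast
  obtain B where B: "\<And>x. \<bar>\<phi> x\<bar> \<le> B" using test_function_bounded[OF \<phi>] by blast
  show ?thesis
  proof (rule Bochner_Integration.integrable_bound)
    show "integrable lebesgue (\<lambda>x. B *\<^sub>R (indicator K x *\<^sub>R f x))"
      by (intro integrable_scaleR_right locally_integrable_indicator f K)
    show "(\<lambda>x. f x * \<phi> x) \<in> borel_measurable lebesgue"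
      by (intro borel_measurable_times locally_integrable_measurable f borel_measurable_lebesgueI
          borel_measurable_continuous_onI test_function_continuous \<phi>)
    have "\<bar>f x\<bar> * \<bar>\<phi> x\<bar> \<le> \<bar>B\<bar> * \<bar>f x\<bar>" for x
      using mult_left_mono[OF order_trans[OF B[of x] abs_ge_self], of "\<bar>f x\<bar>"] by (simp add: mult.commute)
    then show "AE x in lebesgue. norm (f x * \<phi> x) \<le> norm (B *\<^sub>R (indicator K x *\<^sub>R f x))"
      using K(2) by (auto simp: abs_mult indicator_def)
  qed
qed

lemma locally_integrable_component:
  "locally_integrable g \<Longrightarrow> locally_integrable (\<lambda>x. g x $ i)" for g :: "R3 \<Rightarrow> R3"
  unfolding locally_integrable_def
proof (intro allI impI)
  fix K :: "R3 set"
  assume "\<forall>K. compact K \<longrightarrow> g absolutely_integrable_on K" "compact K"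
  then have "integrable lebesgue (\<lambda>x. (indicator K x *\<^sub>R g x) \<bullet> axis i 1)"
    by (intro integrable_inner_left) (auto simp: set_integrable_def)
  then show "(\<lambda>x. g x $ i) absolutely_integrable_on K"
    by (simp add: set_integrable_def inner_axis)
qed

lemma locally_integrable_lincomb:
  assumes "locally_integrable f" "locally_integrable g"
  shows "locally_integrable (\<lambda>x. a *\<^sub>R f x + b *\<^sub>R g x)"
  unfolding locally_integrable_def
proof (intro allI impI)
  fix K :: "R3 set"
  assume "compact K"
  then have "integrable lebesgue (\<lambda>x. a *\<^sub>R (indicator K x *\<^sub>R f x) + b *\<^sub>R (indicator K x *\<^sub>R g x))"
    by (intro Bochner_Integration.integrable_add integrable_scaleR_right locally_integrable_indicator assms)
  then show "(\<lambda>x. a *\<^sub>R f x + b *\<^sub>R g x) absolutely_integrable_on K"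
    by (simp add: set_integrable_def scaleR_add_right mult.commute)
qed

lemma has_weak_gradient_lincomb:
  assumes "locally_integrable u" "has_weak_gradient u g" "locally_integrable v" "has_weak_gradient v k"
  shows "has_weak_gradient (\<lambda>x. a * u x + b * v x) (\<lambda>x. a *\<^sub>R g x + b *\<^sub>R k x)"
  unfolding has_weak_gradient_def
proof (intro conjI allI impI)
  have lg: "locally_integrable g" "locally_integrable k"
    using assms by (auto simp: has_weak_gradient_def)
  show "locally_integrable (\<lambda>x. a *\<^sub>R g x + b *\<^sub>R k x)"
    by (intro locally_integrable_lincomb lg)
  fix \<phi> :: "R3 \<Rightarrow> real" and i :: 3 assume \<phi>: "test_function \<phi>"
  note d = test_function_directional_derivative[OF \<phi>, of "axis i 1"]
  have "(LINT x|lebesgue. (a * u x + b * v x) * frechet_derivative \<phi> (at x) (axis i 1)) =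
     (LINT x|lebesgue. a * (u x * frechet_derivative \<phi> (at x) (axis i 1)) + b * (v x * frechet_derivative \<phi> (at x) (axis i 1)))"
    by (simp add: algebra_simps)
  also have "\<dots> = a * (LINT x|lebesgue. u x * frechet_derivative \<phi> (at x) (axis i 1)) + b * (LINT x|lebesgue. v x * frechet_derivative \<phi> (at x) (axis i 1))"
    by (subst Bochner_Integration.integral_add) (auto intro!: integrable_mult_right locally_integrable_mult_test_function assms d)
  also have "\<dots> = - (a * (LINT x|lebesgue. g x $ i * \<phi> x) + b * (LINT x|lebesgue. k x $ i * \<phi> x))"
    using assms \<phi> by (simp add: has_weak_gradient_def)
  also have "\<dots> = - (LINT x|lebesgue. a * (g x $ i * \<phi> x) + b * (k x $ i * \<phi> x))"
    by (subst Bochner_Integration.integral_add) (auto intro!: integrable_mult_right locally_integrable_mult_test_function locally_integrable_component lg \<phi>)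
  also have "\<dots> = - (LINT x|lebesgue. (a *\<^sub>R g x + b *\<^sub>R k x) $ i * \<phi> x)"
    by (simp add: algebra_simps)
  finally show "(LINT x|lebesgue. (a * u x + b * v x) * frechet_derivative \<phi> (at x) (axis i 1)) =
      - (LINT x|lebesgue. (a *\<^sub>R g x + b *\<^sub>R k x) $ i * \<phi> x)" .
qed

text \<open>The fundamental lemma applied to each component of the difference. Through this the
  arbitrary choice in \<open>weak_grad\<close> becomes linear almost everywhere.\<close>

lemma has_weak_gradient_unique:
  assumes "has_weak_gradient u g" "has_weak_gradient u k"
  shows "AE x in lebesgue. g x = k x"
proof -
  have lg: "locally_integrable g" "locally_integrable k"
    using assms by (auto simp: has_weak_gradient_def)
  have "AE x in lebesgue. g x $ i - k x $ i = 0" for i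
  proof (rule fundamental_lemma_variations)
    show "locally_integrable (\<lambda>x. g x $ i - k x $ i)"
      using locally_integrable_lincomb[OF lg[THEN locally_integrable_component[of _ i]], of 1 "-1"] by simp
    fix \<phi> :: "R3 \<Rightarrow> real" assume \<phi>: "test_function \<phi>"
    have "(LINT x|lebesgue. g x $ i * \<phi> x) = (LINT x|lebesgue. k x $ i * \<phi> x)"
    proof -
      have "(LINT x|lebesgue. u x * frechet_derivative \<phi> (at x) (axis i 1)) = - (LINT x|lebesgue. g x $ i * \<phi> x)"
        "(LINT x|lebesgue. u x * frechet_derivative \<phi> (at x) (axis i 1)) = - (LINT x|lebesgue. k x $ i * \<phi> x)"
        using assms \<phi> unfolding has_weak_gradient_def by blast+
      then show ?thesis by linarith
    qed
    moreover have "(LINT x|lebesgue. (g x $ i - k x $ i) * \<phi> x) = (LINT x|lebesgue. g x $ i * \<phi> x) - (LINT x|lebesgue. k x $ i * \<phi> x)"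
      unfolding left_diff_distrib
      by (intro Bochner_Integration.integral_diff locally_integrable_mult_test_function locally_integrable_component lg \<phi>)
    ultimately show "(LINT x|lebesgue. (g x $ i - k x $ i) * \<phi> x) = 0" by simp
  qed
  then have "AE x in lebesgue. \<forall>i. g x $ i - k x $ i = 0" by (simp add: AE_all_countable)
  then show ?thesis by eventually_elim (simp add: vec_eq_iff)
qed

lemma has_weak_gradient_weak_grad: "u \<in> W11loc \<Longrightarrow> has_weak_gradient u (weak_grad u)"
  unfolding W11loc_def weak_grad_def by (simp add: someI_ex)

lemma W11loc_lincomb:
  assumes "u \<in> W11loc" "v \<in> W11loc"
  shows "(\<lambda>x. a * u x + b * v x) \<in> W11loc"
    "AE x in lebesgue. weak_grad (\<lambda>x. a * u x + b * v x) x = a *\<^sub>R weak_grad u x + b *\<^sub>R weak_grad v x"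
proof -
  have l: "locally_integrable u" "locally_integrable v" using assms by (auto simp: W11loc_def)
  have g: "has_weak_gradient (\<lambda>x. a * u x + b * v x) (\<lambda>x. a *\<^sub>R weak_grad u x + b *\<^sub>R weak_grad v x)"
    by (intro has_weak_gradient_lincomb l has_weak_gradient_weak_grad assms)
  moreover show W: "(\<lambda>x. a * u x + b * v x) \<in> W11loc"
    using g locally_integrable_lincomb[OF l, of a b] by (auto simp: W11loc_def)
  ultimately show "AE x in lebesgue. weak_grad (\<lambda>x. a * u x + b * v x) x = a *\<^sub>R weak_grad u x + b *\<^sub>R weak_grad v x"
    by (intro has_weak_gradient_unique[OF has_weak_gradient_weak_grad])
qed

text \<open>The definition tests coordinate directions only; linearity of the Frechet derivative of
  the test function extends the identity to an arbitrary direction, here the translation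
  vector.\<close>

lemma has_weak_gradient_direction:
  assumes u: "locally_integrable u" "has_weak_gradient u g" and \<phi>: "test_function \<phi>"
  shows "(LINT x|lebesgue. u x * frechet_derivative \<phi> (at x) h) = - (LINT x|lebesgue. (h \<bullet> g x) * \<phi> x)"
proof -
  have lg: "locally_integrable g" using u by (simp add: has_weak_gradient_def)
  have "frechet_derivative \<phi> (at x) h = (\<Sum>i\<in>UNIV. h $ i * frechet_derivative \<phi> (at x) (axis i 1))" for x
  proof -
    interpret linear "frechet_derivative \<phi> (at x)"
      using test_function_has_derivative[OF \<phi>] has_derivative_linear by blast
    have "h = (\<Sum>i\<in>UNIV. h $ i *\<^sub>R axis i 1)" 
      using basis_expansion[of h] by (simp add: scalar_mult_eq_scaleR)
    then have "frechet_derivative \<phi> (at x) h = frechet_derivative \<phi> (at x) (\<Sum>i\<in>UNIV. h $ i *\<^sub>R axis i 1)" by simp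
    also have "\<dots> = (\<Sum>i\<in>UNIV. h $ i * frechet_derivative \<phi> (at x) (axis i 1))"
      by (simp add: sum scale)
    finally show ?thesis .
  qed
  then have "(LINT x|lebesgue. u x * frechet_derivative \<phi> (at x) h) =
      (LINT x|lebesgue. (\<Sum>i\<in>UNIV. h $ i * (u x * frechet_derivative \<phi> (at x) (axis i 1))))"
    by (simp add: sum_distrib_left mult.left_commute)
  also have "\<dots> = (\<Sum>i\<in>UNIV. h $ i * (LINT x|lebesgue. u x * frechet_derivative \<phi> (at x) (axis i 1)))"
    by (subst Bochner_Integration.integral_sum)
       (auto intro!: integrable_mult_right locally_integrable_mult_test_function u test_function_directional_derivative \<phi>)
  also have "\<dots> = - (\<Sum>i\<in>UNIV. h $ i * (LINT x|lebesgue. g x $ i * \<phi> x))"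
    using u \<phi> by (simp add: has_weak_gradient_def sum_negf)
  also have "(\<Sum>i\<in>UNIV. h $ i * (LINT x|lebesgue. g x $ i * \<phi> x)) = (LINT x|lebesgue. (\<Sum>i\<in>UNIV. h $ i * (g x $ i * \<phi> x)))"
    by (subst Bochner_Integration.integral_sum)
       (auto intro!: integrable_mult_right locally_integrable_mult_test_function locally_integrable_component lg \<phi>)
  also have "\<dots> = (LINT x|lebesgue. (h \<bullet> g x) * \<phi> x)"
    by (simp add: inner_vec_def sum_distrib_right mult.assoc)
  finally show ?thesis .
qed

section \<open>Translation estimate\<close>

lemma nn_integral_lborel_translate:
  fixes f :: "'a::euclidean_space \<Rightarrow> ennreal"
  assumes [measurable]: "f \<in> borel_measurable borel"
  shows "(\<integral>\<^sup>+x. f (x + c) \<partial>lborel) = (\<integral>\<^sup>+x. f x \<partial>lborel)"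
proof -
  have "(\<integral>\<^sup>+x. f x \<partial>lborel) = (\<integral>\<^sup>+x. f x \<partial>distr lborel borel ((+) c))"
    by (simp only: lborel_distr_plus)
  also have "\<dots> = (\<integral>\<^sup>+x. f (c + x) \<partial>lborel)"
    by (subst nn_integral_distr) auto
  finally show ?thesis by (simp add: add.commute)
qed

lemma integral_lborel_translate:
  fixes f :: "'a::euclidean_space \<Rightarrow> real"
  assumes [measurable]: "f \<in> borel_measurable borel"
  shows "(LINT x|lborel. f (x + c)) = (LINT x|lborel. f x)"
proof -
  have "(LINT x|lborel. f x) = (LINT x|distr lborel borel ((+) c). f x)"
    by (simp only: lborel_distr_plus)
  also have "\<dots> = (LINT x|lborel. f (c + x))"
    by (subst integral_distr) auto
  finally show ?thesis by (simp add: add.commute)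
qed

text \<open>Expand the nonnegative integral of w (f - c)^2, where c is the weighted mean and the
  weight has total mass 1.\<close>

lemma jensen_square:
  fixes w f :: "'a \<Rightarrow> real"
  assumes [measurable]: "w \<in> borel_measurable M" "f \<in> borel_measurable M"
    and w: "\<And>x. 0 \<le> w x" "(\<integral>\<^sup>+x. ennreal (w x) \<partial>M) = 1"
  shows "ennreal ((LINT x|M. w x * f x)\<^sup>2) \<le> (\<integral>\<^sup>+x. ennreal (w x * (f x)\<^sup>2) \<partial>M)"
proof (cases "integrable M (\<lambda>x. w x * f x) \<and> (\<integral>\<^sup>+x. ennreal (w x * (f x)\<^sup>2) \<partial>M) \<noteq> \<infinity>")
  case True
  define c where "c = (LINT x|M. w x * f x)"
  have i1: "integrable M w" "(LINT x|M. w x) = 1"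
    using w by (auto intro!: integrableI_nonneg simp: integral_eq_nn_integral)
  have i2: "integrable M (\<lambda>x. w x * (f x)\<^sup>2)"
    using True w by (intro integrableI_nonneg) (auto simp: less_top)
  have "0 \<le> (LINT x|M. w x * (f x - c)\<^sup>2)"
    using w by (intro Bochner_Integration.integral_nonneg) auto
  also have "\<dots> = (LINT x|M. w x * (f x)\<^sup>2 - (2 * c) * (w x * f x) + c\<^sup>2 * w x)"
    by (intro Bochner_Integration.integral_cong) (auto simp: power2_eq_square algebra_simps)
  also have "\<dots> = (LINT x|M. w x * (f x)\<^sup>2) - (2 * c) * (LINT x|M. w x * f x) + c\<^sup>2 * (LINT x|M. w x)"
    using True i1 i2 by (subst Bochner_Integration.integral_add Bochner_Integration.integral_diff; auto)+
  finally have "c\<^sup>2 \<le> (LINT x|M. w x * (f x)\<^sup>2)"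
    using i1(2) by (simp add: c_def[symmetric] power2_eq_square)
  then show ?thesis
    unfolding c_def[symmetric] using i2 w by (subst nn_integral_eq_integral) (auto intro: ennreal_leI)
next
  case False
  \<comment> \<open>Both exceptional cases are trivial: a Bochner integral of a non-integrable
    function is 0 by convention, and otherwise the right-hand side is infinite.\<close>
  then consider "\<not> integrable M (\<lambda>x. w x * f x)" | "(\<integral>\<^sup>+x. ennreal (w x * (f x)\<^sup>2) \<partial>M) = \<infinity>" by auto
  then show ?thesis by cases (auto simp: not_integrable_integral_eq)
qed

text \<open>Supplies the integrability for Fubini in the segment formula. For s in [0,1] the
  translate of the bounded function by s h lives in the ball of radius R + |h|, where
  \<open>f\<close> is integrable; the first form arises from the second by translating x.\<close>

lemma integrable_translate_product:
  fixes f \<psi> :: "R3 \<Rightarrow> real"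
  assumes f: "locally_integrable f" and [measurable]: "f \<in> borel_measurable borel"
    and [measurable]: "\<psi> \<in> borel_measurable borel"
    and B: "\<And>x. \<bar>\<psi> x\<bar> \<le> B" and R: "\<And>x. x \<notin> cball 0 R \<Longrightarrow> \<psi> x = 0"
  shows "integrable (lborel \<Otimes>\<^sub>M lborel) (\<lambda>(x, s). indicator {0..1::real} s * f (x + s *\<^sub>R h) * \<psi> x)"
    "integrable (lborel \<Otimes>\<^sub>M lborel) (\<lambda>(x, s). indicator {0..1::real} s * f x * \<psi> (x - s *\<^sub>R h))"
proof -
  define C where "C = (\<integral>\<^sup>+x. ennreal \<bar>indicator (cball 0 (R + norm h)) x *\<^sub>R f x\<bar> \<partial>lborel)"
  have [measurable]: "cball 0 (R + norm h) \<in> sets (borel :: R3 measure)" by simp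
  have C: "C < \<infinity>"
    using locally_integrable_indicator[OF f compact_cball[of 0 "R + norm h"]]
    by (simp add: C_def integrable_iff_bounded nn_integral_completion)
  have m: "(\<lambda>(x, s). indicator {0..1::real} s * f x * \<psi> (x - s *\<^sub>R h)) \<in> borel_measurable (lborel \<Otimes>\<^sub>M lborel)"
    "(\<lambda>(x, s). indicator {0..1::real} s * f (x + s *\<^sub>R h) * \<psi> x) \<in> borel_measurable (lborel \<Otimes>\<^sub>M lborel)"
    unfolding split_beta' by measurable
  have key: "(\<integral>\<^sup>+x. ennreal (norm (indicator {0..1} s * f x * \<psi> (x - s *\<^sub>R h))) \<partial>lborel)
      \<le> ennreal B * C * indicator {0..1} s" for s :: real
  proof (cases "s \<in> {0..1}")
    case True
    have "(\<integral>\<^sup>+x. ennreal (norm (indicator {0..1} s * f x * \<psi> (x - s *\<^sub>R h))) \<partial>lborel)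
        \<le> (\<integral>\<^sup>+x. ennreal B * ennreal \<bar>indicator (cball 0 (R + norm h)) x *\<^sub>R f x\<bar> \<partial>lborel)"
    proof (rule nn_integral_mono)
      fix x :: R3
      show "ennreal (norm (indicator {0..1} s * f x * \<psi> (x - s *\<^sub>R h)))
        \<le> ennreal B * ennreal \<bar>indicator (cball 0 (R + norm h)) x *\<^sub>R f x\<bar>"
      proof (cases "x \<in> cball 0 (R + norm h)")
        case x: True
        have "\<bar>f x\<bar> * \<bar>\<psi> (x - s *\<^sub>R h)\<bar> \<le> \<bar>f x\<bar> * B" by (intro mult_left_mono B) auto
        then show ?thesis using True x B[of 0]
          by (auto simp: abs_mult mult.commute[of _ "\<bar>f x\<bar>"] ennreal_mult[symmetric] intro!: ennreal_leI)
      next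
        case x: False
        have "norm x \<le> norm (x - s *\<^sub>R h) + norm (s *\<^sub>R h)"
          by (metis diff_add_cancel norm_triangle_ineq)
        moreover have "norm (s *\<^sub>R h) \<le> norm h" using True by (simp add: mult_left_le_one_le)
        ultimately have "x - s *\<^sub>R h \<notin> cball 0 R" using x by auto
        then show ?thesis by (simp add: R)
      qed
    qed
    also have "\<dots> = ennreal B * C" unfolding C_def by (intro nn_integral_cmult) measurable
    finally show ?thesis using True by simp
  qed simp
  have fin: "(\<integral>\<^sup>+s. ennreal B * C * indicator {0..1::real} s \<partial>lborel) < \<infinity>"
    using C by (simp add: nn_integral_cmult_indicator ennreal_mult_less_top)
  show "integrable (lborel \<Otimes>\<^sub>M lborel) (\<lambda>(x, s). indicator {0..1::real} s * f x * \<psi> (x - s *\<^sub>R h))"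
  proof (rule integrableI_bounded)
    have "(\<integral>\<^sup>+z. ennreal (norm (case z of (x, s) \<Rightarrow> indicator {0..1::real} s * f x * \<psi> (x - s *\<^sub>R h))) \<partial>(lborel \<Otimes>\<^sub>M lborel))
      = (\<integral>\<^sup>+s. \<integral>\<^sup>+x. ennreal (norm (indicator {0..1::real} s * f x * \<psi> (x - s *\<^sub>R h))) \<partial>lborel \<partial>lborel)"
      by (subst lborel_pair.nn_integral_snd[symmetric]) (simp_all add: m)
    also have "\<dots> \<le> (\<integral>\<^sup>+s. ennreal B * C * indicator {0..1::real} s \<partial>lborel)"
      by (intro nn_integral_mono key)
    finally show "(\<integral>\<^sup>+z. ennreal (norm (case z of (x, s) \<Rightarrow> indicator {0..1::real} s * f x * \<psi> (x - s *\<^sub>R h))) \<partial>(lborel \<Otimes>\<^sub>M lborel)) < \<infinity>"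
      using fin by (rule le_less_trans)
  qed (rule m)
  have tr: "(\<integral>\<^sup>+x. ennreal (norm (indicator {0..1} s * f (x + s *\<^sub>R h) * \<psi> x)) \<partial>lborel)
     = (\<integral>\<^sup>+x. ennreal (norm (indicator {0..1} s * f x * \<psi> (x - s *\<^sub>R h))) \<partial>lborel)" for s :: real
    using nn_integral_lborel_translate[of "\<lambda>x. ennreal (norm (indicator {0..1} s * f x * \<psi> (x - s *\<^sub>R h)))" "s *\<^sub>R h"]
    by simp
  show "integrable (lborel \<Otimes>\<^sub>M lborel) (\<lambda>(x, s). indicator {0..1::real} s * f (x + s *\<^sub>R h) * \<psi> x)"
  proof (rule integrableI_bounded)
    have "(\<integral>\<^sup>+z. ennreal (norm (case z of (x, s) \<Rightarrow> indicator {0..1::real} s * f (x + s *\<^sub>R h) * \<psi> x)) \<partial>(lborel \<Otimes>\<^sub>M lborel))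
      = (\<integral>\<^sup>+s. \<integral>\<^sup>+x. ennreal (norm (indicator {0..1::real} s * f (x + s *\<^sub>R h) * \<psi> x)) \<partial>lborel \<partial>lborel)"
      by (subst lborel_pair.nn_integral_snd[symmetric]) (simp_all add: m)
    also have "\<dots> \<le> (\<integral>\<^sup>+s. ennreal B * C * indicator {0..1::real} s \<partial>lborel)"
      unfolding tr by (intro nn_integral_mono key)
    finally show "(\<integral>\<^sup>+z. ennreal (norm (case z of (x, s) \<Rightarrow> indicator {0..1::real} s * f (x + s *\<^sub>R h) * \<psi> x)) \<partial>(lborel \<Otimes>\<^sub>M lborel)) < \<infinity>"
      using fin by (rule le_less_trans)
  qed (rule m)
qed

lemma locally_integrable_inner: "locally_integrable g \<Longrightarrow> locally_integrable (\<lambda>x. h \<bullet> g x)"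
  for g :: "R3 \<Rightarrow> R3"
  unfolding locally_integrable_def
proof (intro allI impI)
  fix K :: "R3 set"
  assume "\<forall>K. compact K \<longrightarrow> g absolutely_integrable_on K" "compact K"
  then have "integrable lebesgue (\<lambda>x. h \<bullet> (indicator K x *\<^sub>R g x))"
    by (intro integrable_inner_right) (auto simp: set_integrable_def)
  then show "(\<lambda>x. h \<bullet> g x) absolutely_integrable_on K"
    by (simp add: set_integrable_def)
qed

text \<open>The fundamental theorem of calculus for s -> -phi(y - s h), whose derivative is the
  derivative of phi at y - s h in direction h, the two signs cancelling.\<close>

lemma test_function_segment_integral:
  assumes \<phi>: "test_function \<phi>"
  shows "(LINT s|lborel. indicator {0..1::real} s * frechet_derivative \<phi> (at (y - s *\<^sub>R h)) h) = \<phi> y - \<phi> (y - h)"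
proof -
  have 1: "((\<lambda>s. - \<phi> (y - s *\<^sub>R h)) has_field_derivative frechet_derivative \<phi> (at (y - s *\<^sub>R h)) h) (at s)" for s :: real
  proof -
    interpret linear "frechet_derivative \<phi> (at (y - s *\<^sub>R h))"
      using test_function_has_derivative[OF \<phi>] has_derivative_linear by blast
    have "((\<lambda>s. y - s *\<^sub>R h) has_derivative (\<lambda>t. - (t *\<^sub>R h))) (at s)"
      by (auto intro!: derivative_eq_intros)
    from has_derivative_minus[OF has_derivative_compose[OF this test_function_has_derivative[OF \<phi>]]]
    show ?thesis
      unfolding has_field_derivative_def
      by (rule has_derivative_eq_rhs) (auto simp: neg scale fun_eq_iff)
  qed
  have "continuous_on UNIV ((\<lambda>x. frechet_derivative \<phi> (at x) h) \<circ> (\<lambda>s::real. y - s *\<^sub>R h))"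
    by (intro continuous_on_compose continuous_intros
        continuous_on_subset[OF test_function_continuous[OF test_function_directional_derivative[OF \<phi>]]]) auto
  then have 2: "isCont (\<lambda>s. frechet_derivative \<phi> (at (y - s *\<^sub>R h)) h) s" for s :: real
    by (simp add: o_def continuous_on_eq_continuous_at)
  show ?thesis
    using integral_FTC_Icc_real[of 0 1 "\<lambda>s. - \<phi> (y - s *\<^sub>R h)" "\<lambda>s. frechet_derivative \<phi> (at (y - s *\<^sub>R h)) h"] 1 2
    by (simp add: mult.commute)
qed

lemma test_function_cball:
  assumes "test_function \<phi>"
  obtains R where "\<And>x. x \<notin> cball 0 R \<Longrightarrow> \<phi> x = 0"
proof -
  obtain K where K: "compact K" "\<And>x. x \<notin> K \<Longrightarrow> \<phi> x = 0"
    using test_function_support[OF assms] by blast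
  obtain R where "\<forall>x\<in>K. norm x \<le> R" using compact_imp_bounded[OF K(1)] bounded_iff by metis
  then have "K \<subseteq> cball 0 R" by auto
  then show ?thesis using K(2) that by blast
qed

text \<open>Proved by duality. Tested against phi, Fubini and translation move the shift by s h onto
  phi, the weak gradient turns h . g into the derivative of phi along h, and integration over s
  leaves phi(x) - phi(x - h). Shifting back gives u(x + h) - u(x), and the fundamental lemma
  concludes.\<close>

lemma difference_eq_segment_integral:
  fixes u :: "R3 \<Rightarrow> real" and g :: "R3 \<Rightarrow> R3"
  assumes u: "locally_integrable u" "has_weak_gradient u g"
    and [measurable]: "u \<in> borel_measurable borel" "g \<in> borel_measurable borel"
  shows "AE x in lborel. u (x + h) - u x = (LINT s|lborel. indicator {0..1::real} s * (h \<bullet> g (x + s *\<^sub>R h)))"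
proof -
  define D where "D x = (LINT s|lborel. indicator {0..1::real} s * (h \<bullet> g (x + s *\<^sub>R h)))" for x
  have [measurable]: "D \<in> borel_measurable borel"
    unfolding D_def by measurable
  have lg: "locally_integrable (\<lambda>x. h \<bullet> g x)"
    using u by (intro locally_integrable_inner) (simp add: has_weak_gradient_def)
  \<comment> \<open>Stated for any bounded Borel function supported in a ball: test functions give
    the duality computation, and indicators of compact sets give the local integrability of
    \<open>D\<close>.\<close>
  have intD: "integrable lborel (\<lambda>x. D x * \<psi> x)"
    and intD': "(LINT x|lborel. D x * \<psi> x) = (LINT s|lborel. indicator {0..1::real} s * (LINT x|lborel. (h \<bullet> g x) * \<psi> (x - s *\<^sub>R h)))"
    if [measurable]: "\<psi> \<in> borel_measurable borel" and b: "\<And>x. \<bar>\<psi> x\<bar> \<le> B" "\<And>x. x \<notin> cball 0 R \<Longrightarrow> \<psi> x = 0" for \<psi> B R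
  proof -
    have i: "integrable (lborel \<Otimes>\<^sub>M lborel) (\<lambda>(x, s). indicator {0..1::real} s * (h \<bullet> g (x + s *\<^sub>R h)) * \<psi> x)"
      using b by (intro integrable_translate_product(1)[OF lg]) auto
    have "(LINT s|lborel. indicator {0..1::real} s * (h \<bullet> g (x + s *\<^sub>R h)) * \<psi> x) = D x * \<psi> x" for x
      unfolding D_def by (subst integral_mult_left_zero[symmetric]) simp
    then show "integrable lborel (\<lambda>x. D x * \<psi> x)"
      using lborel_pair.integrable_fst[OF i] by (simp add: D_def)
    have "(LINT x|lborel. D x * \<psi> x) = (LINT x|lborel. LINT s|lborel. indicator {0..1::real} s * (h \<bullet> g (x + s *\<^sub>R h)) * \<psi> x)"
      unfolding D_def by (subst integral_mult_left_zero[symmetric]) simp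
    also have "\<dots> = (LINT s|lborel. LINT x|lborel. indicator {0..1::real} s * (h \<bullet> g (x + s *\<^sub>R h)) * \<psi> x)"
      by (rule lborel_pair.Fubini_integral[symmetric]) (use i in simp)
    also have "\<dots> = (LINT s|lborel. indicator {0..1::real} s * (LINT x|lborel. (h \<bullet> g (x + s *\<^sub>R h)) * \<psi> x))"
      by (simp add: mult.assoc)
    also have "\<dots> = (LINT s|lborel. indicator {0..1::real} s * (LINT x|lborel. (h \<bullet> g x) * \<psi> (x - s *\<^sub>R h)))"
      using integral_lborel_translate[of "\<lambda>x. (h \<bullet> g x) * \<psi> (x - s *\<^sub>R h)" "s *\<^sub>R h" for s] by simp
    finally show "(LINT x|lborel. D x * \<psi> x) = (LINT s|lborel. indicator {0..1::real} s * (LINT x|lborel. (h \<bullet> g x) * \<psi> (x - s *\<^sub>R h)))" .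
  qed
  have lD: "locally_integrable D"
    unfolding locally_integrable_def
  proof (intro allI impI)
    fix K :: "R3 set" assume K: "compact K"
    then obtain R where "\<forall>x\<in>K. norm x \<le> R" using compact_imp_bounded bounded_iff by metis
    then have R: "K \<subseteq> cball 0 R" by auto
    have [measurable]: "K \<in> sets borel" using K by (simp add: borel_compact)
    have "integrable lborel (\<lambda>x. D x * indicator K x)"
      by (rule intD[of "indicator K" 1 R]) (use R in \<open>auto simp: indicator_def\<close>)
    then show "D absolutely_integrable_on K"
      by (simp add: set_integrable_def integrable_completion mult.commute)
  qed
  have lt: "locally_integrable (\<lambda>x. u (x + h))"
    unfolding locally_integrable_def
  proof (intro allI impI)
    fix K :: "R3 set" assume K: "compact K"
    have [measurable]: "K \<in> sets borel" using K by (simp add: borel_compact)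
    define K' where "K' = (\<lambda>x. h + x) ` K"
    have K': "compact K'" unfolding K'_def using K by (rule compact_translation)
    have [measurable]: "K' \<in> sets borel" using K' by (simp add: borel_compact)
    have i: "integrable lborel (\<lambda>x. indicator K' x *\<^sub>R u x)"
      using locally_integrable_indicator[OF u(1) K'] by (simp add: integrable_completion)
    have "integrable lborel (\<lambda>x. indicator K' (h + x) *\<^sub>R u (h + x))"
      using i by (subst (asm) lborel_distr_plus[symmetric, of h], subst (asm) integrable_distr_eq) auto
    moreover have "(indicator K' (h + x) :: real) = indicator K x" for x
      by (auto simp: K'_def indicator_def)
    ultimately show "(\<lambda>x. u (x + h)) absolutely_integrable_on K"
      by (simp add: set_integrable_def integrable_completion add.commute)
  qed
  have "AE x in lebesgue. u (x + h) - u x - D x = 0"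
  proof (rule fundamental_lemma_variations)
    have "locally_integrable (\<lambda>x. 1 *\<^sub>R (1 *\<^sub>R u (x + h) + (- 1) *\<^sub>R u x) + (- 1) *\<^sub>R D x)"
      by (intro locally_integrable_lincomb lt lD u)
    then show "locally_integrable (\<lambda>x. u (x + h) - u x - D x)" by simp
    fix \<phi> :: "R3 \<Rightarrow> real" assume \<phi>: "test_function \<phi>"
    have [measurable]: "\<phi> \<in> borel_measurable borel"
      by (intro borel_measurable_continuous_onI test_function_continuous \<phi>)
    define \<psi> where "\<psi> x = frechet_derivative \<phi> (at x) h" for x
    have \<psi>: "test_function \<psi>" unfolding \<psi>_def by (rule test_function_directional_derivative[OF \<phi>])
    have [measurable]: "\<psi> \<in> borel_measurable borel"
      by (intro borel_measurable_continuous_onI test_function_continuous \<psi>)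
    obtain B1 R1 where b1: "\<And>x. \<bar>\<phi> x\<bar> \<le> B1" "\<And>x. x \<notin> cball 0 R1 \<Longrightarrow> \<phi> x = 0"
      using test_function_bounded[OF \<phi>] test_function_cball[OF \<phi>] by metis
    obtain B2 R2 where b2: "\<And>x. \<bar>\<psi> x\<bar> \<le> B2" "\<And>x. x \<notin> cball 0 R2 \<Longrightarrow> \<psi> x = 0"
      using test_function_bounded[OF \<psi>] test_function_cball[OF \<psi>] by metis
    have "(LINT x|lborel. D x * \<phi> x) = (LINT s|lborel. indicator {0..1::real} s * (LINT x|lborel. (h \<bullet> g x) * \<phi> (x - s *\<^sub>R h)))"
      by (rule intD'[OF _ b1]) measurable
    also have "\<dots> = (LINT s|lborel. indicator {0..1::real} s * - (LINT x|lborel. u x * \<psi> (x - s *\<^sub>R h)))"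
    proof -
      have "(LINT x|lborel. (h \<bullet> g x) * \<phi> (x - s *\<^sub>R h)) = - (LINT x|lborel. u x * \<psi> (x - s *\<^sub>R h))" for s
      using has_weak_gradient_direction[OF u test_function_translate(1)[OF \<phi>, of "- (s *\<^sub>R h)"], of h]
      unfolding test_function_translate(2)[OF \<phi>] by (simp add: integral_completion \<psi>_def[symmetric])
      then show ?thesis by simp
    qed
    also have "\<dots> = - (LINT s|lborel. LINT x|lborel. indicator {0..1::real} s * u x * \<psi> (x - s *\<^sub>R h))"
      by (simp add: mult.assoc)
    also have "(LINT s|lborel. LINT x|lborel. indicator {0..1::real} s * u x * \<psi> (x - s *\<^sub>R h))
       = (LINT x|lborel. LINT s|lborel. indicator {0..1::real} s * u x * \<psi> (x - s *\<^sub>R h))"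
      by (rule lborel_pair.Fubini_integral) (rule integrable_translate_product(2)[OF u(1) _ _ b2]; measurable)
    also have "\<dots> = (LINT x|lborel. u x * \<phi> x - u x * \<phi> (x - h))"
    proof -
      have "(LINT s|lborel. indicator {0..1::real} s * u x * \<psi> (x - s *\<^sub>R h))
          = (LINT s|lborel. u x * (indicator {0..1::real} s * \<psi> (x - s *\<^sub>R h)))" for x
        by (simp add: mult_ac)
      then show ?thesis
        using test_function_segment_integral[OF \<phi>, of _ h] by (simp add: \<psi>_def[symmetric] right_diff_distrib)
    qed
    also have "(LINT x|lborel. u x * \<phi> x - u x * \<phi> (x - h)) = (LINT x|lborel. u x * \<phi> x) - (LINT x|lborel. u x * \<phi> (x - h))"
    proof (rule Bochner_Integration.integral_diff)
      show "integrable lborel (\<lambda>x. u x * \<phi> x)"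
        using locally_integrable_mult_test_function[OF u(1) \<phi>] by (simp add: integrable_completion)
      show "integrable lborel (\<lambda>x. u x * \<phi> (x - h))"
        using locally_integrable_mult_test_function[OF u(1) test_function_translate(1)[OF \<phi>, of "- h"]] by (simp add: integrable_completion)
    qed
    also have "(LINT x|lborel. u x * \<phi> (x - h)) = (LINT x|lborel. u (x + h) * \<phi> x)"
      using integral_lborel_translate[of "\<lambda>x. u x * \<phi> (x - h)" h] by simp
    finally have D: "(LINT x|lborel. D x * \<phi> x) = (LINT x|lborel. u (x + h) * \<phi> x) - (LINT x|lborel. u x * \<phi> x)" by simp
    have i: "integrable lebesgue (\<lambda>x. u (x + h) * \<phi> x)" "integrable lebesgue (\<lambda>x. u x * \<phi> x)" "integrable lebesgue (\<lambda>x. D x * \<phi> x)"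
      by (intro locally_integrable_mult_test_function lt lD u \<phi>)+
    have "(LINT x|lebesgue. (u (x + h) - u x - D x) * \<phi> x) = 
      (LINT x|lebesgue. u (x + h) * \<phi> x) - (LINT x|lebesgue. u x * \<phi> x) - (LINT x|lebesgue. D x * \<phi> x)"
      using i by (simp add: left_diff_distrib)
    also have "\<dots> = 0" using D by (simp add: integral_completion)
    finally show "(LINT x|lebesgue. (u (x + h) - u x - D x) * \<phi> x) = 0" .
  qed
  then show ?thesis unfolding D_def[symmetric] by (simp add: AE_completion_iff)
qed

text \<open>Jensen on the segment [0,1], Tonelli, translation invariance for each fixed s, and
  Cauchy-Schwarz for h . g.\<close>

lemma translation_estimate:
  fixes u :: "R3 \<Rightarrow> real" and g :: "R3 \<Rightarrow> R3"
  assumes u: "locally_integrable u" "has_weak_gradient u g"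
    and [measurable]: "u \<in> borel_measurable borel" "g \<in> borel_measurable borel"
  shows "(\<integral>\<^sup>+x. ennreal ((u (x + h) - u x)\<^sup>2) \<partial>lborel) \<le> ennreal ((norm h)\<^sup>2) * (\<integral>\<^sup>+x. ennreal ((norm (g x))\<^sup>2) \<partial>lborel)"
proof -
  have "(\<integral>\<^sup>+x. ennreal ((u (x + h) - u x)\<^sup>2) \<partial>lborel)
     = (\<integral>\<^sup>+x. ennreal ((LINT s|lborel. indicator {0..1::real} s * (h \<bullet> g (x + s *\<^sub>R h)))\<^sup>2) \<partial>lborel)"
    using difference_eq_segment_integral[OF u, of h] by (intro nn_integral_cong_AE) auto
  also have "\<dots> \<le> (\<integral>\<^sup>+x. \<integral>\<^sup>+s. ennreal (indicator {0..1::real} s * (h \<bullet> g (x + s *\<^sub>R h))\<^sup>2) \<partial>lborel \<partial>lborel)"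
    by (intro nn_integral_mono jensen_square) (measurable, auto simp: ennreal_indicator)
  also have "\<dots> = (\<integral>\<^sup>+s. \<integral>\<^sup>+x. ennreal (indicator {0..1::real} s * (h \<bullet> g (x + s *\<^sub>R h))\<^sup>2) \<partial>lborel \<partial>lborel)"
    by (rule lborel_pair.Fubini') measurable
  also have "\<dots> \<le> (\<integral>\<^sup>+s. (ennreal ((norm h)\<^sup>2) * (\<integral>\<^sup>+x. ennreal ((norm (g x))\<^sup>2) \<partial>lborel)) * indicator {0..1::real} s \<partial>lborel)"
  proof (rule nn_integral_mono)
    fix s :: real
    have "(\<integral>\<^sup>+x. ennreal ((h \<bullet> g (x + s *\<^sub>R h))\<^sup>2) \<partial>lborel) = (\<integral>\<^sup>+x. ennreal ((h \<bullet> g x)\<^sup>2) \<partial>lborel)"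
      by (rule nn_integral_lborel_translate) measurable
    also have "\<dots> \<le> (\<integral>\<^sup>+x. ennreal ((norm h)\<^sup>2) * ennreal ((norm (g x))\<^sup>2) \<partial>lborel)"
    proof (rule nn_integral_mono)
      fix x
      have "(h \<bullet> g x)\<^sup>2 \<le> (norm h * norm (g x))\<^sup>2"
        using Cauchy_Schwarz_ineq2[of h "g x"] by (metis abs_ge_zero power2_abs power_mono)
      then show "ennreal ((h \<bullet> g x)\<^sup>2) \<le> ennreal ((norm h)\<^sup>2) * ennreal ((norm (g x))\<^sup>2)"
        by (simp add: ennreal_mult[symmetric] power_mult_distrib ennreal_leI)
    qed
    also have "\<dots> = ennreal ((norm h)\<^sup>2) * (\<integral>\<^sup>+x. ennreal ((norm (g x))\<^sup>2) \<partial>lborel)"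
      by (rule nn_integral_cmult) measurable
    finally show "(\<integral>\<^sup>+x. ennreal (indicator {0..1::real} s * (h \<bullet> g (x + s *\<^sub>R h))\<^sup>2) \<partial>lborel)
      \<le> (ennreal ((norm h)\<^sup>2) * (\<integral>\<^sup>+x. ennreal ((norm (g x))\<^sup>2) \<partial>lborel)) * indicator {0..1::real} s"
      by (auto simp: indicator_def)
  qed
  also have "\<dots> = ennreal ((norm h)\<^sup>2) * (\<integral>\<^sup>+x. ennreal ((norm (g x))\<^sup>2) \<partial>lborel)"
    by (subst nn_integral_cmult_indicator) auto
  finally show ?thesis .
qed

section \<open>Dyadic averages and the Sobolev inequality\<close>

lemma locally_integrable_cong_AE:
  fixes f :: "R3 \<Rightarrow> 'b::euclidean_space"
  assumes "locally_integrable f" "AE x in lebesgue. f x = g x" "g \<in> borel_measurable lebesgue"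
  shows "locally_integrable g"
  unfolding locally_integrable_def set_integrable_def
proof (intro allI impI)
  fix K :: "R3 set" assume K: "compact K"
  then have [measurable]: "K \<in> sets lebesgue" by (simp add: borel_compact)
  note [measurable] = assms(3)
  show "integrable lebesgue (\<lambda>x. indicator K x *\<^sub>R g x)"
    by (rule integrable_cong_AE_imp[OF locally_integrable_indicator[OF assms(1) K]])
       (measurable, use assms(2) in eventually_elim, auto)
qed

lemma has_weak_gradient_cong_AE:
  assumes "has_weak_gradient u g" "AE x in lebesgue. u x = u' x" "AE x in lebesgue. g x = g' x"
    and [measurable]: "u \<in> borel_measurable lebesgue" "u' \<in> borel_measurable lebesgue" "g' \<in> borel_measurable lebesgue"
  shows "has_weak_gradient u' g'"
  unfolding has_weak_gradient_def
proof (intro conjI allI impI)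
  have lg: "locally_integrable g" using assms(1) by (simp add: has_weak_gradient_def)
  show lg': "locally_integrable g'" by (rule locally_integrable_cong_AE[OF lg assms(3,6)])
  fix \<phi> :: "R3 \<Rightarrow> real" and i :: 3 assume \<phi>: "test_function \<phi>"
  have [measurable]: "\<phi> \<in> borel_measurable lebesgue" "(\<lambda>x. frechet_derivative \<phi> (at x) (axis i 1)) \<in> borel_measurable lebesgue"
    by (intro borel_measurable_lebesgueI borel_measurable_continuous_onI test_function_continuous test_function_directional_derivative \<phi>)+
  have [measurable]: "(\<lambda>x. g x $ i) \<in> borel_measurable lebesgue" "(\<lambda>x. g' x $ i) \<in> borel_measurable lebesgue"
    using locally_integrable_component[OF lg, of i] locally_integrable_component[OF lg', of i] by (auto dest: locally_integrable_measurable)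
  have "(LINT x|lebesgue. u' x * frechet_derivative \<phi> (at x) (axis i 1)) = (LINT x|lebesgue. u x * frechet_derivative \<phi> (at x) (axis i 1))"
    by (intro integral_cong_AE) (measurable, use assms(2) in eventually_elim, auto)
  also have "\<dots> = - (LINT x|lebesgue. g x $ i * \<phi> x)" using assms(1) \<phi> by (simp add: has_weak_gradient_def)
  also have "(LINT x|lebesgue. g x $ i * \<phi> x) = (LINT x|lebesgue. g' x $ i * \<phi> x)"
    by (intro integral_cong_AE) (measurable, use assms(3) in eventually_elim, auto)
  finally show "(LINT x|lebesgue. u' x * frechet_derivative \<phi> (at x) (axis i 1)) = - (LINT x|lebesgue. g' x $ i * \<phi> x)" .
qed

lemma lebesgue_measurable_ex_borel:
  fixes g :: "R3 \<Rightarrow> R3"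
  assumes "g \<in> borel_measurable lebesgue"
  obtains g' where "g' \<in> borel_measurable borel" "AE x in lborel. g x = g' x"
proof -
  have "\<exists>h\<in>borel_measurable lborel. AE x in lborel. g x $ i = h x" for i
  proof (rule completion_ex_borel_measurable_real)
    have "(\<lambda>x. g x \<bullet> axis i 1) \<in> borel_measurable lebesgue" using assms by measurable
    then show "(\<lambda>x. g x $ i) \<in> borel_measurable lebesgue" by (simp add: inner_axis)
  qed
  then obtain h where h: "\<And>i. h i \<in> borel_measurable lborel" "\<And>i. AE x in lborel. g x $ i = h i x" by metis
  have "(\<lambda>x. \<chi> i. h i x) \<in> borel_measurable borel"
    by (subst borel_measurable_euclidean_space) (use h(1) in \<open>auto simp: Basis_vec_def inner_axis\<close>)
  moreover have "AE x in lborel. \<forall>i. g x $ i = h i x" using h(2) by (simp add: AE_all_countable)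
  then have "AE x in lborel. g x = (\<chi> i. h i x)" by eventually_elim (simp add: vec_eq_iff)
  ultimately show ?thesis by (rule that)
qed

section \<open>Dyadic cubes, averages and the Poincare estimate\<close>

definition dyadic_cube :: "nat \<Rightarrow> R3 \<Rightarrow> R3 set" where
  "dyadic_cube k x = {y. \<forall>i. \<lfloor>2 ^ k * (y $ i)\<rfloor> = \<lfloor>2 ^ k * (x $ i)\<rfloor>}"

text \<open>The cube has side 2^-k, so \<open>8 ^ k\<close> is its inverse volume and the weight is
  a probability density in \<open>y\<close>.\<close>

definition dyadic_weight :: "nat \<Rightarrow> R3 \<Rightarrow> R3 \<Rightarrow> real" where
  "dyadic_weight k x y = 8 ^ k * indicator (dyadic_cube k x) y"

definition dyadic_avg :: "nat \<Rightarrow> (R3 \<Rightarrow> real) \<Rightarrow> R3 \<Rightarrow> real" where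
  "dyadic_avg k u x = (LINT y|lebesgue. dyadic_weight k x y * u y)"

lemma borel_measurable_vec_nth [measurable (raw)]:
  "f \<in> borel_measurable M \<Longrightarrow> (\<lambda>x. (f x :: R3) $ i) \<in> borel_measurable M"
proof -
  assume "f \<in> borel_measurable M"
  then have "(\<lambda>x. f x \<bullet> axis i 1) \<in> borel_measurable M" by measurable
  then show ?thesis by (simp add: inner_axis)
qed

lemma measurable_dyadic_weight:
  assumes [measurable]: "f \<in> borel_measurable M" "g \<in> borel_measurable M"
  shows "(\<lambda>z. dyadic_weight k (f z) (g z)) \<in> borel_measurable M"
proof -
  have "dyadic_weight k (f z) (g z) = (if \<forall>i. \<lfloor>2 ^ k * (g z $ i)\<rfloor> = \<lfloor>2 ^ k * (f z $ i)\<rfloor> then 8 ^ k else 0)" for z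
    by (simp add: dyadic_weight_def dyadic_cube_def indicator_def)
  then have eq: "(\<lambda>z. dyadic_weight k (f z) (g z)) = (\<lambda>z. if \<forall>i. \<lfloor>2 ^ k * (g z $ i)\<rfloor> = \<lfloor>2 ^ k * (f z $ i)\<rfloor> then 8 ^ k else 0)"
    by (rule ext)
  show ?thesis unfolding eq by measurable
qed

lemma measurable_dyadic_weight_lebesgue [measurable]: "dyadic_weight k x \<in> borel_measurable lebesgue"
  by (intro borel_measurable_lebesgueI measurable_dyadic_weight[of "\<lambda>_. x" borel "\<lambda>y. y"]) measurable

lemma dyadic_weight_nonneg: "0 \<le> dyadic_weight k x y"
  by (simp add: dyadic_weight_def)

lemma dyadic_cube_near:
  assumes "y \<in> dyadic_cube k x"
  shows "\<bar>y $ i - x $ i\<bar> \<le> 1 / 2 ^ k"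
proof -
  have "\<lfloor>2 ^ k * (y $ i)\<rfloor> = \<lfloor>2 ^ k * (x $ i)\<rfloor>" using assms by (simp add: dyadic_cube_def)
  then have "\<bar>2 ^ k * (y $ i) - 2 ^ k * (x $ i)\<bar> \<le> 1" by linarith
  then have "2 ^ k * \<bar>y $ i - x $ i\<bar> \<le> 1" by (simp add: abs_mult right_diff_distrib[symmetric])
  then show ?thesis by (simp add: field_simps)
qed

lemma nn_integral_dyadic_weight: "(\<integral>\<^sup>+y. ennreal (dyadic_weight k x y) \<partial>lebesgue) = 1"
proof -
  define a :: R3 where "a = (\<chi> i. of_int \<lfloor>2 ^ k * (x $ i)\<rfloor> / 2 ^ k)"
  define b :: R3 where "b = (\<chi> i. (of_int \<lfloor>2 ^ k * (x $ i)\<rfloor> + 1) / 2 ^ k)"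
  have sub: "box a b \<subseteq> dyadic_cube k x" "dyadic_cube k x \<subseteq> cbox a b"
  proof -
    show "box a b \<subseteq> dyadic_cube k x"
    proof
      fix y assume "y \<in> box a b"
      then have "of_int \<lfloor>2 ^ k * (x $ i)\<rfloor> < 2 ^ k * (y $ i)" "2 ^ k * (y $ i) < of_int \<lfloor>2 ^ k * (x $ i)\<rfloor> + 1" for i
        by (auto simp: mem_box_cart a_def b_def field_simps)
      then show "y \<in> dyadic_cube k x" by (auto simp: dyadic_cube_def floor_eq_iff less_imp_le)
    qed
    show "dyadic_cube k x \<subseteq> cbox a b"
    proof
      fix y assume "y \<in> dyadic_cube k x"
      then have "of_int \<lfloor>2 ^ k * (x $ i)\<rfloor> \<le> 2 ^ k * (y $ i)" "2 ^ k * (y $ i) \<le> of_int \<lfloor>2 ^ k * (x $ i)\<rfloor> + 1" for i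
        unfolding dyadic_cube_def by (metis (mono_tags) mem_Collect_eq of_int_floor_le, metis (mono_tags, lifting) mem_Collect_eq less_imp_le real_of_int_floor_add_one_gt)
      then show "y \<in> cbox a b" by (auto simp: mem_box_cart a_def b_def field_simps)
    qed
  qed
  have m: "dyadic_cube k x \<in> sets borel"
    unfolding dyadic_cube_def by measurable
  have ba: "(b - a) \<bullet> j = 1 / 2 ^ k" "a \<bullet> j \<le> b \<bullet> j" if "j \<in> Basis" for j
    using that by (auto simp: a_def b_def Basis_vec_def inner_axis field_simps)
  have v: "emeasure lborel (box a b) = ennreal ((1 / 2 ^ k) ^ 3)" "emeasure lborel (cbox a b) = ennreal ((1 / 2 ^ k) ^ 3)"
    using ba by (auto simp: emeasure_lborel_box_eq emeasure_lborel_cbox_eq)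
  have "emeasure lborel (dyadic_cube k x) = ennreal ((1 / 2 ^ k) ^ 3)"
    using emeasure_mono[OF sub(1), of lborel] emeasure_mono[OF sub(2), of lborel] m v by (simp add: order_antisym)
  moreover have "(\<integral>\<^sup>+y. ennreal (dyadic_weight k x y) \<partial>lebesgue) = ennreal (8 ^ k) * emeasure lebesgue (dyadic_cube k x)"
    using m by (simp add: dyadic_weight_def ennreal_mult ennreal_indicator nn_integral_cmult_indicator)
  moreover have "(8::real) ^ k * (1 / 2 ^ k) ^ 3 = 1"
    using power_mult[of "2::real" k 3] power_mult[of "2::real" 3 k] by (simp add: mult.commute power_one_over field_simps)
  ultimately show ?thesis
    using m by (simp add: ennreal_mult[symmetric])
qed

lemma integrable_dyadic_weight:
  assumes "locally_integrable f"
  shows "integrable lebesgue (\<lambda>y. dyadic_weight k x y * f y)"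
proof (rule Bochner_Integration.integrable_bound)
  define K :: "R3 set" where "K = cbox (\<chi> i. x $ i - 1 / 2 ^ k) (\<chi> i. x $ i + 1 / 2 ^ k)"
  have sub: "dyadic_cube k x \<subseteq> K"
  proof
    fix y assume "y \<in> dyadic_cube k x"
    from dyadic_cube_near[OF this] show "y \<in> K"
      unfolding K_def mem_box_cart abs_le_iff by (simp add: algebra_simps)
  qed
  show "integrable lebesgue (\<lambda>y. 8 ^ k *\<^sub>R (indicator K y *\<^sub>R f y))"
    unfolding K_def by (intro integrable_scaleR_right locally_integrable_indicator assms compact_cbox)
  show "(\<lambda>y. dyadic_weight k x y * f y) \<in> borel_measurable lebesgue"
    using locally_integrable_measurable[OF assms] by measurable
  show "AE y in lebesgue. norm (dyadic_weight k x y * f y) \<le> norm (8 ^ k *\<^sub>R indicator K y *\<^sub>R f y)"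
    using sub by (auto simp: dyadic_weight_def indicator_def)
qed

lemma dyadic_weight_integral: "(LINT y|lebesgue. dyadic_weight k x y) = 1"
  using nn_integral_dyadic_weight[of k x] by (simp add: integral_eq_nn_integral dyadic_weight_nonneg)

text \<open>Jensen, then the weight is bounded by its maximum 8^k. Applied to u minus its average,
  where the Poincare estimate gains 4^-k, a net growth of 2^k remains.\<close>

lemma dyadic_avg_square_le:
  assumes [measurable]: "f \<in> borel_measurable lebesgue"
  shows "ennreal ((dyadic_avg k f x)\<^sup>2) \<le> ennreal (8 ^ k) * (\<integral>\<^sup>+y. ennreal ((f y)\<^sup>2) \<partial>lebesgue)"
proof -
  have "ennreal ((dyadic_avg k f x)\<^sup>2) \<le> (\<integral>\<^sup>+y. ennreal (dyadic_weight k x y * (f y)\<^sup>2) \<partial>lebesgue)"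
    unfolding dyadic_avg_def
    by (intro jensen_square nn_integral_dyadic_weight dyadic_weight_nonneg) measurable
  also have "\<dots> \<le> (\<integral>\<^sup>+y. ennreal (8 ^ k) * ennreal ((f y)\<^sup>2) \<partial>lebesgue)"
    by (intro nn_integral_mono) (auto simp: dyadic_weight_def indicator_def ennreal_mult)
  also have "\<dots> = ennreal (8 ^ k) * (\<integral>\<^sup>+y. ennreal ((f y)\<^sup>2) \<partial>lebesgue)"
    by (rule nn_integral_cmult) measurable
  finally show ?thesis .
qed

lemma dyadic_cube_Suc: "y \<in> dyadic_cube (Suc k) x \<Longrightarrow> y \<in> dyadic_cube k x"
proof -
  have half: "\<lfloor>t\<rfloor> = \<lfloor>s\<rfloor>" if "\<lfloor>2 * t\<rfloor> = \<lfloor>2 * s\<rfloor>" for s t :: real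
    using floor_divide_real_eq_div[of 2 "2 * t"] floor_divide_real_eq_div[of 2 "2 * s"] that by simp
  assume "y \<in> dyadic_cube (Suc k) x"
  then have "\<lfloor>2 * (2 ^ k * (y $ i))\<rfloor> = \<lfloor>2 * (2 ^ k * (x $ i))\<rfloor>" for i
    unfolding dyadic_cube_def by (simp add: mult.assoc)
  then have "\<lfloor>2 ^ k * (y $ i)\<rfloor> = \<lfloor>2 ^ k * (x $ i)\<rfloor>" for i by (rule half)
  then show ?thesis unfolding dyadic_cube_def by blast
qed

lemma dyadic_avg_cong: "y \<in> dyadic_cube k x \<Longrightarrow> dyadic_avg k u y = dyadic_avg k u x"
  by (simp add: dyadic_avg_def dyadic_weight_def dyadic_cube_def)

text \<open>Cubes of consecutive generations are nested, so the coarse average is constant on the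
  fine cube and can be taken out of the fine average. This expresses the increments of the
  telescoping sum through u minus its coarse average.\<close>

lemma dyadic_avg_const_on_cube:
  assumes "locally_integrable u"
  shows "dyadic_avg (Suc k) (\<lambda>y. u y - dyadic_avg k u y) x = dyadic_avg (Suc k) u x - dyadic_avg k u x"
proof -
  have "dyadic_weight (Suc k) x y * (u y - dyadic_avg k u y) = dyadic_weight (Suc k) x y * u y - dyadic_weight (Suc k) x y * dyadic_avg k u x" for y
    using dyadic_cube_Suc[of y k x] dyadic_avg_cong[of y k x u]
    by (auto simp: dyadic_weight_def indicator_def right_diff_distrib)
  moreover have "integrable lebesgue (dyadic_weight (Suc k) x)"
    using nn_integral_dyadic_weight[of "Suc k" x] by (intro integrableI_nonneg) (auto simp: dyadic_weight_nonneg)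
  ultimately show ?thesis
    using integrable_dyadic_weight[OF assms, of "Suc k" x] by (simp add: dyadic_avg_def dyadic_weight_integral)
qed

text \<open>With r = 2^-k, two points of one cube differ by a vector h in Q = [-r, r]^3, so the
  average is dominated by an integral over translations. There |h|^2 <= 9 r^2 and Q has volume 8
  r^3; since 8^k r^3 = 1, the translation estimate yields the constant 8^k * 9 r^2 * 8 r^3 = 72
  r^2.\<close>

lemma dyadic_poincare_borel:
  fixes u :: "R3 \<Rightarrow> real" and g :: "R3 \<Rightarrow> R3"
  assumes u: "locally_integrable u" "has_weak_gradient u g"
    and [measurable]: "u \<in> borel_measurable borel" "g \<in> borel_measurable borel"
  shows "(\<integral>\<^sup>+x. ennreal ((u x - dyadic_avg k u x)\<^sup>2) \<partial>lborel) \<le> ennreal (72 / 4 ^ k) * (\<integral>\<^sup>+x. ennreal ((norm (g x))\<^sup>2) \<partial>lborel)"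
proof -
  define G where "G = (\<integral>\<^sup>+x. ennreal ((norm (g x))\<^sup>2) \<partial>lborel)"
  define r :: real where "r = 1 / 2 ^ k"
  define Q :: "R3 set" where "Q = cbox (\<chi> i. - r) (\<chi> i. r)"
  have [measurable]: "Q \<in> sets borel" by (simp add: Q_def)
  have r: "r > 0" by (simp add: r_def)
  have 1: "ennreal ((u x - dyadic_avg k u x)\<^sup>2) \<le> (\<integral>\<^sup>+y. ennreal (8 ^ k * indicator Q (y - x) * (u y - u x)\<^sup>2) \<partial>lborel)" for x
  proof -
    have iw: "integrable lebesgue (dyadic_weight k x)"
      using nn_integral_dyadic_weight[of k x] by (intro integrableI_nonneg) (auto simp: dyadic_weight_nonneg)
    have "(LINT y|lebesgue. dyadic_weight k x y * (u x - u y)) = u x - dyadic_avg k u x"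
      using integrable_dyadic_weight[OF u(1), of k x] iw
      by (simp add: right_diff_distrib dyadic_avg_def dyadic_weight_integral)
    moreover have "(\<lambda>y. u x - u y) \<in> borel_measurable lebesgue" by (intro borel_measurable_lebesgueI) measurable
    ultimately have "ennreal ((u x - dyadic_avg k u x)\<^sup>2) \<le> (\<integral>\<^sup>+y. ennreal (dyadic_weight k x y * (u x - u y)\<^sup>2) \<partial>lebesgue)"
      using jensen_square[OF _ _ dyadic_weight_nonneg nn_integral_dyadic_weight, of k x "\<lambda>y. u x - u y"] by simp
    also have "\<dots> \<le> (\<integral>\<^sup>+y. ennreal (8 ^ k * indicator Q (y - x) * (u y - u x)\<^sup>2) \<partial>lebesgue)"
    proof (intro nn_integral_mono ennreal_leI)
      fix y
      have "y - x \<in> Q" if "y \<in> dyadic_cube k x"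
        using dyadic_cube_near[OF that] unfolding Q_def r_def mem_box_cart abs_le_iff by (simp add: minus_le_iff)
      then show "dyadic_weight k x y * (u x - u y)\<^sup>2 \<le> 8 ^ k * indicator Q (y - x) * (u y - u x)\<^sup>2"
        by (auto simp: dyadic_weight_def indicator_def power2_commute)
    qed
    finally show ?thesis by (simp add: nn_integral_completion)
  qed
  have tr: "(\<integral>\<^sup>+y. ennreal (8 ^ k * indicator Q (y - x) * (u y - u x)\<^sup>2) \<partial>lborel)
      = (\<integral>\<^sup>+h. ennreal (8 ^ k * indicator Q h * (u (x + h) - u x)\<^sup>2) \<partial>lborel)" for x
    using nn_integral_lborel_translate[of "\<lambda>y. ennreal (8 ^ k * indicator Q (y - x) * (u y - u x)\<^sup>2)" x]
    by (simp add: add.commute)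
  have "(\<integral>\<^sup>+x. ennreal ((u x - dyadic_avg k u x)\<^sup>2) \<partial>lborel)
     \<le> (\<integral>\<^sup>+x. \<integral>\<^sup>+h. ennreal (8 ^ k * indicator Q h * (u (x + h) - u x)\<^sup>2) \<partial>lborel \<partial>lborel)"
    using 1 unfolding tr by (rule nn_integral_mono)
  also have "\<dots> = (\<integral>\<^sup>+h. \<integral>\<^sup>+x. ennreal (8 ^ k * indicator Q h * (u (x + h) - u x)\<^sup>2) \<partial>lborel \<partial>lborel)"
    by (rule lborel_pair.Fubini') measurable
  also have "\<dots> \<le> (\<integral>\<^sup>+h. ennreal (8 ^ k * (9 * r\<^sup>2)) * G * indicator Q h \<partial>lborel)"
  proof (rule nn_integral_mono)
    fix h :: R3
    show "(\<integral>\<^sup>+x. ennreal (8 ^ k * indicator Q h * (u (x + h) - u x)\<^sup>2) \<partial>lborel) \<le> ennreal (8 ^ k * (9 * r\<^sup>2)) * G * indicator Q h"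
    proof (cases "h \<in> Q")
      case True
      have "norm h \<le> (\<Sum>i\<in>UNIV. \<bar>h $ i\<bar>)" by (rule norm_le_l1_cart)
      also have "\<dots> \<le> (\<Sum>i\<in>(UNIV::3 set). r)"
        using True by (intro sum_mono) (auto simp: Q_def mem_box_cart abs_le_iff minus_le_iff)
      finally have "(norm h)\<^sup>2 \<le> (3 * r)\<^sup>2" by (intro power_mono) auto
      then have hn: "(norm h)\<^sup>2 \<le> 9 * r\<^sup>2" by (simp add: power_mult_distrib)
      have "(\<integral>\<^sup>+x. ennreal (8 ^ k * indicator Q h * (u (x + h) - u x)\<^sup>2) \<partial>lborel) = ennreal (8 ^ k) * (\<integral>\<^sup>+x. ennreal ((u (x + h) - u x)\<^sup>2) \<partial>lborel)"
        using True by (simp add: ennreal_mult nn_integral_cmult)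
      also have "\<dots> \<le> ennreal (8 ^ k) * (ennreal ((norm h)\<^sup>2) * G)"
        unfolding G_def by (intro mult_left_mono translation_estimate u) auto
      also have "\<dots> \<le> ennreal (8 ^ k) * (ennreal (9 * r\<^sup>2) * G)"
        by (intro mult_left_mono mult_right_mono ennreal_leI hn) auto
      finally show ?thesis using True by (simp add: ennreal_mult mult.assoc)
    qed simp
  qed
  also have "\<dots> = ennreal (8 ^ k * (9 * r\<^sup>2)) * G * emeasure lborel Q"
    by (rule nn_integral_cmult_indicator) simp
  also have "emeasure lborel Q = ennreal ((2 * r) ^ 3)"
  proof -
    have "((\<chi> i. r) - (\<chi> i. - r) :: R3) \<bullet> j = 2 * r" "((\<chi> i. - r) :: R3) \<bullet> j \<le> (\<chi> i. r) \<bullet> j" if "j \<in> Basis" for j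
      using that r by (auto simp: Basis_vec_def inner_axis)
    then show ?thesis unfolding Q_def by (simp add: emeasure_lborel_cbox_eq)
  qed
  also have "ennreal (8 ^ k * (9 * r\<^sup>2)) * G * ennreal ((2 * r) ^ 3) = ennreal (8 ^ k * (9 * r\<^sup>2) * (2 * r) ^ 3) * G"
  proof -
    have "ennreal (8 ^ k * (9 * r\<^sup>2) * (2 * r) ^ 3) = ennreal (8 ^ k * (9 * r\<^sup>2)) * ennreal ((2 * r) ^ 3)"
      using r by (intro ennreal_mult) auto
    then show ?thesis by (simp only: mult_ac)
  qed
  also have "8 ^ k * (9 * r\<^sup>2) * (2 * r) ^ 3 = 72 / 4 ^ k"
  proof -
    have "(8::real) ^ k = (2 ^ k) ^ 3" using power_mult[of "2::real" k 3] power_mult[of "2::real" 3 k] by (simp add: mult.commute)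
    moreover have "(4::real) ^ k = (2 ^ k) ^ 2" using power_mult[of "2::real" k 2] power_mult[of "2::real" 2 k] by (simp add: mult.commute)
    ultimately show ?thesis by (simp add: r_def field_simps power_one_over power2_eq_square power3_eq_cube)
  qed
  finally show ?thesis unfolding G_def .
qed

text \<open>The translation and Fubini arguments are carried out for Borel functions over
  \<open>lborel\<close>; this transfers them to \<open>W11loc\<close>, whose members are only
  Lebesgue measurable.\<close>

lemma W11loc_borel_representative:
  assumes "u \<in> W11loc"
  obtains u' g' where "u' \<in> borel_measurable borel" "g' \<in> borel_measurable borel"
    "AE x in lebesgue. u x = u' x" "AE x in lebesgue. weak_grad u x = g' x"
    "locally_integrable u'" "has_weak_gradient u' g'"
proof -
  have u: "locally_integrable u" using assms by (simp add: W11loc_def)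
  have g: "has_weak_gradient u (weak_grad u)" using assms by (rule has_weak_gradient_weak_grad)
  have mu: "u \<in> borel_measurable lebesgue" by (rule locally_integrable_measurable[OF u])
  have mg: "weak_grad u \<in> borel_measurable lebesgue"
    using g by (intro locally_integrable_measurable) (simp add: has_weak_gradient_def)
  obtain u' where u': "u' \<in> borel_measurable borel" "AE x in lborel. u x = u' x"
    using completion_ex_borel_measurable_real[OF mu] by auto
  obtain g' where g': "g' \<in> borel_measurable borel" "AE x in lborel. weak_grad u x = g' x"
    using lebesgue_measurable_ex_borel[OF mg] by blast
  have ae: "AE x in lebesgue. u x = u' x" "AE x in lebesgue. weak_grad u x = g' x"
    using u' g' by (auto intro: AE_completion)
  show ?thesis
    by (rule that[OF u'(1) g'(1) ae locally_integrable_cong_AE[OF u ae(1)] has_weak_gradient_cong_AE[OF g ae mu]])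
      (intro borel_measurable_lebesgueI u' g')+
qed

lemma W11loc_measurable:
  assumes "u \<in> W11loc"
  shows "u \<in> borel_measurable lebesgue" "weak_grad u \<in> borel_measurable lebesgue"
proof -
  show "u \<in> borel_measurable lebesgue"
    using assms by (intro locally_integrable_measurable) (simp add: W11loc_def)
  show "weak_grad u \<in> borel_measurable lebesgue"
    using has_weak_gradient_weak_grad[OF assms] by (intro locally_integrable_measurable) (simp add: has_weak_gradient_def)
qed

lemma dyadic_avg_cong_AE:
  assumes "AE x in lebesgue. u x = v x" and [measurable]: "u \<in> borel_measurable lebesgue" "v \<in> borel_measurable lebesgue"
  shows "dyadic_avg k u x = dyadic_avg k v x"
  unfolding dyadic_avg_def by (intro integral_cong_AE) (measurable, use assms(1) in eventually_elim, auto)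

lemma dyadic_poincare:
  assumes u: "u \<in> W11loc"
  shows "(\<integral>\<^sup>+x. ennreal ((u x - dyadic_avg k u x)\<^sup>2) \<partial>lebesgue)
    \<le> ennreal (72 / 4 ^ k) * (\<integral>\<^sup>+x. ennreal ((norm (weak_grad u x))\<^sup>2) \<partial>lebesgue)"
proof -
  obtain u' g' where r: "u' \<in> borel_measurable borel" "g' \<in> borel_measurable borel"
    "AE x in lebesgue. u x = u' x" "AE x in lebesgue. weak_grad u x = g' x"
    "locally_integrable u'" "has_weak_gradient u' g'"
    using W11loc_borel_representative[OF u] by blast
  have d: "dyadic_avg k u x = dyadic_avg k u' x" for x
    by (intro dyadic_avg_cong_AE r W11loc_measurable u borel_measurable_lebesgueI)
  have "(\<integral>\<^sup>+x. ennreal ((u x - dyadic_avg k u x)\<^sup>2) \<partial>lebesgue) = (\<integral>\<^sup>+x. ennreal ((u' x - dyadic_avg k u' x)\<^sup>2) \<partial>lebesgue)"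
    using r(3) by (intro nn_integral_cong_AE) (auto simp: d)
  also have "\<dots> \<le> ennreal (72 / 4 ^ k) * (\<integral>\<^sup>+x. ennreal ((norm (g' x))\<^sup>2) \<partial>lebesgue)"
    unfolding nn_integral_completion by (intro dyadic_poincare_borel r)
  also have "(\<integral>\<^sup>+x. ennreal ((norm (g' x))\<^sup>2) \<partial>lebesgue) = (\<integral>\<^sup>+x. ennreal ((norm (weak_grad u x))\<^sup>2) \<partial>lebesgue)"
    using r(4) by (intro nn_integral_cong_AE) auto
  finally show ?thesis .
qed

lemma H1_energy_ge:
  assumes u: "u \<in> W11loc"
  shows "(\<integral>\<^sup>+x. ennreal ((u x)\<^sup>2) \<partial>lebesgue) \<le> H1_energy u"
    "(\<integral>\<^sup>+x. ennreal ((norm (weak_grad u x))\<^sup>2) \<partial>lebesgue) \<le> H1_energy u"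
  unfolding H1_energy_def by (auto intro!: nn_integral_mono ennreal_leI)

lemma measurable_dyadic_avg:
  assumes u: "u \<in> W11loc"
  shows "dyadic_avg k u \<in> borel_measurable lebesgue"
proof -
  obtain u' g' where r: "u' \<in> borel_measurable borel" "g' \<in> borel_measurable borel"
    "AE x in lebesgue. u x = u' x" "AE x in lebesgue. weak_grad u x = g' x"
    "locally_integrable u'" "has_weak_gradient u' g'"
    using W11loc_borel_representative[OF u] by blast
  have [measurable]: "(\<lambda>(x, y). dyadic_weight k x y) \<in> borel_measurable (borel \<Otimes>\<^sub>M lborel)"
    unfolding split_beta' by (intro measurable_dyadic_weight) measurable
  note [measurable] = r(1)
  have "dyadic_avg k u x = (LINT y|lborel. dyadic_weight k x y * u' y)" for x
  proof -
    have "dyadic_avg k u x = dyadic_avg k u' x"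
      by (intro dyadic_avg_cong_AE r W11loc_measurable u borel_measurable_lebesgueI)
    also have "\<dots> = (LINT y|lborel. dyadic_weight k x y * u' y)"
      unfolding dyadic_avg_def
      by (intro integral_completion) measurable
    finally show ?thesis .
  qed
  then have "dyadic_avg k u = (\<lambda>x. LINT y|lborel. dyadic_weight k x y * u' y)" by (rule ext)
  then show ?thesis
    by simp (intro borel_measurable_lebesgueI, measurable)
qed

lemma ennreal_mult3:
  "0 \<le> a \<Longrightarrow> 0 \<le> b \<Longrightarrow> 0 \<le> c \<Longrightarrow> ennreal a * (ennreal b * ennreal c) = ennreal (a * (b * c))"
  by (simp add: ennreal_mult)

text \<open>Induction on the generation. The square of an increment is at most 8^(k+1) * 72/4^k *
  K^2 = 576 * 2^k * K^2, so the increment is at most 24 * sqrt 2 ^ k * K and the geometric growth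
  persists.\<close>

lemma dyadic_avg_bound:
  assumes u: "u \<in> W11loc" and K: "0 \<le> K" "H1_energy u \<le> ennreal (K\<^sup>2)"
  shows "\<bar>dyadic_avg k u x\<bar> \<le> 60 * sqrt 2 ^ k * K"
proof (induction k)
  case 0
  have "ennreal ((dyadic_avg 0 u x)\<^sup>2) \<le> ennreal (8 ^ 0) * (\<integral>\<^sup>+y. ennreal ((u y)\<^sup>2) \<partial>lebesgue)"
    by (intro dyadic_avg_square_le W11loc_measurable u)
  also have "\<dots> \<le> ennreal (K\<^sup>2)" using order_trans[OF H1_energy_ge(1)[OF u] K(2)] by simp
  finally have "\<bar>dyadic_avg 0 u x\<bar> \<le> K"
    using K(1) by (simp add: abs_le_square_iff[symmetric])
  then show ?case using K(1) by simp
next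
  case (Suc k)
  have l: "locally_integrable u" using u by (simp add: W11loc_def)
  have m: "(\<lambda>y. u y - dyadic_avg k u y) \<in> borel_measurable lebesgue"
    by (intro borel_measurable_diff W11loc_measurable measurable_dyadic_avg u)
  have "ennreal ((dyadic_avg (Suc k) u x - dyadic_avg k u x)\<^sup>2)
      \<le> ennreal (8 ^ Suc k) * (\<integral>\<^sup>+y. ennreal ((u y - dyadic_avg k u y)\<^sup>2) \<partial>lebesgue)"
    using dyadic_avg_square_le[OF m, of "Suc k" x] dyadic_avg_const_on_cube[OF l, of k x] by simp
  also have "\<dots> \<le> ennreal (8 ^ Suc k) * (ennreal (72 / 4 ^ k) * ennreal (K\<^sup>2))"
    by (intro mult_left_mono order_trans[OF dyadic_poincare[OF u]] order_trans[OF H1_energy_ge(2)[OF u] K(2)]) auto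
  also have "\<dots> = ennreal (8 ^ Suc k * (72 / 4 ^ k * K\<^sup>2))"
    by (rule ennreal_mult3) auto
  also have "8 ^ Suc k * (72 / 4 ^ k * K\<^sup>2) = (24 * sqrt 2 ^ k * K)\<^sup>2"
  proof -
    have "(8::real) ^ k = 2 ^ k * 4 ^ k" by (simp add: power_mult_distrib[symmetric])
    moreover have "(sqrt 2 ^ k)\<^sup>2 = (2::real) ^ k" by (simp add: power_mult[symmetric] mult.commute[of k]) (simp add: power_mult)
    ultimately show ?thesis by (simp add: power_mult_distrib)
  qed
  finally have "\<bar>dyadic_avg (Suc k) u x - dyadic_avg k u x\<bar> \<le> 24 * sqrt 2 ^ k * K"
    using K(1) by (simp add: abs_le_square_iff[symmetric])
  then have "\<bar>dyadic_avg (Suc k) u x\<bar> \<le> (24 + 60) * (sqrt 2 ^ k * K)"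
    using Suc.IH by (simp add: algebra_simps)
  also have "\<dots> \<le> (60 * sqrt 2) * (sqrt 2 ^ k * K)"
  proof (rule mult_right_mono)
    \<comment> \<open>The constant 60 is chosen to close the induction: 24 + 60 = 84 = 60 *
      1.4.\<close>
    have "1.4 \<le> sqrt 2" by (rule real_le_rsqrt) (simp add: power2_eq_square)
    then show "24 + 60 \<le> 60 * sqrt 2" by simp
  qed (use K in simp)
  finally show ?case by simp
qed

text \<open>Where \<open>\<bar>t\<bar>\<close> exceeds twice the bound on the average \<open>a k\<close>, it is controlled by \<open>t - a k\<close>; choosing
  \<open>k\<close> by the size of \<open>\<bar>t\<bar>\<close> makes the resulting series geometric with ratio below 1 exactly for \<open>p < 6\<close>.\<close>

lemma powr_le_dyadic:
  fixes t K p :: real and a :: "nat \<Rightarrow> real"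
  assumes K: "0 < K" and p: "2 \<le> p" and a: "\<And>k. \<bar>a k\<bar> \<le> 60 * sqrt 2 ^ k * K"
  shows "\<bar>t\<bar> powr p \<le> (120 * K) powr (p - 2) * t\<^sup>2
    \<or> (\<exists>k. \<bar>t\<bar> powr p \<le> (120 * K) powr (p - 2) * (sqrt 2 powr (p - 2)) ^ Suc k * (4 * (t - a k)\<^sup>2))"
proof -
  define L where "L k = 2 * (60 * sqrt 2 ^ k * K)" for k :: nat
  have split: "\<bar>t\<bar> powr p = \<bar>t\<bar> powr (p - 2) * t\<^sup>2"
  proof (cases "t = 0")
    case False
    have "\<bar>t\<bar> powr p = \<bar>t\<bar> powr (p - 2) * \<bar>t\<bar> powr 2" by (simp only: powr_add[symmetric]) simp
    also have "\<bar>t\<bar> powr 2 = t\<^sup>2" using False by simp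
    finally show ?thesis .
  qed simp
  show ?thesis
  proof (cases "\<bar>t\<bar> \<le> L 0")
    case True
    then have "\<bar>t\<bar> powr (p - 2) \<le> (120 * K) powr (p - 2)"
      using p by (intro powr_mono2) (auto simp: L_def)
    then show ?thesis unfolding split by (intro disjI1 mult_right_mono) auto
  next
    case False
    have "\<exists>n. \<bar>t\<bar> \<le> L n"
    proof -
      obtain n where "\<bar>t\<bar> / (120 * K) < sqrt 2 ^ n"
        using real_arch_pow[of "sqrt 2"] by auto
      then show ?thesis using K by (auto simp: L_def field_simps intro!: exI[of _ n])
    qed
    then obtain n where n: "\<bar>t\<bar> \<le> L n" "\<And>m. m < n \<Longrightarrow> \<not> \<bar>t\<bar> \<le> L m"
      using exists_least_iff[of "\<lambda>n. \<bar>t\<bar> \<le> L n"] by auto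
    with False obtain k where k: "n = Suc k" by (cases n) auto
    then have "L k < \<bar>t\<bar>" using n(2)[of k] by simp
    moreover have "2 * \<bar>a k\<bar> \<le> L k" unfolding L_def by (rule mult_left_mono[OF a]) simp
    moreover have "\<bar>t\<bar> \<le> \<bar>t - a k\<bar> + \<bar>a k\<bar>" by (rule abs_triangle_ineq[of "t - a k" "a k", simplified])
    ultimately have "\<bar>t\<bar> \<le> 2 * \<bar>t - a k\<bar>" by simp
    then have "\<bar>t\<bar>\<^sup>2 \<le> (2 * \<bar>t - a k\<bar>)\<^sup>2" by (rule power_mono) simp
    then have 1: "t\<^sup>2 \<le> 4 * (t - a k)\<^sup>2" by (simp add: power_mult_distrib)
    have "\<bar>t\<bar> powr (p - 2) \<le> L (Suc k) powr (p - 2)"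
      using p n(1) k by (intro powr_mono2) auto
    also have "L (Suc k) powr (p - 2) = (120 * K) powr (p - 2) * (sqrt 2 powr (p - 2)) ^ Suc k"
    proof -
      have "L (Suc k) = (120 * K) * sqrt 2 ^ Suc k" by (simp add: L_def)
      then have "L (Suc k) powr (p - 2) = (120 * K) powr (p - 2) * (sqrt 2 ^ Suc k) powr (p - 2)"
        using K by (simp only: powr_mult)
      also have "(sqrt 2 ^ Suc k) powr (p - 2) = (sqrt 2 powr (p - 2)) ^ Suc k"
        using powr_powr[of "sqrt 2" "real (Suc k)" "p - 2"] powr_powr[of "sqrt 2" "p - 2" "real (Suc k)"]
          powr_realpow[of "sqrt 2" "Suc k"] powr_realpow[of "sqrt 2 powr (p - 2)" "Suc k"]
        by (simp only: mult.commute[of "p - 2"]) simp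
      finally show ?thesis .
    qed
    finally have "\<bar>t\<bar> powr p \<le> ((120 * K) powr (p - 2) * (sqrt 2 powr (p - 2)) ^ Suc k) * (4 * (t - a k)\<^sup>2)"
      unfolding split using 1 by (intro mult_mono) auto
    then show ?thesis by blast
  qed
qed

text \<open>The factor 120 is twice the constant 60 of the average bound, and 288 = 4 * 72 combines
  the factor of \<open>powr_le_dyadic\<close> with the Poincare constant. The ratio sqrt 2 powr (p -
  2) / 4 is below 1 exactly for p < 6, the critical exponent in dimension 3.\<close>

definition sobolev_const :: "real \<Rightarrow> real" where
  "sobolev_const p = 120 powr (p - 2) * (1 + 288 * sqrt 2 powr (p - 2) * (\<Sum>k. (sqrt 2 powr (p - 2) / 4) ^ k))"

lemma sobolev_ratio:
  assumes "p < (6::real)"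
  shows "norm (sqrt 2 powr (p - 2) / 4) < 1"
proof -
  have "sqrt 2 powr (p - 2) < sqrt 2 powr 4" using assms by (intro powr_less_mono) auto
  also have "sqrt 2 powr 4 = 4" by (simp add: powr_numeral power4_eq_xxxx)
  finally show ?thesis by simp
qed

lemma sobolev_const_nonneg: "p < 6 \<Longrightarrow> 0 \<le> sobolev_const p"
  unfolding sobolev_const_def
  by (intro mult_nonneg_nonneg add_nonneg_nonneg suminf_nonneg summable_geometric sobolev_ratio) auto

text \<open>The generation selected in the pointwise alternative depends on the point. Summing the
  terms of all generations gives a measurable majorant that is integrated term by term with the
  Poincare estimate.\<close>

lemma sobolev_inequality:
  assumes u: "u \<in> W11loc" and K: "0 < K" "H1_energy u \<le> ennreal (K\<^sup>2)" and p: "2 \<le> p" "p < 6"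
  shows "(\<integral>\<^sup>+x. ennreal (\<bar>u x\<bar> powr p) \<partial>lebesgue) \<le> ennreal (sobolev_const p * K powr p)"
proof -
  note [measurable] = W11loc_measurable[OF u] measurable_dyadic_avg[OF u]
  define c where "c = (120 * K) powr (p - 2)"
  define s where "s = sqrt 2 powr (p - 2)"
  have c: "0 \<le> c" "0 \<le> s" by (auto simp: c_def s_def)
  have s1: "norm (s / 4) < 1" using sobolev_ratio[OF p(2)] by (simp add: s_def)
  define T where "T k x = c * s ^ Suc k * (4 * (u x - dyadic_avg k u x)\<^sup>2)" for k x
  have T0: "0 \<le> T k x" for k x using c by (simp add: T_def)
  have [measurable]: "T k \<in> borel_measurable lebesgue" for k unfolding T_def by measurable
  have "(\<integral>\<^sup>+x. ennreal (\<bar>u x\<bar> powr p) \<partial>lebesgue) \<le> (\<integral>\<^sup>+x. ennreal (c * (u x)\<^sup>2) + (\<Sum>k. ennreal (T k x)) \<partial>lebesgue)"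
  proof (rule nn_integral_mono)
    fix x
    have "\<bar>u x\<bar> powr p \<le> c * (u x)\<^sup>2 \<or> (\<exists>k. \<bar>u x\<bar> powr p \<le> T k x)"
      unfolding c_def T_def s_def
      by (rule powr_le_dyadic[OF K(1) p(1)]) (rule dyadic_avg_bound[OF u less_imp_le[OF K(1)] K(2)])
    then show "ennreal (\<bar>u x\<bar> powr p) \<le> ennreal (c * (u x)\<^sup>2) + (\<Sum>k. ennreal (T k x))"
    proof
      assume "\<bar>u x\<bar> powr p \<le> c * (u x)\<^sup>2"
      then have "ennreal (\<bar>u x\<bar> powr p) \<le> ennreal (c * (u x)\<^sup>2)" by (rule ennreal_leI)
      then show ?thesis by (rule order_trans) simp
    next
      assume "\<exists>k. \<bar>u x\<bar> powr p \<le> T k x"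
      then obtain k where "\<bar>u x\<bar> powr p \<le> T k x" by blast
      then have "ennreal (\<bar>u x\<bar> powr p) \<le> ennreal (T k x)" by (rule ennreal_leI)
      also have "\<dots> \<le> (\<Sum>k. ennreal (T k x))"
        using sum_le_suminf[of "\<lambda>k. ennreal (T k x)" "{k}"] by auto
      finally show ?thesis by (rule order_trans) simp
    qed
  qed
  also have "\<dots> = (\<integral>\<^sup>+x. ennreal (c * (u x)\<^sup>2) \<partial>lebesgue) + (\<Sum>k. \<integral>\<^sup>+x. ennreal (T k x) \<partial>lebesgue)"
    by (subst nn_integral_add) (auto simp: nn_integral_suminf)
  also have "\<dots> \<le> ennreal (c * K\<^sup>2) + (\<Sum>k. ennreal (c * K\<^sup>2 * (288 * s) * (s / 4) ^ k))"
  proof (intro add_mono suminf_le summableI)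
    have "(\<integral>\<^sup>+x. ennreal (c * (u x)\<^sup>2) \<partial>lebesgue) = ennreal c * (\<integral>\<^sup>+x. ennreal ((u x)\<^sup>2) \<partial>lebesgue)"
      using c by (simp add: ennreal_mult nn_integral_cmult)
    also have "\<dots> \<le> ennreal c * ennreal (K\<^sup>2)"
      by (intro mult_left_mono order_trans[OF H1_energy_ge(1)[OF u] K(2)]) auto
    finally show "(\<integral>\<^sup>+x. ennreal (c * (u x)\<^sup>2) \<partial>lebesgue) \<le> ennreal (c * K\<^sup>2)"
      using c by (simp add: ennreal_mult)
    fix k
    have "(\<integral>\<^sup>+x. ennreal (T k x) \<partial>lebesgue) = (\<integral>\<^sup>+x. ennreal (c * s ^ Suc k * 4) * ennreal ((u x - dyadic_avg k u x)\<^sup>2) \<partial>lebesgue)"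
      using c by (simp add: T_def ennreal_mult[symmetric] mult.assoc)
    also have "\<dots> = ennreal (c * s ^ Suc k * 4) * (\<integral>\<^sup>+x. ennreal ((u x - dyadic_avg k u x)\<^sup>2) \<partial>lebesgue)"
      by (rule nn_integral_cmult) measurable
    also have "\<dots> \<le> ennreal (c * s ^ Suc k * 4) * (ennreal (72 / 4 ^ k) * ennreal (K\<^sup>2))"
      by (intro mult_left_mono order_trans[OF dyadic_poincare[OF u]] order_trans[OF H1_energy_ge(2)[OF u] K(2)]) auto
    also have "\<dots> = ennreal (c * s ^ Suc k * 4 * (72 / 4 ^ k * K\<^sup>2))"
      by (rule ennreal_mult3) (use c in auto)
    also have "c * s ^ Suc k * 4 * (72 / 4 ^ k * K\<^sup>2) = c * K\<^sup>2 * (288 * s) * (s / 4) ^ k"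
      by (simp add: power_divide)
    finally show "(\<integral>\<^sup>+x. ennreal (T k x) \<partial>lebesgue) \<le> ennreal (c * K\<^sup>2 * (288 * s) * (s / 4) ^ k)" .
  qed
  also have "(\<Sum>k. ennreal (c * K\<^sup>2 * (288 * s) * (s / 4) ^ k)) = ennreal (\<Sum>k. c * K\<^sup>2 * (288 * s) * (s / 4) ^ k)"
    using c by (intro suminf_ennreal2 summable_mult summable_geometric s1) auto
  also have "(\<Sum>k. c * K\<^sup>2 * (288 * s) * (s / 4) ^ k) = c * K\<^sup>2 * (288 * s) * (\<Sum>k. (s / 4) ^ k)"
    by (intro suminf_mult summable_geometric s1)
  also have "ennreal (c * K\<^sup>2) + ennreal (c * K\<^sup>2 * (288 * s) * (\<Sum>k. (s / 4) ^ k)) = ennreal (c * K\<^sup>2 * (1 + 288 * s * (\<Sum>k. (s / 4) ^ k)))"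
    using c s1 by (subst ennreal_plus[symmetric])
      (auto intro!: mult_nonneg_nonneg suminf_nonneg summable_geometric simp: algebra_simps)
  also have "c * K\<^sup>2 = 120 powr (p - 2) * K powr p"
  proof -
    have "K powr p = K powr (p - 2) * K powr 2" by (simp only: powr_add[symmetric]) simp
    also have "K powr 2 = K\<^sup>2" using K(1) by simp
    finally show ?thesis using K(1) by (simp only: c_def) (simp add: powr_mult)
  qed
  also have "120 powr (p - 2) * K powr p * (1 + 288 * s * (\<Sum>k. (s / 4) ^ k)) = sobolev_const p * K powr p"
    by (simp add: sobolev_const_def s_def)
  finally show ?thesis .
qed

section \<open>Weak compactness in complete semi-inner product spaces\<close>

text \<open>The rows are points of the compact product [-B, B]^N, and convergence there is
  coordinatewise; sequential compactness of this product selects the rows.\<close>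

lemma bounded_array_diagonal_subseq:
  fixes G :: "nat \<Rightarrow> nat \<Rightarrow> real"
  assumes "\<And>i j. \<bar>G i j\<bar> \<le> B"
  obtains r l where "strict_mono r" "\<And>k. (\<lambda>n. G (r n) k) \<longlonglongrightarrow> l k" "\<And>k. \<bar>l k\<bar> \<le> B"
proof -
  have "compactin (product_topology (\<lambda>_::nat. euclidean) UNIV) (PiE UNIV (\<lambda>_. {-B..B}))"
    by (simp add: compactin_PiE)
  then have "compact (PiE UNIV (\<lambda>_::nat. {-B..B}))"
    by (simp add: euclidean_product_topology)
  then have "seq_compact (PiE UNIV (\<lambda>_::nat. {-B..B}))"
    by (rule compact_imp_seq_compact)
  moreover have "\<forall>n. G n \<in> PiE UNIV (\<lambda>_::nat. {-B..B})"
    using assms by (auto simp: PiE_iff abs_le_iff) (meson minus_le_iff)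
  ultimately obtain l r where l: "l \<in> PiE UNIV (\<lambda>_::nat. {-B..B})" "strict_mono r" "(G \<circ> r) \<longlonglongrightarrow> l"
    unfolding seq_compact_def by metis
  have "(\<lambda>n. (G \<circ> r) n k) \<longlonglongrightarrow> l k" for k
    using continuous_on_tendsto_compose[OF continuous_on_product_coordinates[of k] l(3)] by simp
  then have lim: "\<And>k. (\<lambda>n. G (r n) k) \<longlonglongrightarrow> l k" by (simp add: o_def)
  have b: "\<bar>l k\<bar> \<le> B" for k
  proof -
    have "l k \<in> {-B..B}" using l(1) by (simp add: PiE_iff)
    then show ?thesis unfolding atLeastAtMost_iff by linarith
  qed
  show ?thesis by (rule that[of r l]) (rule l(2) lim b)+
qed

text \<open>Two extractions make the rows converge and then their limits converge to
  \<open>L\<close>. A third one thins out the indices so that every later entry of a row is already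
  close to the limit of the row; symmetry covers the other side of the diagonal.\<close>

lemma bounded_gram_subseq:
  fixes G :: "nat \<Rightarrow> nat \<Rightarrow> real"
  assumes B: "\<And>i j. \<bar>G i j\<bar> \<le> B" and sym: "\<And>i j. G i j = G j i"
  obtains r l L where "strict_mono r" "\<And>k. (\<lambda>n. G (r n) (r k)) \<longlonglongrightarrow> l k"
    "\<And>e. e > 0 \<Longrightarrow> \<exists>N. \<forall>i\<ge>N. \<forall>j\<ge>N. i \<noteq> j \<longrightarrow> \<bar>G (r i) (r j) - L\<bar> < e"
proof -
  obtain r1 l1 where r1: "strict_mono r1" "\<And>k. (\<lambda>n. G (r1 n) k) \<longlonglongrightarrow> l1 k" "\<And>k. \<bar>l1 k\<bar> \<le> B"
    by (rule bounded_array_diagonal_subseq[of G B, OF B]) blast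
  have "bounded (range (\<lambda>n. l1 (r1 n)))"
    using r1(3) by (auto simp: bounded_iff)
  then obtain L r2 where r2: "strict_mono r2" "((\<lambda>n. l1 (r1 n)) \<circ> r2) \<longlonglongrightarrow> L"
    using bounded_imp_convergent_subsequence by metis
  define p where "p = r1 \<circ> r2"
  have p: "strict_mono p" unfolding p_def using r1(1) r2(1) by (rule strict_mono_o)
  have lim: "(\<lambda>n. G (p n) (p k)) \<longlonglongrightarrow> l1 (p k)" for k
    using LIMSEQ_subseq_LIMSEQ[OF r1(2)[of "p k"] r2(1)] by (simp add: p_def o_def)
  have "\<exists>N. \<forall>n\<ge>N. \<bar>G (p n) (p k) - l1 (p k)\<bar> < 1 / real (Suc k)" for k
    using LIMSEQ_D[OF lim[of k], of "1 / real (Suc k)"] by simp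
  then obtain N where N: "\<And>k n. N k \<le> n \<Longrightarrow> \<bar>G (p n) (p k) - l1 (p k)\<bar> < 1 / real (Suc k)" by metis
  \<comment> \<open>Each index lies beyond the threshold \<open>N\<close> of its predecessor, so for
    j < i the entry at (i, j) is within 1/(j+1) of its row limit.\<close>
  define t where "t = rec_nat 0 (\<lambda>k x. max (Suc x) (N x))"
  have t_Suc: "t (Suc k) = max (Suc (t k)) (N (t k))" for k by (simp add: t_def)
  have t: "strict_mono t" by (simp add: strict_mono_Suc_iff t_Suc less_max_iff_disj)
  define r where "r = p \<circ> t"
  show ?thesis
  proof (rule that[of r "\<lambda>k. l1 (r k)" L])
    show "strict_mono r" unfolding r_def using p t by (rule strict_mono_o)
    show "(\<lambda>n. G (r n) (r k)) \<longlonglongrightarrow> l1 (r k)" for k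
      using LIMSEQ_subseq_LIMSEQ[OF lim[of "t k"] t] by (simp add: r_def o_def)
    fix e :: real assume e: "e > 0"
    have close: "\<bar>G (r i) (r j) - l1 (r j)\<bar> < 1 / real (Suc j)" if "j < i" for i j
    proof -
      have "t (Suc j) \<le> t i" using that t by (simp add: strict_mono_less_eq)
      then have "N (t j) \<le> t i" by (simp add: t_Suc)
      then have "\<bar>G (r i) (r j) - l1 (r j)\<bar> < 1 / real (Suc (t j))" using N by (simp add: r_def)
      also have "\<dots> \<le> 1 / real (Suc j)"
        using strict_mono_imp_increasing[OF t, of j] by (simp add: field_simps)
      finally show ?thesis .
    qed
    have "(\<lambda>n. l1 (r n)) \<longlonglongrightarrow> L"
      using LIMSEQ_subseq_LIMSEQ[OF r2(2) t] by (simp add: r_def p_def o_def)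
    then obtain N1 where N1: "\<And>n. N1 \<le> n \<Longrightarrow> \<bar>l1 (r n) - L\<bar> < e / 2"
      using LIMSEQ_D[of _ L "e / 2"] e by (metis half_gt_zero real_norm_def)
    obtain N2 where N2: "1 / real (Suc N2) < e / 2"
      using e by (meson half_gt_zero nat_approx_posE)
    have one: "\<bar>G (r i) (r j) - L\<bar> < e" if "max N1 N2 \<le> j" "j < i" for i j
    proof -
      have "1 / real (Suc j) \<le> 1 / real (Suc N2)" using that by (simp add: field_simps)
      then show ?thesis using close[OF that(2)] N1[of j] N2 that by linarith
    qed
    have "\<bar>G (r i) (r j) - L\<bar> < e" if "max N1 N2 \<le> i" "max N1 N2 \<le> j" "i \<noteq> j" for i j
      using one[of j i] one[of i j] that sym[of "r i" "r j"] by (cases "j < i") auto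
    then show "\<exists>N. \<forall>i\<ge>N. \<forall>j\<ge>N. i \<noteq> j \<longrightarrow> \<bar>G (r i) (r j) - L\<bar> < e" by blast
  qed
qed

text \<open>The m+1 indices m+1, ..., 2m+1: the length grows, which makes diagonal terms negligible,
  and the start moves to infinity, so only the tail of a sequence enters.\<close>

definition block :: "nat \<Rightarrow> nat set" where
  "block m = {Suc m..<2 * Suc m}"

lemma finite_block [simp]: "finite (block m)" and card_block [simp]: "card (block m) = Suc m"
  and block_ge: "i \<in> block m \<Longrightarrow> m \<le> i"
  by (auto simp: block_def)

lemma block_average_tendsto:
  fixes a :: "nat \<Rightarrow> real"
  assumes "a \<longlonglongrightarrow> l"
  shows "(\<lambda>m. \<Sum>i\<in>block m. 1 / real (Suc m) * a i) \<longlonglongrightarrow> l"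
proof (rule LIMSEQ_I)
  fix e :: real assume "e > 0"
  then obtain N where N: "\<And>n. N \<le> n \<Longrightarrow> norm (a n - l) < e" using LIMSEQ_D[OF assms] by metis
  have "norm ((\<Sum>i\<in>block m. 1 / real (Suc m) * a i) - l) < e" if "N \<le> m" for m
  proof -
    have "(\<Sum>i\<in>block m. 1 / real (Suc m) * a i) - l = (\<Sum>i\<in>block m. 1 / real (Suc m) * (a i - l))"
      by (simp add: right_diff_distrib sum_subtractf del: of_nat_Suc)
    also have "norm \<dots> \<le> (\<Sum>i\<in>block m. norm (1 / real (Suc m) * (a i - l)))" by (rule norm_sum)
    also have "\<dots> < (\<Sum>i\<in>block m. 1 / real (Suc m) * e)"
    proof (rule sum_strict_mono)
      show "block m \<noteq> {}" by (simp add: block_def)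
      fix i assume "i \<in> block m"
      then have "norm (a i - l) < e" using N block_ge that by (meson order_trans)
      then show "norm (1 / real (Suc m) * (a i - l)) < 1 / real (Suc m) * e"
        by (simp add: norm_mult divide_strict_right_mono)
    qed simp
    also have "\<dots> = e" by (simp del: of_nat_Suc)
    finally show ?thesis .
  qed
  then show "\<exists>no. \<forall>m\<ge>no. norm ((\<Sum>i\<in>block m. 1 / real (Suc m) * a i) - l) < e" by blast
qed

section \<open>Weak sequential compactness in complete semi-inner product spaces\<close>

text \<open>Vectors are functions and the form is only semidefinite, as for functions modulo null
  sets. Limits are therefore determined up to a difference d with \<open>ip d d = 0\<close>, on
  which every bounded functional vanishes.\<close>

locale semi_hilbert =
  fixes X :: "('a \<Rightarrow> real) set" and ip :: "('a \<Rightarrow> real) \<Rightarrow> ('a \<Rightarrow> real) \<Rightarrow> real"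
  assumes lincomb: "u \<in> X \<Longrightarrow> v \<in> X \<Longrightarrow> (\<lambda>x. a * u x + b * v x) \<in> X"
    and ip_lincomb: "u \<in> X \<Longrightarrow> v \<in> X \<Longrightarrow> w \<in> X \<Longrightarrow> ip (\<lambda>x. a * u x + b * v x) w = a * ip u w + b * ip v w"
    and ip_sym: "u \<in> X \<Longrightarrow> v \<in> X \<Longrightarrow> ip u v = ip v u"
    and ip_nonneg: "u \<in> X \<Longrightarrow> 0 \<le> ip u u"
    and ip_complete: "(\<And>n::nat. s n \<in> X) \<Longrightarrow>
      (\<And>e. e > 0 \<Longrightarrow> \<exists>N. \<forall>m\<ge>N. \<forall>n\<ge>N. ip (\<lambda>x. s m x - s n x) (\<lambda>x. s m x - s n x) < e) \<Longrightarrow>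
      \<exists>w\<in>X. (\<lambda>n. ip (\<lambda>x. s n x - w x) (\<lambda>x. s n x - w x)) \<longlonglongrightarrow> 0"
begin

definition bounded_functional :: "(('a \<Rightarrow> real) \<Rightarrow> real) \<Rightarrow> bool" where
  "bounded_functional F \<longleftrightarrow> (\<forall>u\<in>X. \<forall>v\<in>X. \<forall>a b. F (\<lambda>x. a * u x + b * v x) = a * F u + b * F v) \<and>
     (\<exists>C. \<forall>u\<in>X. \<bar>F u\<bar> \<le> C * sqrt (ip u u))"

lemma functional_lincomb:
  "bounded_functional F \<Longrightarrow> u \<in> X \<Longrightarrow> v \<in> X \<Longrightarrow> F (\<lambda>x. a * u x + b * v x) = a * F u + b * F v"
  unfolding bounded_functional_def by blast

lemma diff_in: "u \<in> X \<Longrightarrow> v \<in> X \<Longrightarrow> (\<lambda>x. u x - v x) \<in> X"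
  using lincomb[of u v 1 "-1"] by simp

lemma functional_diff:
  "bounded_functional F \<Longrightarrow> u \<in> X \<Longrightarrow> v \<in> X \<Longrightarrow> F (\<lambda>x. u x - v x) = F u - F v"
  using functional_lincomb[of F u v 1 "-1"] by simp

lemma ip_lincomb_right:
  "u \<in> X \<Longrightarrow> v \<in> X \<Longrightarrow> w \<in> X \<Longrightarrow> ip w (\<lambda>x. a * u x + b * v x) = a * ip w u + b * ip w v"
  using ip_lincomb[of u v w a b] by (simp add: ip_sym lincomb)

lemma ip_diff: "u \<in> X \<Longrightarrow> v \<in> X \<Longrightarrow> w \<in> X \<Longrightarrow> ip (\<lambda>x. u x - v x) w = ip u w - ip v w"
  using ip_lincomb[of u v w 1 "-1"] by simp

lemma ip_diff_diff:
  assumes "u \<in> X" "v \<in> X"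
  shows "ip (\<lambda>x. u x - v x) (\<lambda>x. u x - v x) = ip u u - 2 * ip u v + ip v v"
proof -
  have "ip (\<lambda>x. u x - v x) (\<lambda>x. u x - v x) = ip u (\<lambda>x. u x - v x) - ip v (\<lambda>x. u x - v x)"
    by (intro ip_diff diff_in assms)
  also have "\<dots> = ip (\<lambda>x. u x - v x) u - ip (\<lambda>x. u x - v x) v"
    using assms by (simp add: ip_sym diff_in)
  also have "\<dots> = ip u u - 2 * ip u v + ip v v"
    using assms ip_sym[of v u] by (simp add: ip_diff)
  finally show ?thesis .
qed

lemma cauchy_schwarz:
  assumes u: "u \<in> X" and v: "v \<in> X"
  shows "(ip u v)\<^sup>2 \<le> ip u u * ip v v"
proof -
  have q: "0 \<le> s\<^sup>2 * ip u u + 2 * s * t * ip u v + t\<^sup>2 * ip v v" for s t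
  proof -
    define w where "w = (\<lambda>x. s * u x + t * v x)"
    have w: "w \<in> X" unfolding w_def by (intro lincomb u v)
    have "ip w w = s * ip w u + t * ip w v"
      using ip_lincomb_right[OF u v w, of s t] by (simp add: w_def)
    also have "\<dots> = s\<^sup>2 * ip u u + 2 * s * t * ip u v + t\<^sup>2 * ip v v"
      unfolding w_def by (simp add: ip_lincomb u v ip_sym[OF v u] power2_eq_square algebra_simps)
    finally show ?thesis using ip_nonneg[OF w] by simp
  qed
  show ?thesis
  proof (cases "ip v v = 0")
    case True
    have "ip u v = 0"
    proof (rule ccontr)
      assume *: "ip u v \<noteq> 0"
      \<comment> \<open>For \<open>ip v v = 0\<close> the quadratic form is affine in t; this t
        makes it equal to -1.\<close>
      show False using q[of 1 "- (ip u u + 1) / (2 * ip u v)"] True * by (simp add: field_simps)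
    qed
    then show ?thesis using True by simp
  next
    case False
    then have pos: "ip v v > 0" using ip_nonneg[OF v] by simp
    \<comment> \<open>The discriminant computation: the form at s = \<open>ip v v\<close>, t =
      -\<open>ip u v\<close> factors.\<close>
    have "0 \<le> ip v v * (ip u u * ip v v - (ip u v)\<^sup>2)"
      using q[of "ip v v" "- ip u v"] by (simp add: power2_eq_square algebra_simps)
    then show ?thesis using pos by (simp add: zero_le_mult_iff)
  qed
qed

lemma bounded_functional_ip: "w \<in> X \<Longrightarrow> bounded_functional (\<lambda>u. ip w u)"
  unfolding bounded_functional_def
proof (intro conjI ballI allI exI)
  fix u assume w: "w \<in> X" and u: "u \<in> X"
  have "\<bar>ip w u\<bar> = sqrt ((ip w u)\<^sup>2)" by simp
  also have "\<dots> \<le> sqrt (ip w w * ip u u)" by (intro real_sqrt_le_mono cauchy_schwarz w u)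
  finally show "\<bar>ip w u\<bar> \<le> sqrt (ip w w) * sqrt (ip u u)" by (simp add: real_sqrt_mult)
qed (auto simp: ip_lincomb_right)

lemma sum_in: "finite A \<Longrightarrow> (\<And>i. s i \<in> X) \<Longrightarrow> (\<lambda>x. \<Sum>i\<in>A. c i * s i x) \<in> X"
proof (induction A rule: finite_induct)
  case empty
  then show ?case using lincomb[of "s undefined" "s undefined" 0 0] by simp
next
  case (insert j A)
  then show ?case using lincomb[of "s j" "\<lambda>x. \<Sum>i\<in>A. c i * s i x" "c j" 1] by simp
qed

lemma functional_sum:
  assumes F: "bounded_functional F" and "finite A" and s: "\<And>i. s i \<in> X"
  shows "F (\<lambda>x. \<Sum>i\<in>A. c i * s i x) = (\<Sum>i\<in>A. c i * F (s i))"
  using \<open>finite A\<close>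
proof (induction A rule: finite_induct)
  case empty
  have "F (\<lambda>x. 0 * s undefined x + 0 * s undefined x) = 0 * F (s undefined) + 0 * F (s undefined)"
    by (intro functional_lincomb F s)
  then show ?case by simp
next
  case (insert j A)
  have "F (\<lambda>x. c j * s j x + 1 * (\<Sum>i\<in>A. c i * s i x)) = c j * F (s j) + 1 * F (\<lambda>x. \<Sum>i\<in>A. c i * s i x)"
    by (intro functional_lincomb F s sum_in insert.hyps)
  then show ?case using insert by simp
qed

definition block_avg :: "(nat \<Rightarrow> 'a \<Rightarrow> real) \<Rightarrow> nat \<Rightarrow> 'a \<Rightarrow> real" where
  "block_avg s m = (\<lambda>x. \<Sum>i\<in>block m. 1 / real (Suc m) * s i x)"

lemma block_avg_in: "(\<And>i. s i \<in> X) \<Longrightarrow> block_avg s m \<in> X"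
  unfolding block_avg_def by (rule sum_in) auto

lemma functional_block_avg:
  "bounded_functional F \<Longrightarrow> (\<And>i. s i \<in> X) \<Longrightarrow> F (block_avg s m) = (\<Sum>i\<in>block m. 1 / real (Suc m) * F (s i))"
  unfolding block_avg_def by (rule functional_sum) auto

lemma functional_strong_tendsto:
  assumes F: "bounded_functional F" and s: "\<And>n. s n \<in> X" "w \<in> X"
    and "(\<lambda>n::nat. ip (\<lambda>x. s n x - w x) (\<lambda>x. s n x - w x)) \<longlonglongrightarrow> 0"
  shows "(\<lambda>n. F (s n)) \<longlonglongrightarrow> F w"
proof -
  obtain C where C: "\<And>u. u \<in> X \<Longrightarrow> \<bar>F u\<bar> \<le> C * sqrt (ip u u)" using F unfolding bounded_functional_def by blast
  have b: "norm (F (s n) - F w) \<le> C * sqrt (ip (\<lambda>x. s n x - w x) (\<lambda>x. s n x - w x))" for n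
    using C[OF diff_in[OF s(1)[of n] s(2)]] functional_diff[OF F s(1)[of n] s(2)] by simp
  have "(\<lambda>n. C * sqrt (ip (\<lambda>x. s n x - w x) (\<lambda>x. s n x - w x))) \<longlonglongrightarrow> C * sqrt 0"
    by (intro tendsto_intros assms)
  then have "(\<lambda>n. C * sqrt (ip (\<lambda>x. s n x - w x) (\<lambda>x. s n x - w x))) \<longlonglongrightarrow> 0" by simp
  from Lim_null_comparison[OF always_eventually[OF allI[OF b]] this]
  have "(\<lambda>n. F (s n) - F w) \<longlonglongrightarrow> 0" .
  then show ?thesis by (simp add: LIM_zero_iff)
qed

text \<open>The difference is a double average of \<open>ip (s i) (s j) - L\<close>. Off-diagonal
  terms are at most \<open>e\<close>. At most m+1 pairs are diagonal, each with weight
  1/((m+1)(n+1)) and size at most B + |L|, which gives the second term.\<close>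

lemma ip_block_avg_close:
  assumes s: "\<And>i. s i \<in> X" and B: "\<And>i j. \<bar>ip (s i) (s j)\<bar> \<le> B"
    and N: "\<And>i j. N \<le> i \<Longrightarrow> N \<le> j \<Longrightarrow> i \<noteq> j \<Longrightarrow> \<bar>ip (s i) (s j) - L\<bar> \<le> e" and e: "0 \<le> e"
    and mn: "N \<le> m" "N \<le> n"
  shows "\<bar>ip (block_avg s m) (block_avg s n) - L\<bar> \<le> e + (B + \<bar>L\<bar>) / real (Suc n)"
proof -
  define a where "a = 1 / real (Suc m)"
  define b where "b = 1 / real (Suc n)"
  have ab: "0 < a" "0 < b" "real (Suc m) * a = 1" "real (Suc n) * b = 1" by (auto simp: a_def b_def)
  have B0: "0 \<le> B" using B[of 0 0] by linarith
  have "ip (block_avg s m) (block_avg s n) = (\<Sum>j\<in>block n. b * ip (block_avg s m) (s j))"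
    unfolding b_def by (rule functional_block_avg[OF bounded_functional_ip]) (auto intro: block_avg_in s)
  also have "\<dots> = (\<Sum>j\<in>block n. b * (\<Sum>i\<in>block m. a * ip (s i) (s j)))"
  proof -
    have "ip (block_avg s m) (s j) = (\<Sum>i\<in>block m. a * ip (s i) (s j))" for j
      using functional_block_avg[OF bounded_functional_ip[OF s], of s j m] s
      by (simp add: a_def ip_sym[OF s block_avg_in[OF s]] ip_sym[of "s j"])
    then show ?thesis by simp
  qed
  finally have "ip (block_avg s m) (block_avg s n) - L = (\<Sum>j\<in>block n. \<Sum>i\<in>block m. a * b * (ip (s i) (s j) - L))"
  proof -
    assume *: "ip (block_avg s m) (block_avg s n) = (\<Sum>j\<in>block n. b * (\<Sum>i\<in>block m. a * ip (s i) (s j)))"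
    have "L = (\<Sum>j\<in>block n. \<Sum>i\<in>block m. a * b * L)"
      using ab by (simp add: a_def b_def del: of_nat_Suc)
    with * show ?thesis
      by (simp add: right_diff_distrib sum_subtractf sum_distrib_left mult_ac)
  qed
  also have "\<bar>\<dots>\<bar> \<le> (\<Sum>j\<in>block n. \<Sum>i\<in>block m. a * b * (e + (if i = j then B + \<bar>L\<bar> else 0)))"
  proof (intro order_trans[OF sum_abs] sum_mono)
    fix i j assume ij: "j \<in> block n" "i \<in> block m"
    have "\<bar>ip (s i) (s j) - L\<bar> \<le> e + (if i = j then B + \<bar>L\<bar> else 0)"
    proof (cases "i = j")
      case True
      then show ?thesis using B[of i j] e by simp
    next
      case False
      then show ?thesis using N[of i j] block_ge[OF ij(1)] block_ge[OF ij(2)] mn by simp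
    qed
    then show "\<bar>a * b * (ip (s i) (s j) - L)\<bar> \<le> a * b * (e + (if i = j then B + \<bar>L\<bar> else 0))"
      using ab by (simp add: abs_mult)
  qed
  also have "\<dots> = e + (\<Sum>j\<in>block n. \<Sum>i\<in>block m. if i = j then a * b * (B + \<bar>L\<bar>) else 0)"
  proof -
    have "(\<Sum>j\<in>block n. \<Sum>i\<in>block m. a * b * e) = e"
      using ab by (simp add: a_def b_def del: of_nat_Suc)
    moreover have "a * b * (e + (if i = j then B + \<bar>L\<bar> else 0)) = a * b * e + (if i = j then a * b * (B + \<bar>L\<bar>) else 0)" for i j :: nat
      by (simp add: distrib_left)
    ultimately show ?thesis by (simp add: sum.distrib del: of_nat_Suc)
  qed
  also have "(\<Sum>j\<in>block n. \<Sum>i\<in>block m. if i = j then a * b * (B + \<bar>L\<bar>) else 0) \<le> (\<Sum>i\<in>block m. a * b * (B + \<bar>L\<bar>))"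
  proof -
    have "(\<Sum>j\<in>block n. if i = j then a * b * (B + \<bar>L\<bar>) else 0) \<le> a * b * (B + \<bar>L\<bar>)" for i
      using ab B0 by simp
    then show ?thesis by (subst sum.swap) (rule sum_mono)
  qed
  also have "\<dots> = (B + \<bar>L\<bar>) / real (Suc n)"
    using ab by (simp add: a_def b_def del: of_nat_Suc)
  finally show ?thesis by simp
qed

text \<open>Averages over growing blocks converge strongly (Banach--Saks); the Gram matrix of
  the subsequence has a double limit off the diagonal, and the diagonal is negligible in the average.\<close>

lemma banach_saks:
  fixes s :: "nat \<Rightarrow> 'a \<Rightarrow> real"
  assumes s: "\<And>i. s i \<in> X" and B: "\<And>i. ip (s i) (s i) \<le> B"
  obtains r x l where "strict_mono r" "x \<in> X" 
    "(\<lambda>m. ip (\<lambda>y. block_avg (s \<circ> r) m y - x y) (\<lambda>y. block_avg (s \<circ> r) m y - x y)) \<longlonglongrightarrow> 0"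
    "\<And>k. (\<lambda>n. ip (s (r n)) (s (r k))) \<longlonglongrightarrow> l k"
proof -
  have GB: "\<bar>ip (s i) (s j)\<bar> \<le> B" for i j
  proof -
    have "(ip (s i) (s j))\<^sup>2 \<le> B * B"
      using cauchy_schwarz[OF s s] B ip_nonneg[OF s] by (meson order_trans mult_mono)
    then have "(ip (s i) (s j))\<^sup>2 \<le> B\<^sup>2" by (simp add: power2_eq_square)
    moreover have "0 \<le> B" using B[of 0] ip_nonneg[OF s, of 0] by linarith
    ultimately show ?thesis by (simp add: abs_le_square_iff[symmetric])
  qed
  obtain r l L where r: "strict_mono r" "\<And>k. (\<lambda>n. ip (s (r n)) (s (r k))) \<longlonglongrightarrow> l k"
    "\<And>e. e > 0 \<Longrightarrow> \<exists>N. \<forall>i\<ge>N. \<forall>j\<ge>N. i \<noteq> j \<longrightarrow> \<bar>ip (s (r i)) (s (r j)) - L\<bar> < e"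
    by (rule bounded_gram_subseq[of "\<lambda>i j. ip (s i) (s j)" B, OF GB ip_sym[OF s s]]) blast
  define a where "a = block_avg (s \<circ> r)"
  have sr: "(s \<circ> r) i \<in> X" for i using s by simp
  have a: "a m \<in> X" for m unfolding a_def by (rule block_avg_in[OF sr])
  have "\<exists>w\<in>X. (\<lambda>n. ip (\<lambda>y. a n y - w y) (\<lambda>y. a n y - w y)) \<longlonglongrightarrow> 0"
  proof (rule ip_complete[OF a])
    fix e :: real assume e: "e > 0"
    obtain N1 where N1: "\<And>i j. N1 \<le> i \<Longrightarrow> N1 \<le> j \<Longrightarrow> i \<noteq> j \<Longrightarrow> \<bar>ip (s (r i)) (s (r j)) - L\<bar> < e / 16"
      using r(3)[of "e / 16"] e by auto
    obtain N2 where N2: "(B + \<bar>L\<bar>) * 16 / e < real N2" using reals_Archimedean2 by blast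
    define N where "N = max N1 N2"
    have c: "\<bar>ip (a m) (a n) - L\<bar> < e / 8" if "N \<le> m" "N \<le> n" for m n
    proof -
      have "\<bar>ip (a m) (a n) - L\<bar> \<le> e / 16 + (B + \<bar>L\<bar>) / real (Suc n)"
        unfolding a_def
        by (rule ip_block_avg_close[where N = N and B = B]) (use sr GB N1 that e in \<open>auto simp: N_def less_imp_le\<close>)
      moreover have "(B + \<bar>L\<bar>) / real (Suc n) < e / 16"
      proof -
        have "(B + \<bar>L\<bar>) * 16 / e < real (Suc n)" using N2 that by (simp add: N_def)
        then show ?thesis using e by (simp add: field_simps)
      qed
      ultimately show ?thesis by linarith
    qed
    \<comment> \<open>In the expansion of the square the four copies of \<open>L\<close> cancel,
      leaving at most four errors below e/8.\<close>
    have "ip (\<lambda>x. a m x - a n x) (\<lambda>x. a m x - a n x) < e" if "N \<le> m" "N \<le> n" for m n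
      using c[OF that] c[OF that(1) that(1)] c[OF that(2) that(2)] e unfolding ip_diff_diff[OF a a] by linarith
    then show "\<exists>N. \<forall>m\<ge>N. \<forall>n\<ge>N. ip (\<lambda>x. a m x - a n x) (\<lambda>x. a m x - a n x) < e" by blast
  qed
  then obtain x where "x \<in> X" "(\<lambda>n. ip (\<lambda>y. a n y - x y) (\<lambda>y. a n y - x y)) \<longlonglongrightarrow> 0" by blast
  then show ?thesis using that[OF r(1) _ _ r(2)] unfolding a_def by blast
qed

text \<open>Two evaluations of F on the block averages: continuity gives F x, and averaging the
  convergent values gives \<open>c\<close>.\<close>

lemma block_avg_functional_limit:
  assumes F: "bounded_functional F" and s: "\<And>i. s i \<in> X" "x \<in> X"
    and "(\<lambda>m. ip (\<lambda>y. block_avg s m y - x y) (\<lambda>y. block_avg s m y - x y)) \<longlonglongrightarrow> 0"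
    and "(\<lambda>n. F (s n)) \<longlonglongrightarrow> c"
  shows "F x = c"
proof -
  have "(\<lambda>m. F (block_avg s m)) \<longlonglongrightarrow> F x"
    by (rule functional_strong_tendsto[OF F block_avg_in[OF s(1)] s(2) assms(4)])
  moreover have "(\<lambda>m. F (block_avg s m)) \<longlonglongrightarrow> c"
    unfolding functional_block_avg[OF F s(1)] by (rule block_average_tendsto[OF assms(5)])
  ultimately show ?thesis by (rule LIMSEQ_unique)
qed

text \<open>The candidate x is the strong limit of block averages. If F failed to converge to F x
  along the subsequence, a further subsequence with F-values tending to some other c would have
  block averages converging to some x' with F x' = c. But x and x' have the same inner products with
  all the vectors of the subsequence, so d = x' - x is orthogonal to these, hence to their strong
  limits x and x', hence to itself; thus F d = 0, a contradiction.\<close>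

lemma weak_compactness:
  fixes s :: "nat \<Rightarrow> 'a \<Rightarrow> real"
  assumes s: "\<And>i. s i \<in> X" and B: "\<And>i. ip (s i) (s i) \<le> B"
  obtains r x where "strict_mono r" "x \<in> X" "\<And>F. bounded_functional F \<Longrightarrow> (\<lambda>n. F (s (r n))) \<longlonglongrightarrow> F x"
proof -
  obtain r x l where r: "strict_mono r" "x \<in> X" 
    "(\<lambda>m. ip (\<lambda>y. block_avg (s \<circ> r) m y - x y) (\<lambda>y. block_avg (s \<circ> r) m y - x y)) \<longlonglongrightarrow> 0"
    "\<And>k. (\<lambda>n. ip (s (r n)) (s (r k))) \<longlonglongrightarrow> l k"
    by (rule banach_saks[of s B, OF s B]) blast
  have sr: "(s \<circ> r) i \<in> X" for i using s by simp
  have x: "ip (s (r k)) x = l k" for k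
    by (rule block_avg_functional_limit[OF bounded_functional_ip[OF s] sr r(2,3)])
       (use r(4)[of k] ip_sym[OF s s] in \<open>simp add: o_def\<close>)
  have "(\<lambda>n. F (s (r n))) \<longlonglongrightarrow> F x" if F: "bounded_functional F" for F
  proof (rule ccontr)
    obtain C where C: "\<And>u. u \<in> X \<Longrightarrow> \<bar>F u\<bar> \<le> C * sqrt (ip u u)" using F unfolding bounded_functional_def by blast
    assume "\<not> (\<lambda>n. F (s (r n))) \<longlonglongrightarrow> F x"
    then obtain e where e: "e > 0" "\<forall>N. \<exists>n\<ge>N. e \<le> \<bar>F (s (r n)) - F x\<bar>"
      unfolding lim_sequentially dist_real_def by (auto simp: not_less)
    then have "infinite {n. e \<le> \<bar>F (s (r n)) - F x\<bar>}" by (auto simp: infinite_nat_iff_unbounded_le)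
    from infinite_enumerate[OF this] obtain p :: "nat \<Rightarrow> nat"
      where "strict_mono p \<and> (\<forall>n. p n \<in> {n. e \<le> \<bar>F (s (r n)) - F x\<bar>})" ..
    then have p: "strict_mono p" "\<And>n. e \<le> \<bar>F (s (r (p n))) - F x\<bar>" by auto
    have "bounded (range (\<lambda>n. F (s (r (p n)))))"
    proof -
      have "\<bar>F (s i)\<bar> \<le> \<bar>C\<bar> * sqrt B" for i
      proof -
        have "\<bar>F (s i)\<bar> \<le> C * sqrt (ip (s i) (s i))" by (rule C[OF s])
        also have "\<dots> \<le> \<bar>C\<bar> * sqrt B" using B ip_nonneg[OF s] by (intro mult_mono) auto
        finally show ?thesis .
      qed
      then show ?thesis by (auto simp: bounded_iff)
    qed
    then obtain c p2 where p2: "strict_mono p2" "((\<lambda>n. F (s (r (p n)))) \<circ> p2) \<longlonglongrightarrow> c"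
      using bounded_imp_convergent_subsequence by metis
    define q where "q = p \<circ> p2"
    have q: "strict_mono q" unfolding q_def using p(1) p2(1) by (rule strict_mono_o)
    define s' where "s' = s \<circ> r \<circ> q"
    have s': "s' i \<in> X" "ip (s' i) (s' i) \<le> B" for i using s B by (auto simp: s'_def)
    obtain r3 x' l' where r3: "strict_mono r3" "x' \<in> X" 
      "(\<lambda>m. ip (\<lambda>y. block_avg (s' \<circ> r3) m y - x' y) (\<lambda>y. block_avg (s' \<circ> r3) m y - x' y)) \<longlonglongrightarrow> 0"
      by (rule banach_saks[of s' B, OF s']) blast
    have sr3: "(s' \<circ> r3) i \<in> X" for i using s' by simp
    have qr: "strict_mono (q \<circ> r3)" using q r3(1) by (rule strict_mono_o)
    have "F x' = c"
      by (rule block_avg_functional_limit[OF F sr3 r3(2,3)])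
         (use LIMSEQ_subseq_LIMSEQ[OF p2(2) r3(1)] in \<open>simp add: s'_def q_def o_def\<close>)
    have x': "ip (s (r k)) x' = l k" for k
      by (rule block_avg_functional_limit[OF bounded_functional_ip[OF s] sr3 r3(2,3)])
         (use LIMSEQ_subseq_LIMSEQ[OF r(4)[of k] qr] ip_sym[OF s s] in \<open>simp add: s'_def o_def\<close>)
    define d where "d = (\<lambda>y. x' y - x y)"
    have d: "d \<in> X" unfolding d_def by (intro diff_in r3 r)
    have dk: "ip d (s (r k)) = 0" for k
      unfolding d_def using x[of k] x'[of k] s r(2) r3(2) by (simp add: ip_diff ip_sym)
    \<comment> \<open>Orthogonality passes from the sequence to the limits of its block averages
      because the functional given by d is bounded.\<close>
    have "ip d x = 0"
      by (rule block_avg_functional_limit[OF bounded_functional_ip[OF d] sr r(2,3)]) (simp add: dk)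
    moreover have "ip d x' = 0"
      by (rule block_avg_functional_limit[OF bounded_functional_ip[OF d] sr3 r3(2,3)]) (simp add: dk s'_def)
    ultimately have "ip d d = 0"
      using ip_diff[OF r3(2) r(2) d] d r(2) r3(2) by (simp add: d_def[symmetric] ip_sym)
    then have "F d = 0" using C[OF d] by simp
    moreover have "F d = F x' - F x"
      unfolding d_def by (rule functional_diff[OF F r3(2) r(2)])
    ultimately have "F x = c" using \<open>F x' = c\<close> by simp
    moreover have "e \<le> \<bar>c - F x\<bar>"
    proof (rule LIMSEQ_le_const)
      show "(\<lambda>n. \<bar>F (s (r (p (p2 n)))) - F x\<bar>) \<longlonglongrightarrow> \<bar>c - F x\<bar>"
        using p2(2) by (intro tendsto_intros) (simp add: o_def)
    qed (use p(2) in auto)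
    ultimately show False using e by simp
  qed
  then show ?thesis using that[OF r(1,2)] by blast
qed

end

section \<open>Completeness of the Sobolev space\<close>

text \<open>Cauchy-Schwarz in scaled form: the arithmetic-geometric inequality with weights B/(2A)
  and A/(2B) integrates to AB/2 + AB/2.\<close>

lemma nn_integral_abs_mult_le:
  fixes f g :: "'a \<Rightarrow> real"
  assumes [measurable]: "f \<in> borel_measurable M" "g \<in> borel_measurable M"
    and A: "0 < A" "(\<integral>\<^sup>+x. ennreal ((f x)\<^sup>2) \<partial>M) \<le> ennreal (A\<^sup>2)"
    and B: "0 < B" "(\<integral>\<^sup>+x. ennreal ((g x)\<^sup>2) \<partial>M) \<le> ennreal (B\<^sup>2)"
  shows "(\<integral>\<^sup>+x. ennreal \<bar>f x * g x\<bar> \<partial>M) \<le> ennreal (A * B)"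
proof -
  have pt: "\<bar>f x * g x\<bar> \<le> B / (2 * A) * (f x)\<^sup>2 + A / (2 * B) * (g x)\<^sup>2" for x
  proof -
    have "0 \<le> (B * \<bar>f x\<bar> - A * \<bar>g x\<bar>)\<^sup>2" by simp
    then have "2 * A * B * (\<bar>f x\<bar> * \<bar>g x\<bar>) \<le> B\<^sup>2 * (f x)\<^sup>2 + A\<^sup>2 * (g x)\<^sup>2"
      by (simp add: power2_diff power_mult_distrib algebra_simps)
    then show ?thesis using A(1) B(1) by (simp add: abs_mult field_simps power2_eq_square)
  qed
  have "(\<integral>\<^sup>+x. ennreal \<bar>f x * g x\<bar> \<partial>M)
      \<le> (\<integral>\<^sup>+x. ennreal (B / (2 * A)) * ennreal ((f x)\<^sup>2) + ennreal (A / (2 * B)) * ennreal ((g x)\<^sup>2) \<partial>M)"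
  proof (rule nn_integral_mono)
    fix x
    have "ennreal \<bar>f x * g x\<bar> \<le> ennreal (B / (2 * A) * (f x)\<^sup>2 + A / (2 * B) * (g x)\<^sup>2)"
      by (rule ennreal_leI[OF pt])
    also have "\<dots> = ennreal (B / (2 * A)) * ennreal ((f x)\<^sup>2) + ennreal (A / (2 * B)) * ennreal ((g x)\<^sup>2)"
      using A(1) B(1) by (simp add: ennreal_mult[symmetric])
    finally show "ennreal \<bar>f x * g x\<bar> \<le> ennreal (B / (2 * A)) * ennreal ((f x)\<^sup>2) + ennreal (A / (2 * B)) * ennreal ((g x)\<^sup>2)" .
  qed
  also have "\<dots> = ennreal (B / (2 * A)) * (\<integral>\<^sup>+x. ennreal ((f x)\<^sup>2) \<partial>M) + ennreal (A / (2 * B)) * (\<integral>\<^sup>+x. ennreal ((g x)\<^sup>2) \<partial>M)"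
    by (simp add: nn_integral_add nn_integral_cmult)
  also have "\<dots> \<le> ennreal (B / (2 * A)) * ennreal (A\<^sup>2) + ennreal (A / (2 * B)) * ennreal (B\<^sup>2)"
    by (intro add_mono mult_left_mono A B) auto
  also have "\<dots> = ennreal (B / (2 * A) * A\<^sup>2 + A / (2 * B) * B\<^sup>2)"
    using A(1) B(1) by (simp add: ennreal_mult[symmetric])
  also have "B / (2 * A) * A\<^sup>2 + A / (2 * B) * B\<^sup>2 = A * B"
    using A(1) B(1) by (simp add: field_simps power2_eq_square)
  finally show ?thesis .
qed

lemma term_le_suminf_ennreal: "f k \<le> (\<Sum>k. f k)" for f :: "nat \<Rightarrow> ennreal"
  using sum_le_suminf[of f "{k}"] by simp

lemma ennreal_pos_obtains_real:
  assumes "0 < (a :: ennreal)"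
  obtains e where "e > 0" "ennreal e < a"
proof (cases a)
  case (real r)
  then show ?thesis using assms that[of "r / 2"] by (auto simp: ennreal_less_iff)
next
  case top
  then show ?thesis using that[of 1] by auto
qed

lemma ennreal_finite_square_bound:
  assumes "(a::ennreal) < \<infinity>"
  obtains B where "0 < B" "a \<le> ennreal (B\<^sup>2)"
proof -
  obtain r where r: "a = ennreal r" "0 \<le> r" using assms by (cases a) auto
  have "r \<le> (1 + r)\<^sup>2" using r(2) by (simp add: power2_eq_square algebra_simps)
  then show ?thesis using r by (intro that[of "1 + r"]) (auto intro: ennreal_leI)
qed

lemma integral_mult_tendsto_0:
  fixes f :: "nat \<Rightarrow> 'a \<Rightarrow> real"
  assumes m: "\<And>n. f n \<in> borel_measurable M" "g \<in> borel_measurable M"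
    and f: "(\<lambda>n. \<integral>\<^sup>+x. ennreal ((f n x)\<^sup>2) \<partial>M) \<longlonglongrightarrow> 0"
    and g: "(\<integral>\<^sup>+x. ennreal ((g x)\<^sup>2) \<partial>M) < \<infinity>"
  shows "(\<lambda>n. LINT x|M. f n x * g x) \<longlonglongrightarrow> 0"
proof (rule LIMSEQ_I)
  fix e :: real assume e: "e > 0"
  obtain B where B: "0 < B" "(\<integral>\<^sup>+x. ennreal ((g x)\<^sup>2) \<partial>M) \<le> ennreal (B\<^sup>2)"
    using ennreal_finite_square_bound[OF g] by blast
  define A where "A = e / (2 * B)"
  have A: "0 < A" using e B by (simp add: A_def)
  have "\<forall>\<^sub>F n in sequentially. (\<integral>\<^sup>+x. ennreal ((f n x)\<^sup>2) \<partial>M) < ennreal (A\<^sup>2)"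
    using A by (intro order_tendstoD(2)[OF f]) (simp add: ennreal_zero_less_divide zero_less_power)
  then obtain N where N: "\<And>n. N \<le> n \<Longrightarrow> (\<integral>\<^sup>+x. ennreal ((f n x)\<^sup>2) \<partial>M) < ennreal (A\<^sup>2)"
    by (auto simp: eventually_sequentially)
  have "norm ((LINT x|M. f n x * g x) - 0) < e" if "N \<le> n" for n
  proof -
    have "ennreal (norm (LINT x|M. f n x * g x)) \<le> (\<integral>\<^sup>+x. ennreal \<bar>f n x * g x\<bar> \<partial>M)"
      using integral_norm_bound_ennreal[of M "\<lambda>x. f n x * g x"]
      by (cases "integrable M (\<lambda>x. f n x * g x)") (auto simp: not_integrable_integral_eq)
    also have "\<dots> \<le> ennreal (A * B)"
      by (rule nn_integral_abs_mult_le[OF m A(1) less_imp_le[OF N[OF that]] B])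
    finally have "norm (LINT x|M. f n x * g x) \<le> A * B" using A B by simp
    also have "A * B < e" using e B by (simp add: A_def)
    finally show ?thesis by simp
  qed
  then show "\<exists>no. \<forall>n\<ge>no. norm ((LINT x|M. f n x * g x) - 0) < e" by blast
qed

text \<open>Along a subsequence whose consecutive squared distances are at most 8^-k, the weights
  2^k leave the summable bound 4^-k. So almost everywhere 2^k d_k^2 is bounded, d_k decays
  geometrically, and the subsequence converges pointwise. Fatou then compares the whole Cauchy
  sequence with this limit.\<close>

lemma riesz_fischer:
  fixes f :: "nat \<Rightarrow> 'a \<Rightarrow> 'b::euclidean_space"
  assumes [measurable]: "\<And>n. f n \<in> borel_measurable M"
    and cauchy: "\<And>e. e > 0 \<Longrightarrow> \<exists>N. \<forall>m\<ge>N. \<forall>n\<ge>N. (\<integral>\<^sup>+x. ennreal ((norm (f m x - f n x))\<^sup>2) \<partial>M) \<le> ennreal e"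
  obtains g where "g \<in> borel_measurable M" "(\<lambda>n. \<integral>\<^sup>+x. ennreal ((norm (f n x - g x))\<^sup>2) \<partial>M) \<longlonglongrightarrow> 0"
proof -
  have "\<exists>N. \<forall>m\<ge>N. \<forall>n\<ge>N. (\<integral>\<^sup>+x. ennreal ((norm (f m x - f n x))\<^sup>2) \<partial>M) \<le> ennreal ((1/8) ^ k)" for k :: nat
    by (rule cauchy) simp
  then obtain N where N: "\<And>k m n. N k \<le> m \<Longrightarrow> N k \<le> n \<Longrightarrow> (\<integral>\<^sup>+x. ennreal ((norm (f m x - f n x))\<^sup>2) \<partial>M) \<le> ennreal ((1/8) ^ k)"
    by metis
  define t where "t = rec_nat (N 0) (\<lambda>k x. max (Suc x) (N (Suc k)))"
  have t_Suc: "t (Suc k) = max (Suc (t k)) (N (Suc k))" for k by (simp add: t_def)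
  have t: "strict_mono t" by (simp add: strict_mono_Suc_iff t_Suc less_max_iff_disj)
  have tN: "N k \<le> t k" for k by (cases k) (auto simp: t_Suc t_def)
  define d where "d k x = norm (f (t (Suc k)) x - f (t k) x)" for k x
  have [measurable]: "d k \<in> borel_measurable M" for k unfolding d_def by measurable
  have dk: "(\<integral>\<^sup>+x. ennreal (2 ^ k * (d k x)\<^sup>2) \<partial>M) \<le> ennreal ((1/4) ^ k)" for k
  proof -
    have "t k \<le> t (Suc k)" using t by (simp add: strict_mono_less_eq)
    then have "N k \<le> t (Suc k)" using tN[of k] by linarith
    then have "(\<integral>\<^sup>+x. ennreal ((d k x)\<^sup>2) \<partial>M) \<le> ennreal ((1/8) ^ k)"
      unfolding d_def using N tN by blast
    then have "ennreal (2 ^ k) * (\<integral>\<^sup>+x. ennreal ((d k x)\<^sup>2) \<partial>M) \<le> ennreal (2 ^ k) * ennreal ((1/8) ^ k)"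
      by (rule mult_left_mono) simp
    also have "ennreal (2 ^ k) * ennreal ((1/8) ^ k) = ennreal ((1/4) ^ k)"
      by (subst ennreal_mult[symmetric]) (auto simp: power_mult_distrib[symmetric])
    also have "ennreal (2 ^ k) * (\<integral>\<^sup>+x. ennreal ((d k x)\<^sup>2) \<partial>M) = (\<integral>\<^sup>+x. ennreal (2 ^ k * (d k x)\<^sup>2) \<partial>M)"
      by (subst nn_integral_cmult[symmetric]) (auto simp: ennreal_mult)
    finally show ?thesis .
  qed
  have "(\<integral>\<^sup>+x. (\<Sum>k. ennreal (2 ^ k * (d k x)\<^sup>2)) \<partial>M) = (\<Sum>k. \<integral>\<^sup>+x. ennreal (2 ^ k * (d k x)\<^sup>2) \<partial>M)"
    by (rule nn_integral_suminf) measurable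
  also have "\<dots> \<le> (\<Sum>k. ennreal ((1/4) ^ k))"
    by (intro suminf_le dk summableI)
  also have "\<dots> = ennreal (\<Sum>k. (1/4) ^ k)"
    by (intro suminf_ennreal2 summable_geometric) auto
  also have "\<dots> < \<infinity>" by simp
  finally have "AE x in M. (\<Sum>k. ennreal (2 ^ k * (d k x)\<^sup>2)) \<noteq> \<infinity>"
    by (intro nn_integral_PInf_AE) auto
  then have conv: "AE x in M. convergent (\<lambda>k. f (t k) x)"
  proof eventually_elim
    fix x assume fin: "(\<Sum>k. ennreal (2 ^ k * (d k x)\<^sup>2)) \<noteq> \<infinity>"
    define C where "C = enn2real (\<Sum>k. ennreal (2 ^ k * (d k x)\<^sup>2))"
    have C: "(\<Sum>k. ennreal (2 ^ k * (d k x)\<^sup>2)) = ennreal C" "0 \<le> C"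
      unfolding C_def using fin by (simp_all add: less_top)
    have bnd: "d k x \<le> sqrt C * (1 / sqrt 2) ^ k" for k
    proof -
      have "ennreal (2 ^ k * (d k x)\<^sup>2) \<le> (\<Sum>k. ennreal (2 ^ k * (d k x)\<^sup>2))"
        by (rule term_le_suminf_ennreal)
      then have "2 ^ k * (d k x)\<^sup>2 \<le> C" unfolding C using C(2) by simp
      then have "(d k x)\<^sup>2 \<le> C * (1 / 2) ^ k" by (simp add: field_simps power_divide)
      then have "sqrt ((d k x)\<^sup>2) \<le> sqrt (C * (1 / 2) ^ k)" by (rule real_sqrt_le_mono)
      moreover have "sqrt ((d k x)\<^sup>2) = d k x" by (simp add: d_def)
      moreover have "sqrt (C * (1 / 2) ^ k) = sqrt C * (1 / sqrt 2) ^ k"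
        by (simp add: real_sqrt_mult real_sqrt_power real_sqrt_divide)
      ultimately show ?thesis by simp
    qed
    have "summable (\<lambda>k. sqrt C * (1 / sqrt 2) ^ k)"
      by (intro summable_mult summable_geometric) auto
    then have "summable (\<lambda>k. f (t (Suc k)) x - f (t k) x)"
      by (rule summable_comparison_test'[where N = 0]) (use bnd in \<open>simp add: d_def\<close>)
    then have "convergent (\<lambda>n. \<Sum>k<n. f (t (Suc k)) x - f (t k) x)"
      by (simp add: summable_iff_convergent)
    then have "convergent (\<lambda>n. f (t n) x - f (t 0) x)" by (simp only: sum_lessThan_telescope[of "\<lambda>k. f (t k) x"])
    then have "convergent (\<lambda>n. (f (t n) x - f (t 0) x) + f (t 0) x)"
      by (intro convergent_add convergent_const)
    then show "convergent (\<lambda>k. f (t k) x)" by simp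
  qed
  define g where "g x = lim (\<lambda>k. f (t k) x)" for x
  have [measurable]: "g \<in> borel_measurable M"
    unfolding g_def by (rule borel_measurable_lim_metric) measurable
  have lim: "AE x in M. (\<lambda>k. f (t k) x) \<longlonglongrightarrow> g x"
    using conv by eventually_elim (simp add: g_def convergent_LIMSEQ_iff)
  have "\<exists>N. \<forall>n\<ge>N. (\<integral>\<^sup>+x. ennreal ((norm (f n x - g x))\<^sup>2) \<partial>M) \<le> ennreal e" if "e > 0" for e
  proof -
    obtain N' where N': "\<And>m n. N' \<le> m \<Longrightarrow> N' \<le> n \<Longrightarrow> (\<integral>\<^sup>+x. ennreal ((norm (f m x - f n x))\<^sup>2) \<partial>M) \<le> ennreal e"
      using cauchy[OF \<open>e > 0\<close>] by blast
    have "(\<integral>\<^sup>+x. ennreal ((norm (f n x - g x))\<^sup>2) \<partial>M) \<le> ennreal e" if n: "N' \<le> n" for n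
    proof -
      have "(\<integral>\<^sup>+x. ennreal ((norm (f n x - g x))\<^sup>2) \<partial>M) = (\<integral>\<^sup>+x. liminf (\<lambda>k. ennreal ((norm (f n x - f (t k) x))\<^sup>2)) \<partial>M)"
      proof (rule nn_integral_cong_AE)
        show "AE x in M. ennreal ((norm (f n x - g x))\<^sup>2) = liminf (\<lambda>k. ennreal ((norm (f n x - f (t k) x))\<^sup>2))"
          using lim
        proof eventually_elim
          fix x assume "(\<lambda>k. f (t k) x) \<longlonglongrightarrow> g x"
          then have "(\<lambda>k. ennreal ((norm (f n x - f (t k) x))\<^sup>2)) \<longlonglongrightarrow> ennreal ((norm (f n x - g x))\<^sup>2)"
            by (intro tendsto_intros)
          then show "ennreal ((norm (f n x - g x))\<^sup>2) = liminf (\<lambda>k. ennreal ((norm (f n x - f (t k) x))\<^sup>2))"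
            by (simp only: lim_imp_Liminf[OF trivial_limit_sequentially])
        qed
      qed
      also have "\<dots> \<le> liminf (\<lambda>k. \<integral>\<^sup>+x. ennreal ((norm (f n x - f (t k) x))\<^sup>2) \<partial>M)"
        by (rule nn_integral_liminf) measurable
      also have "\<dots> \<le> ennreal e"
      proof -
        have "\<forall>\<^sub>F k in sequentially. (\<integral>\<^sup>+x. ennreal ((norm (f n x - f (t k) x))\<^sup>2) \<partial>M) \<le> ennreal e"
          using N'[OF n] strict_mono_imp_increasing[OF t] by (intro eventually_sequentiallyI[of N']) (meson order_trans)
        then have "liminf (\<lambda>k. \<integral>\<^sup>+x. ennreal ((norm (f n x - f (t k) x))\<^sup>2) \<partial>M) \<le> liminf (\<lambda>k::nat. ennreal e)"
          by (rule Liminf_mono)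
        then show ?thesis by (simp add: Liminf_const)
      qed
      finally show ?thesis .
    qed
    then show ?thesis by blast
  qed
  note small = this
  have "(\<lambda>n. \<integral>\<^sup>+x. ennreal ((norm (f n x - g x))\<^sup>2) \<partial>M) \<longlonglongrightarrow> 0"
  proof (rule order_tendstoI)
    fix a :: ennreal assume a: "0 < a"
    obtain e where e: "e > 0" "ennreal e < a" by (rule ennreal_pos_obtains_real[OF a])
    then show "\<forall>\<^sub>F n in sequentially. (\<integral>\<^sup>+x. ennreal ((norm (f n x - g x))\<^sup>2) \<partial>M) < a"
      using small[OF e(1)] unfolding eventually_sequentially by (meson le_less_trans)
  qed simp
  with \<open>g \<in> borel_measurable M\<close> show ?thesis by (rule that)
qed

lemma square_integrable_locally_integrable:
  fixes f :: "R3 \<Rightarrow> 'b::euclidean_space"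
  assumes [measurable]: "f \<in> borel_measurable lebesgue" and "(\<integral>\<^sup>+x. ennreal ((norm (f x))\<^sup>2) \<partial>lebesgue) < \<infinity>"
  shows "locally_integrable f"
  unfolding locally_integrable_def set_integrable_def
proof (intro allI impI)
  fix K :: "R3 set" assume K: "compact K"
  have [measurable]: "K \<in> sets lebesgue" using K by (simp add: borel_compact)
  have i: "integrable lebesgue (\<lambda>x. (norm (f x))\<^sup>2)"
    using assms by (intro integrableI_bounded) auto
  have "emeasure lebesgue K < \<infinity>" using emeasure_compact_finite[OF K] K by (simp add: borel_compact)
  then have "integrable lebesgue (\<lambda>x. indicator K x :: real)"
    by (simp add: integrable_indicator_iff)
  with i have "integrable lebesgue (\<lambda>x. indicator K x + (norm (f x))\<^sup>2)" by simp
  then show "integrable lebesgue (\<lambda>x. indicator K x *\<^sub>R f x)"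
  proof (rule Bochner_Integration.integrable_bound)
    have "norm (f x) \<le> 1 + (norm (f x))\<^sup>2" for x
    proof -
      have "0 \<le> (norm (f x) - 1)\<^sup>2 + norm (f x)" by simp
      also have "(norm (f x) - 1)\<^sup>2 + norm (f x) = (norm (f x))\<^sup>2 + 1 - norm (f x)"
        by (simp add: power2_diff)
      finally show ?thesis by simp
    qed
    then show "AE x in lebesgue. norm (indicator K x *\<^sub>R f x) \<le> norm (indicator K x + (norm (f x))\<^sup>2)"
      by (intro AE_I2) (auto simp: indicator_def)
  qed measurable
qed

section \<open>The space \<open>H1\<close> as a complete semi-inner product space\<close>

definition H1 :: "(R3 \<Rightarrow> real) set" where
  "H1 = {u \<in> W11loc. H1_energy u < \<infinity>}"

text \<open>Bundling value and weak gradient into one vector-valued function turns energy, inner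
  product and completeness into statements about L^2.\<close>

definition H1_pair :: "(R3 \<Rightarrow> real) \<Rightarrow> R3 \<Rightarrow> real \<times> R3" where
  "H1_pair u x = (u x, weak_grad u x)"

definition H1_ip :: "(R3 \<Rightarrow> real) \<Rightarrow> (R3 \<Rightarrow> real) \<Rightarrow> real" where
  "H1_ip u v = (LINT x|lebesgue. H1_pair u x \<bullet> H1_pair v x)"

abbreviation H1_sq :: "(R3 \<Rightarrow> real) \<Rightarrow> real" where
  "H1_sq u \<equiv> enn2real (H1_energy u)"

lemma H1_energy_pair: "H1_energy u = (\<integral>\<^sup>+x. ennreal ((norm (H1_pair u x))\<^sup>2) \<partial>lebesgue)"
  by (simp add: H1_energy_def H1_pair_def norm_prod_def add.commute)

lemma H1_pair_measurable: "u \<in> W11loc \<Longrightarrow> H1_pair u \<in> borel_measurable lebesgue"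
  unfolding H1_pair_def by (intro borel_measurable_Pair W11loc_measurable)

lemma H1_pair_lincomb:
  assumes "u \<in> W11loc" "v \<in> W11loc"
  shows "AE x in lebesgue. H1_pair (\<lambda>x. a * u x + b * v x) x = a *\<^sub>R H1_pair u x + b *\<^sub>R H1_pair v x"
  using W11loc_lincomb(2)[OF assms, of a b] by eventually_elim (simp add: H1_pair_def)

lemma H1_pair_diff:
  assumes "u \<in> W11loc" "v \<in> W11loc"
  shows "(\<lambda>x. u x - v x) \<in> W11loc" "AE x in lebesgue. H1_pair (\<lambda>x. u x - v x) x = H1_pair u x - H1_pair v x"
  using W11loc_lincomb(1)[OF assms, of 1 "-1"] H1_pair_lincomb[OF assms, of 1 "-1"] by simp_all

lemma norm_prod_square: "(norm z)\<^sup>2 = (norm (fst z))\<^sup>2 + (norm (snd z))\<^sup>2" for z :: "'a::real_inner \<times> 'b::real_inner"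
  by (simp add: norm_prod_def)

lemma norm_add_square_le: "(norm (a + b))\<^sup>2 \<le> 2 * (norm a)\<^sup>2 + 2 * (norm b)\<^sup>2" for a b :: "'a::real_inner"
proof -
  have "(norm (a + b))\<^sup>2 + (norm (a - b))\<^sup>2 = 2 * (norm a)\<^sup>2 + 2 * (norm b)\<^sup>2"
    by (simp add: power2_norm_eq_inner inner_simps inner_commute)
  then show ?thesis using zero_le_power2[of "norm (a - b)"] by linarith
qed

lemma ennreal_lincomb:
  "0 \<le> a \<Longrightarrow> 0 \<le> b \<Longrightarrow> 0 \<le> c \<Longrightarrow> 0 \<le> d \<Longrightarrow> ennreal c * ennreal a + ennreal d * ennreal b = ennreal (c * a + d * b)"
  by (simp add: ennreal_mult)

lemma H1_energy_lincomb_le: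
  assumes "u \<in> W11loc" "v \<in> W11loc"
  shows "H1_energy (\<lambda>x. a * u x + b * v x) \<le> ennreal (2 * a\<^sup>2) * H1_energy u + ennreal (2 * b\<^sup>2) * H1_energy v"
proof -
  note [measurable] = assms[THEN H1_pair_measurable]
  have "H1_energy (\<lambda>x. a * u x + b * v x)
     \<le> (\<integral>\<^sup>+x. ennreal (2 * a\<^sup>2) * ennreal ((norm (H1_pair u x))\<^sup>2) + ennreal (2 * b\<^sup>2) * ennreal ((norm (H1_pair v x))\<^sup>2) \<partial>lebesgue)"
    unfolding H1_energy_pair
  proof (rule nn_integral_mono_AE)
    show "AE x in lebesgue. ennreal ((norm (H1_pair (\<lambda>x. a * u x + b * v x) x))\<^sup>2) \<le> ennreal (2 * a\<^sup>2) * ennreal ((norm (H1_pair u x))\<^sup>2) + ennreal (2 * b\<^sup>2) * ennreal ((norm (H1_pair v x))\<^sup>2)"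
      using H1_pair_lincomb[OF assms, of a b]
    proof eventually_elim
      fix x assume eq: "H1_pair (\<lambda>x. a * u x + b * v x) x = a *\<^sub>R H1_pair u x + b *\<^sub>R H1_pair v x"
      have "ennreal ((norm (H1_pair (\<lambda>x. a * u x + b * v x) x))\<^sup>2) \<le> ennreal (2 * a\<^sup>2 * (norm (H1_pair u x))\<^sup>2 + 2 * b\<^sup>2 * (norm (H1_pair v x))\<^sup>2)"
        using norm_add_square_le[of "a *\<^sub>R H1_pair u x" "b *\<^sub>R H1_pair v x"]
        unfolding eq by (intro ennreal_leI) (simp add: power_mult_distrib)
      also have "\<dots> = ennreal (2 * a\<^sup>2) * ennreal ((norm (H1_pair u x))\<^sup>2) + ennreal (2 * b\<^sup>2) * ennreal ((norm (H1_pair v x))\<^sup>2)"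
        by (simp add: ennreal_mult[symmetric])
      finally show "ennreal ((norm (H1_pair (\<lambda>x. a * u x + b * v x) x))\<^sup>2) \<le> ennreal (2 * a\<^sup>2) * ennreal ((norm (H1_pair u x))\<^sup>2) + ennreal (2 * b\<^sup>2) * ennreal ((norm (H1_pair v x))\<^sup>2)" .
    qed
  qed
  also have "\<dots> = ennreal (2 * a\<^sup>2) * H1_energy u + ennreal (2 * b\<^sup>2) * H1_energy v"
    unfolding H1_energy_pair by (simp add: nn_integral_add nn_integral_cmult)
  finally show ?thesis .
qed

lemma H1_W11loc: "u \<in> H1 \<Longrightarrow> u \<in> W11loc" and H1_finite: "u \<in> H1 \<Longrightarrow> H1_energy u < \<infinity>"
  by (auto simp: H1_def)

lemma H1_lincomb: "u \<in> H1 \<Longrightarrow> v \<in> H1 \<Longrightarrow> (\<lambda>x. a * u x + b * v x) \<in> H1"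
  using H1_energy_lincomb_le[of u v a b]
  by (auto simp: H1_def W11loc_lincomb ennreal_mult_less_top intro: le_less_trans)

lemma H1_diff: "u \<in> H1 \<Longrightarrow> v \<in> H1 \<Longrightarrow> (\<lambda>x. u x - v x) \<in> H1"
  using H1_lincomb[of u v 1 "-1"] by simp

lemma integrable_H1_ip:
  assumes u: "u \<in> H1" and v: "v \<in> H1"
  shows "integrable lebesgue (\<lambda>x. H1_pair u x \<bullet> H1_pair v x)"
proof (rule Bochner_Integration.integrable_bound)
  note [measurable] = H1_pair_measurable[OF H1_W11loc[OF u]] H1_pair_measurable[OF H1_W11loc[OF v]]
  have "integrable lebesgue (\<lambda>x. (norm (H1_pair w x))\<^sup>2)" if "w \<in> H1" for w
    using H1_finite[OF that] H1_pair_measurable[OF H1_W11loc[OF that]]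
    by (intro integrableI_bounded) (auto simp: H1_energy_pair)
  then show "integrable lebesgue (\<lambda>x. (norm (H1_pair u x))\<^sup>2 + (norm (H1_pair v x))\<^sup>2)" using u v by simp
  have "\<bar>H1_pair u x \<bullet> H1_pair v x\<bar> \<le> (norm (H1_pair u x))\<^sup>2 + (norm (H1_pair v x))\<^sup>2" for x
  proof -
    have "\<bar>H1_pair u x \<bullet> H1_pair v x\<bar> \<le> norm (H1_pair u x) * norm (H1_pair v x)" by (rule Cauchy_Schwarz_ineq2)
    also have "\<dots> \<le> (norm (H1_pair u x))\<^sup>2 + (norm (H1_pair v x))\<^sup>2"
      using sum_squares_bound[of "norm (H1_pair u x)" "norm (H1_pair v x)"]
        mult_nonneg_nonneg[OF norm_ge_zero[of "H1_pair u x"] norm_ge_zero[of "H1_pair v x"]] by linarith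
    finally show ?thesis .
  qed
  then show "AE x in lebesgue. norm (H1_pair u x \<bullet> H1_pair v x) \<le> norm ((norm (H1_pair u x))\<^sup>2 + (norm (H1_pair v x))\<^sup>2)"
    by (intro AE_I2) simp
  show "(\<lambda>x. H1_pair u x \<bullet> H1_pair v x) \<in> borel_measurable lebesgue" by measurable
qed

lemma H1_ip_self:
  assumes u: "u \<in> H1"
  shows "H1_ip u u = H1_sq u"
proof -
  have [measurable]: "H1_pair u \<in> borel_measurable lebesgue" by (intro H1_pair_measurable H1_W11loc u)
  show ?thesis
    unfolding H1_ip_def H1_energy_pair power2_norm_eq_inner
    by (intro integral_eq_nn_integral) auto
qed

lemma H1_sq_eq_norm: "u \<in> H1 \<Longrightarrow> H1_energy u = ennreal (H1_sq u)"
  by (simp add: H1_def less_top)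

text \<open>Riesz-Fischer for the pairs gives an L^2 limit f. The weak gradient identity passes to
  the limit against each test function, so the second component of f is the weak gradient of the
  first.\<close>

lemma H1_completeness:
  assumes s: "\<And>n::nat. s n \<in> H1"
    and cauchy: "\<And>e. e > 0 \<Longrightarrow> \<exists>N. \<forall>m\<ge>N. \<forall>n\<ge>N. H1_sq (\<lambda>x. s m x - s n x) < e"
  obtains w where "w \<in> H1" "(\<lambda>n. H1_energy (\<lambda>x. s n x - w x)) \<longlonglongrightarrow> 0"
proof -
  have sW: "s n \<in> W11loc" for n using s by (rule H1_W11loc)
  have mP[measurable]: "H1_pair (s n) \<in> borel_measurable lebesgue" for n by (rule H1_pair_measurable[OF sW])
  have cP: "\<exists>N. \<forall>m\<ge>N. \<forall>n\<ge>N. (\<integral>\<^sup>+x. ennreal ((norm (H1_pair (s m) x - H1_pair (s n) x))\<^sup>2) \<partial>lebesgue) \<le> ennreal e" if "e > 0" for e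
  proof -
    have "(\<integral>\<^sup>+x. ennreal ((norm (H1_pair (s m) x - H1_pair (s n) x))\<^sup>2) \<partial>lebesgue) = ennreal (H1_sq (\<lambda>x. s m x - s n x))" for m n
    proof -
      have "(\<integral>\<^sup>+x. ennreal ((norm (H1_pair (s m) x - H1_pair (s n) x))\<^sup>2) \<partial>lebesgue) = H1_energy (\<lambda>x. s m x - s n x)"
        unfolding H1_energy_pair using H1_pair_diff(2)[OF sW sW, of m n] by (intro nn_integral_cong_AE) auto
      then show ?thesis using H1_sq_eq_norm[OF H1_diff[OF s s], of m n] by simp
    qed
    then show ?thesis using cauchy[OF that] by (simp add: ennreal_leI less_imp_le) (meson ennreal_leI less_imp_le)
  qed
  obtain f where f[measurable]: "f \<in> borel_measurable lebesgue"
    and lim: "(\<lambda>n. \<integral>\<^sup>+x. ennreal ((norm (H1_pair (s n) x - f x))\<^sup>2) \<partial>lebesgue) \<longlonglongrightarrow> 0"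
    by (rule riesz_fischer[of "\<lambda>n. H1_pair (s n)" lebesgue, OF mP cP]) blast
  have mfst: "(\<lambda>x. fst (f x)) \<in> borel_measurable lebesgue" and msnd: "(\<lambda>x. snd (f x)) \<in> borel_measurable lebesgue"
    by (intro measurable_compose[OF f] borel_measurable_continuous_onI continuous_intros)+
  have fin: "(\<integral>\<^sup>+x. ennreal ((norm (f x))\<^sup>2) \<partial>lebesgue) < \<infinity>"
  proof -
    obtain n where n: "(\<integral>\<^sup>+x. ennreal ((norm (H1_pair (s n) x - f x))\<^sup>2) \<partial>lebesgue) < 1"
      using order_tendstoD(2)[OF lim, of 1] by (auto simp: eventually_sequentially)
    have "(\<integral>\<^sup>+x. ennreal ((norm (f x))\<^sup>2) \<partial>lebesgue)
       \<le> (\<integral>\<^sup>+x. ennreal 2 * ennreal ((norm (H1_pair (s n) x))\<^sup>2) + ennreal 2 * ennreal ((norm (H1_pair (s n) x - f x))\<^sup>2) \<partial>lebesgue)"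
    proof (rule nn_integral_mono)
      fix x
      show "ennreal ((norm (f x))\<^sup>2) \<le> ennreal 2 * ennreal ((norm (H1_pair (s n) x))\<^sup>2) + ennreal 2 * ennreal ((norm (H1_pair (s n) x - f x))\<^sup>2)"
        using norm_add_square_le[of "H1_pair (s n) x" "- (H1_pair (s n) x - f x)"]
        by (subst ennreal_lincomb) (auto intro!: ennreal_leI simp: norm_minus_commute simp del: ennreal_plus)
    qed
    also have "\<dots> = ennreal 2 * H1_energy (s n) + ennreal 2 * (\<integral>\<^sup>+x. ennreal ((norm (H1_pair (s n) x - f x))\<^sup>2) \<partial>lebesgue)"
      unfolding H1_energy_pair by (subst nn_integral_add) (simp_all add: nn_integral_cmult)
    also have "\<dots> < \<infinity>"
      using H1_finite[OF s] n by (auto simp: ennreal_mult_less_top intro: less_trans)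
    finally show ?thesis .
  qed
  define w where "w x = fst (f x)" for x
  define g where "g x = snd (f x)" for x
  have sq: "(w x)\<^sup>2 \<le> (norm (f x))\<^sup>2" "(norm (g x))\<^sup>2 \<le> (norm (f x))\<^sup>2" for x
    using norm_prod_square[of "f x"] by (simp_all add: w_def g_def)
  have lw: "locally_integrable w" and lg: "locally_integrable g"
    using mfst msnd sq unfolding w_def[symmetric] g_def[symmetric]
    by (intro square_integrable_locally_integrable le_less_trans[OF nn_integral_mono fin] ennreal_leI; simp)+
  have lsq: "(\<lambda>n. \<integral>\<^sup>+x. ennreal ((s n x - w x)\<^sup>2) \<partial>lebesgue) \<longlonglongrightarrow> 0"
    "(\<lambda>n. \<integral>\<^sup>+x. ennreal ((weak_grad (s n) x $ i - g x $ i)\<^sup>2) \<partial>lebesgue) \<longlonglongrightarrow> 0" for i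
  proof -
    have 1: "(s n x - w x)\<^sup>2 \<le> (norm (H1_pair (s n) x - f x))\<^sup>2" for n x
      using norm_prod_square[of "H1_pair (s n) x - f x"] by (simp add: H1_pair_def w_def)
    have 2: "(weak_grad (s n) x $ i - g x $ i)\<^sup>2 \<le> (norm (H1_pair (s n) x - f x))\<^sup>2" for n x
    proof -
      have "(weak_grad (s n) x $ i - g x $ i)\<^sup>2 \<le> (norm (weak_grad (s n) x - g x))\<^sup>2"
        using power_mono[OF component_le_norm_cart[of "weak_grad (s n) x - g x" i] abs_ge_zero, of 2] by simp
      then show ?thesis
        using norm_prod_square[of "H1_pair (s n) x - f x"] by (simp add: H1_pair_def g_def add_increasing)
    qed
    show "(\<lambda>n. \<integral>\<^sup>+x. ennreal ((s n x - w x)\<^sup>2) \<partial>lebesgue) \<longlonglongrightarrow> 0"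
      by (rule tendsto_sandwich[OF _ _ tendsto_const lim]) (auto intro!: always_eventually nn_integral_mono ennreal_leI 1)
    show "(\<lambda>n. \<integral>\<^sup>+x. ennreal ((weak_grad (s n) x $ i - g x $ i)\<^sup>2) \<partial>lebesgue) \<longlonglongrightarrow> 0"
      by (rule tendsto_sandwich[OF _ _ tendsto_const lim]) (auto intro!: always_eventually nn_integral_mono ennreal_leI 2)
  qed
  have wg: "has_weak_gradient w g"
    unfolding has_weak_gradient_def
  proof (intro conjI allI impI lg)
    fix \<phi> :: "R3 \<Rightarrow> real" and i :: 3 assume \<phi>: "test_function \<phi>"
    define \<psi> where "\<psi> x = frechet_derivative \<phi> (at x) (axis i 1)" for x
    have \<psi>: "test_function \<psi>" unfolding \<psi>_def by (rule test_function_directional_derivative[OF \<phi>])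
    have mt: "\<theta> \<in> borel_measurable lebesgue" if "test_function \<theta>" for \<theta>
      by (intro borel_measurable_lebesgueI borel_measurable_continuous_onI test_function_continuous that)
    have test2: "(\<integral>\<^sup>+x. ennreal ((\<theta> x)\<^sup>2) \<partial>lebesgue) < \<infinity>" if t: "test_function \<theta>" for \<theta>
    proof -
      have "locally_integrable \<theta>"
        unfolding locally_integrable_def
        using absolutely_integrable_continuous_real continuous_on_subset[OF test_function_continuous[OF t]]
          borel_integrable_compact[of _ \<theta>] by (auto simp: set_integrable_def integrable_completion borel_measurable_continuous_onI[OF test_function_continuous[OF t]] borel_compact mult.commute)
      then have "integrable lebesgue (\<lambda>x. \<theta> x * \<theta> x)" using t by (rule locally_integrable_mult_test_function)
      then show ?thesis by (simp add: integrable_iff_bounded power2_eq_square)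
    qed
    have key: "(\<lambda>n. LINT x|lebesgue. a n x * \<theta> x) \<longlonglongrightarrow> (LINT x|lebesgue. b x * \<theta> x)"
      if la: "\<And>n. locally_integrable (a n)" "locally_integrable b" and t: "test_function \<theta>"
        and l: "(\<lambda>n. \<integral>\<^sup>+x. ennreal ((a n x - b x)\<^sup>2) \<partial>lebesgue) \<longlonglongrightarrow> 0" for a :: "nat \<Rightarrow> R3 \<Rightarrow> real" and b \<theta>
    proof -
      have "(\<lambda>n. LINT x|lebesgue. (a n x - b x) * \<theta> x) \<longlonglongrightarrow> 0"
        by (rule integral_mult_tendsto_0[OF _ mt[OF t] l test2[OF t]]) (intro borel_measurable_diff locally_integrable_measurable la)
      moreover have "(LINT x|lebesgue. (a n x - b x) * \<theta> x) = (LINT x|lebesgue. a n x * \<theta> x) - (LINT x|lebesgue. b x * \<theta> x)" for n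
        unfolding left_diff_distrib by (intro Bochner_Integration.integral_diff locally_integrable_mult_test_function la t)
      ultimately show ?thesis by (simp add: LIM_zero_iff)
    qed
    have ws: "has_weak_gradient (s n) (weak_grad (s n))" "locally_integrable (s n)" for n
      using has_weak_gradient_weak_grad[OF sW] sW by (auto simp: W11loc_def)
    have "(\<lambda>n. LINT x|lebesgue. s n x * \<psi> x) \<longlonglongrightarrow> (LINT x|lebesgue. w x * \<psi> x)"
      by (rule key[OF ws(2) lw \<psi> lsq(1)])
    moreover have "(\<lambda>n. LINT x|lebesgue. weak_grad (s n) x $ i * \<phi> x) \<longlonglongrightarrow> (LINT x|lebesgue. g x $ i * \<phi> x)"
      using ws(1) by (intro key locally_integrable_component lg \<phi> lsq(2)) (auto simp: has_weak_gradient_def)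
    moreover have "(LINT x|lebesgue. s n x * \<psi> x) = - (LINT x|lebesgue. weak_grad (s n) x $ i * \<phi> x)" for n
      using ws(1)[of n] \<phi> unfolding has_weak_gradient_def \<psi>_def by blast
    ultimately have "(\<lambda>n. LINT x|lebesgue. s n x * \<psi> x) \<longlonglongrightarrow> - (LINT x|lebesgue. g x $ i * \<phi> x)"
      by (simp add: tendsto_minus)
    with \<open>(\<lambda>n. LINT x|lebesgue. s n x * \<psi> x) \<longlonglongrightarrow> (LINT x|lebesgue. w x * \<psi> x)\<close>
    show "(LINT x|lebesgue. w x * frechet_derivative \<phi> (at x) (axis i 1)) = - (LINT x|lebesgue. g x $ i * \<phi> x)"
      unfolding \<psi>_def by (rule LIMSEQ_unique)
  qed
  have wW: "w \<in> W11loc" using lw wg by (auto simp: W11loc_def)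
  have pw: "AE x in lebesgue. H1_pair w x = f x"
    using has_weak_gradient_unique[OF has_weak_gradient_weak_grad[OF wW] wg]
    by eventually_elim (simp add: H1_pair_def w_def g_def)
  have "H1_energy w = (\<integral>\<^sup>+x. ennreal ((norm (f x))\<^sup>2) \<partial>lebesgue)"
    unfolding H1_energy_pair using pw by (intro nn_integral_cong_AE) auto
  then have wH: "w \<in> H1" using wW fin by (simp add: H1_def)
  have "H1_energy (\<lambda>x. s n x - w x) = (\<integral>\<^sup>+x. ennreal ((norm (H1_pair (s n) x - f x))\<^sup>2) \<partial>lebesgue)" for n
    unfolding H1_energy_pair
  proof (rule nn_integral_cong_AE)
    show "AE x in lebesgue. ennreal ((norm (H1_pair (\<lambda>x. s n x - w x) x))\<^sup>2) = ennreal ((norm (H1_pair (s n) x - f x))\<^sup>2)"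
      using H1_pair_diff(2)[OF sW[of n] wW] pw by eventually_elim simp
  qed
  then have "(\<lambda>n. H1_energy (\<lambda>x. s n x - w x)) \<longlonglongrightarrow> 0" using lim by simp
  then show ?thesis using that wH by blast
qed

interpretation H1: semi_hilbert H1 H1_ip
proof
  show "(\<lambda>x. a * u x + b * v x) \<in> H1" if "u \<in> H1" "v \<in> H1" for u v a b
    using that by (rule H1_lincomb)
  show "H1_ip (\<lambda>x. a * u x + b * v x) w = a * H1_ip u w + b * H1_ip v w" if "u \<in> H1" "v \<in> H1" "w \<in> H1" for u v w a b
  proof -
    note [measurable] = H1_pair_measurable[OF H1_W11loc[OF that(1)]] H1_pair_measurable[OF H1_W11loc[OF that(2)]]
      H1_pair_measurable[OF H1_W11loc[OF that(3)]] H1_pair_measurable[OF H1_W11loc[OF H1_lincomb[OF that(1,2), of a b]]]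
    have "H1_ip (\<lambda>x. a * u x + b * v x) w = (LINT x|lebesgue. a * (H1_pair u x \<bullet> H1_pair w x) + b * (H1_pair v x \<bullet> H1_pair w x))"
      unfolding H1_ip_def
      using H1_pair_lincomb[OF H1_W11loc[OF that(1)] H1_W11loc[OF that(2)], of a b]
      by (intro integral_cong_AE) (measurable, auto simp: inner_simps)
    also have "\<dots> = a * H1_ip u w + b * H1_ip v w"
      unfolding H1_ip_def using that by (subst Bochner_Integration.integral_add) (auto intro!: integrable_mult_right integrable_H1_ip)
    finally show ?thesis .
  qed
  show "H1_ip u v = H1_ip v u" for u v by (simp add: H1_ip_def inner_commute)
  show "0 \<le> H1_ip u u" for u by (simp add: H1_ip_def)
  fix s :: "nat \<Rightarrow> R3 \<Rightarrow> real"
  assume s: "\<And>n. s n \<in> H1" and c: "\<And>e. e > 0 \<Longrightarrow> \<exists>N. \<forall>m\<ge>N. \<forall>n\<ge>N. H1_ip (\<lambda>x. s m x - s n x) (\<lambda>x. s m x - s n x) < e"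
  obtain w where w: "w \<in> H1" "(\<lambda>n. H1_energy (\<lambda>x. s n x - w x)) \<longlonglongrightarrow> 0"
    by (rule H1_completeness[OF s c[unfolded H1_ip_self[OF H1_diff[OF s s]]]]) blast
  have "(\<lambda>n. enn2real (H1_energy (\<lambda>x. s n x - w x))) \<longlonglongrightarrow> 0"
    by (rule tendsto_enn2real) (use w(2) in simp_all)
  then show "\<exists>w\<in>H1. (\<lambda>n. H1_ip (\<lambda>x. s n x - w x) (\<lambda>x. s n x - w x)) \<longlonglongrightarrow> 0"
    using w(1) by (intro bexI[of _ w]) (simp_all add: H1_ip_self[OF H1_diff[OF s w(1)]])
qed

section \<open>Local compactness\<close>

text \<open>Subtracting \<open>\<epsilon> s n\<close> leaves a dominated sequence, so no equi-integrability of \<open>z\<close> is needed.\<close>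

lemma nn_integral_tendsto_0_absorb:
  fixes z s :: "nat \<Rightarrow> 'a \<Rightarrow> real"
  assumes [measurable]: "\<And>n. z n \<in> borel_measurable M" "\<And>n. s n \<in> borel_measurable M"
    and nonneg: "\<And>n x. 0 \<le> z n x" "\<And>n x. 0 \<le> s n x"
    and lim: "AE x in M. (\<lambda>n. z n x) \<longlonglongrightarrow> 0"
    and C: "\<And>n. (\<integral>\<^sup>+x. ennreal (s n x) \<partial>M) \<le> ennreal C"
    and G: "\<And>\<epsilon>. \<epsilon> > 0 \<Longrightarrow> \<exists>G. integrable M G \<and> (\<forall>n x. z n x \<le> \<epsilon> * s n x + G x)"
  shows "(\<lambda>n. \<integral>\<^sup>+x. ennreal (z n x) \<partial>M) \<longlonglongrightarrow> 0"
proof (rule order_tendstoI)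
  fix a :: ennreal assume a: "0 < a"
  obtain e where e: "e > 0" "ennreal e < a" by (rule ennreal_pos_obtains_real[OF a])
  define \<epsilon> where "\<epsilon> = e / (2 * (\<bar>C\<bar> + 1))"
  have \<epsilon>: "\<epsilon> > 0" using e(1) by (simp add: \<epsilon>_def add_nonneg_pos)
  obtain G where G: "integrable M G" "\<And>n x. z n x \<le> \<epsilon> * s n x + G x" using G[OF \<epsilon>] by blast
  note [measurable] = borel_measurable_integrable[OF G(1)]
  define y where "y n x = max 0 (z n x - \<epsilon> * s n x)" for n x
  have [measurable]: "y n \<in> borel_measurable M" for n unfolding y_def by measurable
  have y_le: "0 \<le> y n x" "y n x \<le> z n x" "y n x \<le> \<bar>G x\<bar>" for n x
    using nonneg[of n x] mult_nonneg_nonneg[OF less_imp_le[OF \<epsilon>] nonneg(2)[of n x]] G(2)[of n x]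
    by (auto simp: y_def)
  have "(\<lambda>n. \<integral>\<^sup>+x. ennreal (y n x) \<partial>M) \<longlonglongrightarrow> (\<integral>\<^sup>+x. 0 \<partial>M)"
  proof (rule nn_integral_dominated_convergence)
    show "(\<integral>\<^sup>+x. ennreal \<bar>G x\<bar> \<partial>M) < \<infinity>" using G(1) by (simp add: integrable_iff_bounded)
    show "AE x in M. ennreal (y n x) \<le> ennreal \<bar>G x\<bar>" for n using y_le by (auto intro: ennreal_leI)
    show "AE x in M. (\<lambda>n. ennreal (y n x)) \<longlonglongrightarrow> 0"
      using lim
    proof eventually_elim
      fix x assume *: "(\<lambda>n. z n x) \<longlonglongrightarrow> 0"
      have "(\<lambda>n. y n x) \<longlonglongrightarrow> 0"
        by (rule tendsto_sandwich[OF _ _ tendsto_const *]) (auto simp: y_le)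
      then show "(\<lambda>n. ennreal (y n x)) \<longlonglongrightarrow> 0" using tendsto_ennrealI by fastforce
    qed
  qed measurable
  then have "(\<lambda>n. \<integral>\<^sup>+x. ennreal (y n x) \<partial>M) \<longlonglongrightarrow> 0" by simp
  then have "\<forall>\<^sub>F n in sequentially. (\<integral>\<^sup>+x. ennreal (y n x) \<partial>M) < ennreal (e / 2)"
    using e(1) by (intro order_tendstoD(2)) auto
  then show "\<forall>\<^sub>F n in sequentially. (\<integral>\<^sup>+x. ennreal (z n x) \<partial>M) < a"
  proof eventually_elim
    case (elim n)
    have "(\<integral>\<^sup>+x. ennreal (z n x) \<partial>M) \<le> (\<integral>\<^sup>+x. ennreal (y n x) + ennreal \<epsilon> * ennreal (s n x) \<partial>M)"
    proof (rule nn_integral_mono)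
      fix x
      have "z n x \<le> y n x + \<epsilon> * s n x" by (simp add: y_def)
      then show "ennreal (z n x) \<le> ennreal (y n x) + ennreal \<epsilon> * ennreal (s n x)"
        using \<epsilon> nonneg(2)[of n x] y_le(1)[of n x]
        by (simp add: ennreal_mult[symmetric] ennreal_plus[symmetric] ennreal_leI del: ennreal_plus)
    qed
    also have "\<dots> = (\<integral>\<^sup>+x. ennreal (y n x) \<partial>M) + ennreal \<epsilon> * (\<integral>\<^sup>+x. ennreal (s n x) \<partial>M)"
      by (simp add: nn_integral_add nn_integral_cmult)
    also have "\<dots> \<le> ennreal (e / 2) + ennreal \<epsilon> * ennreal \<bar>C\<bar>"
      using elim C[of n] by (intro add_mono mult_left_mono) (auto intro: order_trans ennreal_leI)
    also have "\<dots> = ennreal (e / 2 + \<epsilon> * \<bar>C\<bar>)"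
      using \<epsilon> e(1) by (simp add: ennreal_mult)
    also have "\<dots> \<le> ennreal e"
    proof (rule ennreal_leI)
      have "\<epsilon> * \<bar>C\<bar> \<le> \<epsilon> * (\<bar>C\<bar> + 1)" using \<epsilon> by simp
      also have "\<dots> = e / 2" by (simp add: \<epsilon>_def field_simps add_nonneg_eq_0_iff)
      finally show "e / 2 + \<epsilon> * \<bar>C\<bar> \<le> e" by simp
    qed
    finally show ?case using e(2) by simp
  qed
qed simp

lemma H1_energy_le_sqrt: "u \<in> H1 \<Longrightarrow> H1_energy u \<le> ennreal ((sqrt (H1_sq u))\<^sup>2)"
  using H1_sq_eq_norm[of u] by simp

lemma dyadic_avg_functional: "H1.bounded_functional (\<lambda>u. dyadic_avg k u x)"
  unfolding H1.bounded_functional_def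
proof (intro conjI ballI allI exI)
  fix u v :: "R3 \<Rightarrow> real" and a b :: real assume "u \<in> H1" "v \<in> H1"
  then have l: "locally_integrable u" "locally_integrable v" by (auto simp: H1_def W11loc_def)
  have "dyadic_avg k (\<lambda>x. a * u x + b * v x) x = (LINT y|lebesgue. a * (dyadic_weight k x y * u y) + b * (dyadic_weight k x y * v y))"
    unfolding dyadic_avg_def by (simp add: algebra_simps)
  also have "\<dots> = a * dyadic_avg k u x + b * dyadic_avg k v x"
    unfolding dyadic_avg_def
    by (subst Bochner_Integration.integral_add) (auto intro!: integrable_mult_right integrable_dyadic_weight l)
  finally show "dyadic_avg k (\<lambda>x. a * u x + b * v x) x = a * dyadic_avg k u x + b * dyadic_avg k v x" .
next
  fix u assume u: "u \<in> H1"
  show "\<bar>dyadic_avg k u x\<bar> \<le> (60 * sqrt 2 ^ k) * sqrt (H1_ip u u)"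
    unfolding H1_ip_self[OF u]
    by (rule dyadic_avg_bound[OF H1_W11loc[OF u] _ H1_energy_le_sqrt[OF u]]) simp
qed

lemma H1_sq_diff_le:
  assumes "u \<in> H1" "v \<in> H1"
  shows "H1_sq (\<lambda>x. u x - v x) \<le> 2 * H1_sq u + 2 * H1_sq v"
proof -
  have "ennreal (H1_sq (\<lambda>x. u x - v x)) \<le> ennreal 2 * ennreal (H1_sq u) + ennreal 2 * ennreal (H1_sq v)"
    using H1_energy_lincomb_le[OF assms[THEN H1_W11loc], of 1 "-1"]
    unfolding H1_sq_eq_norm[OF assms(1), symmetric] H1_sq_eq_norm[OF assms(2), symmetric] H1_sq_eq_norm[OF H1_diff[OF assms], symmetric]
    by simp
  then show ?thesis by (subst (asm) ennreal_lincomb) (auto simp del: ennreal_plus)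
qed

text \<open>Split the difference into its dyadic average and the remainder. The remainder is small
  in L^2 uniformly in n by the Poincare estimate; for fixed generation the averages tend to 0
  pointwise by weak convergence and are uniformly bounded, so the integrable weight dominates
  them.\<close>

lemma H1_weak_imp_weighted_L2:
  assumes v: "\<And>n::nat. v n \<in> H1" "u \<in> H1" and K: "\<And>n. H1_sq (v n) \<le> K"
    and weak: "\<And>F. H1.bounded_functional F \<Longrightarrow> (\<lambda>n. F (v n)) \<longlonglongrightarrow> F u"
    and w: "w \<in> borel_measurable lebesgue" "\<And>x. 0 \<le> w x" "\<And>x. w x \<le> 1" "integrable lebesgue w"
  shows "(\<lambda>n. \<integral>\<^sup>+x. ennreal ((v n x - u x)\<^sup>2 * w x) \<partial>lebesgue) \<longlonglongrightarrow> 0"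
proof (rule order_tendstoI)
  note [measurable] = w(1)
  fix a :: ennreal assume a: "0 < a"
  obtain e where e: "e > 0" "ennreal e < a" by (rule ennreal_pos_obtains_real[OF a])
  define d where "d n x = v n x - u x" for n x
  have d: "d n \<in> H1" for n unfolding d_def by (intro H1_diff v)
  note dW = H1_W11loc[OF d]
  note [measurable] = W11loc_measurable(1)[OF dW] measurable_dyadic_avg[OF dW]
  define L where "L = 2 * \<bar>K\<bar> + 2 * H1_sq u"
  have L: "0 \<le> L" by (simp add: L_def)
  have dE: "H1_energy (d n) \<le> ennreal ((sqrt L)\<^sup>2)" for n
  proof -
    have "d n = (\<lambda>x. v n x - u x)" by (rule ext) (simp add: d_def)
    then have "H1_sq (d n) \<le> 2 * H1_sq (v n) + 2 * H1_sq u"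
      by (simp only: H1_sq_diff_le[OF v])
    also have "\<dots> \<le> L" using K[of n] abs_ge_self[of K] unfolding L_def by linarith
    finally have "ennreal (H1_sq (d n)) \<le> ennreal L" by (rule ennreal_leI)
    then show ?thesis unfolding H1_sq_eq_norm[OF d, symmetric] using L by simp
  qed
  \<comment> \<open>Chosen so that the remainder contributes 2 * 72/4^k * L <= e/2, where 288 = 2 *
    144; the averages contribute the other half.\<close>
  obtain k where k: "288 * L / e < 4 ^ k" using real_arch_pow[of 4] by auto
  have "(\<lambda>n. \<integral>\<^sup>+x. ennreal ((dyadic_avg k (d n) x)\<^sup>2 * w x) \<partial>lebesgue) \<longlonglongrightarrow> (\<integral>\<^sup>+x. 0 \<partial>(lebesgue :: R3 measure))"
  proof (rule nn_integral_dominated_convergence)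
    show "(\<integral>\<^sup>+x. ennreal ((60 * sqrt 2 ^ k * sqrt L)\<^sup>2 * w x) \<partial>lebesgue) < \<infinity>"
    proof -
      have "(\<integral>\<^sup>+x. ennreal (w x) \<partial>lebesgue) < \<infinity>" using w(2,4) by (simp add: integrable_iff_bounded)
      then show ?thesis using w(2) by (simp add: ennreal_mult nn_integral_cmult ennreal_mult_less_top del: power_mult_distrib)
    qed
    have "(dyadic_avg k (d n) x)\<^sup>2 \<le> (60 * sqrt 2 ^ k * sqrt L)\<^sup>2" for n x
    proof -
      have "\<bar>dyadic_avg k (d n) x\<bar> \<le> 60 * sqrt 2 ^ k * sqrt L"
        by (rule dyadic_avg_bound[OF dW _ dE]) (use L in simp)
      from power_mono[OF this abs_ge_zero, of 2] show ?thesis by (simp only: power2_abs)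
    qed
    then show "AE x in lebesgue. ennreal ((dyadic_avg k (d n) x)\<^sup>2 * w x) \<le> ennreal ((60 * sqrt 2 ^ k * sqrt L)\<^sup>2 * w x)" for n
      using w(2) by (intro AE_I2 ennreal_leI mult_right_mono)
    have "(\<lambda>n. ennreal ((dyadic_avg k (d n) x)\<^sup>2 * w x)) \<longlonglongrightarrow> 0" for x
    proof -
      have "(\<lambda>n. dyadic_avg k (v n) x - dyadic_avg k u x) \<longlonglongrightarrow> 0"
        using weak[OF dyadic_avg_functional] by (simp add: LIM_zero_iff)
      moreover have "dyadic_avg k (d n) x = dyadic_avg k (v n) x - dyadic_avg k u x" for n
        unfolding d_def by (rule H1.functional_diff[OF dyadic_avg_functional v])
      ultimately have "(\<lambda>n. dyadic_avg k (d n) x) \<longlonglongrightarrow> 0" by simp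
      then have "(\<lambda>n. ennreal ((dyadic_avg k (d n) x)\<^sup>2 * w x)) \<longlonglongrightarrow> ennreal (0\<^sup>2 * w x)"
        by (intro tendsto_intros)
      then show ?thesis by simp
    qed
    then show "AE x in lebesgue. (\<lambda>n. ennreal ((dyadic_avg k (d n) x)\<^sup>2 * w x)) \<longlonglongrightarrow> 0" by simp
  qed measurable
  then have "(\<lambda>n. \<integral>\<^sup>+x. ennreal ((dyadic_avg k (d n) x)\<^sup>2 * w x) \<partial>lebesgue) \<longlonglongrightarrow> 0" by simp
  then have "\<forall>\<^sub>F n in sequentially. (\<integral>\<^sup>+x. ennreal ((dyadic_avg k (d n) x)\<^sup>2 * w x) \<partial>lebesgue) < ennreal (e / 4)"
    using e(1) by (intro order_tendstoD(2)) auto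
  then show "\<forall>\<^sub>F n in sequentially. (\<integral>\<^sup>+x. ennreal ((v n x - u x)\<^sup>2 * w x) \<partial>lebesgue) < a"
  proof eventually_elim
    case (elim n)
    have "(\<integral>\<^sup>+x. ennreal ((d n x)\<^sup>2 * w x) \<partial>lebesgue)
      \<le> (\<integral>\<^sup>+x. ennreal 2 * ennreal ((d n x - dyadic_avg k (d n) x)\<^sup>2) + ennreal 2 * ennreal ((dyadic_avg k (d n) x)\<^sup>2 * w x) \<partial>lebesgue)"
    proof (rule nn_integral_mono)
      fix x
      have "(d n x)\<^sup>2 \<le> 2 * (d n x - dyadic_avg k (d n) x)\<^sup>2 + 2 * (dyadic_avg k (d n) x)\<^sup>2"
        using norm_add_square_le[of "d n x - dyadic_avg k (d n) x" "dyadic_avg k (d n) x"] by simp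
      from mult_right_mono[OF this w(2)[of x]]
      have "(d n x)\<^sup>2 * w x \<le> 2 * ((d n x - dyadic_avg k (d n) x)\<^sup>2 * w x) + 2 * ((dyadic_avg k (d n) x)\<^sup>2 * w x)"
        by (simp add: algebra_simps)
      also have "(d n x - dyadic_avg k (d n) x)\<^sup>2 * w x \<le> (d n x - dyadic_avg k (d n) x)\<^sup>2"
        using w(2,3)[of x] by (intro mult_right_le_one_le) auto
      finally show "ennreal ((d n x)\<^sup>2 * w x) \<le> ennreal 2 * ennreal ((d n x - dyadic_avg k (d n) x)\<^sup>2) + ennreal 2 * ennreal ((dyadic_avg k (d n) x)\<^sup>2 * w x)"
        using w(2)[of x] by (subst ennreal_lincomb) (auto intro!: ennreal_leI simp del: ennreal_plus)
    qed
    also have "\<dots> = ennreal 2 * (\<integral>\<^sup>+x. ennreal ((d n x - dyadic_avg k (d n) x)\<^sup>2) \<partial>lebesgue) + ennreal 2 * (\<integral>\<^sup>+x. ennreal ((dyadic_avg k (d n) x)\<^sup>2 * w x) \<partial>lebesgue)"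
      by (subst nn_integral_add) (simp_all add: nn_integral_cmult)
    also have "\<dots> \<le> ennreal 2 * (ennreal (72 / 4 ^ k) * ennreal L) + ennreal 2 * ennreal (e / 4)"
      using order_trans[OF H1_energy_ge(2)[OF dW] dE[of n]] elim L
      by (intro add_mono mult_left_mono order_trans[OF dyadic_poincare[OF dW]]) auto
    also have "\<dots> = ennreal (2 * (72 / 4 ^ k * L) + 2 * (e / 4))"
      using L e(1) by (subst ennreal_mult[symmetric], simp, simp, subst ennreal_lincomb) auto
    also have "\<dots> \<le> ennreal e"
    proof (rule ennreal_leI)
      have "288 * L / 4 ^ k \<le> e" using k e(1) by (simp add: field_simps)
      then show "2 * (72 / 4 ^ k * L) + 2 * (e / 4) \<le> e" by simp
    qed
    finally show ?case using e(2) unfolding d_def by (rule le_less_trans)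
  qed
qed simp

text \<open>With a strictly positive integrable weight the weighted convergence takes place on all
  of \<open>R3\<close> at once. An L^1 convergent sequence has an almost everywhere convergent
  subsequence, and dividing by the weight recovers v - u.\<close>

lemma H1_weak_imp_AE_subseq:
  assumes v: "\<And>n::nat. v n \<in> H1" "u \<in> H1" and K: "\<And>n. H1_sq (v n) \<le> K"
    and weak: "\<And>F. H1.bounded_functional F \<Longrightarrow> (\<lambda>n. F (v n)) \<longlonglongrightarrow> F u"
  obtains r where "strict_mono r" "AE x in lebesgue. (\<lambda>n. v (r n) x) \<longlonglongrightarrow> u x"
proof -
  obtain w :: "R3 \<Rightarrow> real" where w: "w \<in> borel_measurable lebesgue" "\<And>x. w x > 0" "\<And>x. w x \<le> 1" "integrable lebesgue w"
    using sigma_finite_measure.obtain_positive_integrable_function[OF sigma_finite_lebesgue] by blast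
  note [measurable] = w(1) W11loc_measurable(1)[OF H1_W11loc[OF v(1)]] W11loc_measurable(1)[OF H1_W11loc[OF v(2)]]
  define z where "z n x = (v n x - u x)\<^sup>2 * w x" for n x
  have lim: "(\<lambda>n. \<integral>\<^sup>+x. ennreal (z n x) \<partial>lebesgue) \<longlonglongrightarrow> 0"
    unfolding z_def by (rule H1_weak_imp_weighted_L2[OF v K weak w(1) _ w(3,4)]) (use w(2) less_imp_le in auto)
  have z0: "0 \<le> z n x" for n x using w(2)[of x] by (simp add: z_def)
  have zi: "integrable lebesgue (z n)" for n
  proof (rule integrableI_nonneg)
    have d: "(\<lambda>x. v n x - u x) \<in> H1" by (rule H1_diff[OF v])
    have "(\<integral>\<^sup>+x. ennreal (z n x) \<partial>lebesgue) \<le> (\<integral>\<^sup>+x. ennreal ((v n x - u x)\<^sup>2) \<partial>lebesgue)"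
      unfolding z_def using w(2,3) by (intro nn_integral_mono ennreal_leI mult_right_le_one_le) (auto simp: less_imp_le)
    also have "\<dots> < \<infinity>" using H1_energy_ge(1)[OF H1_W11loc[OF d]] H1_finite[OF d] by (rule le_less_trans)
    finally show "(\<integral>\<^sup>+x. ennreal (z n x) \<partial>lebesgue) < \<infinity>" .
    show "z n \<in> borel_measurable lebesgue" unfolding z_def by measurable
  qed (use z0 in auto)
  have "(\<lambda>n. enn2real (\<integral>\<^sup>+x. ennreal (z n x) \<partial>lebesgue)) \<longlonglongrightarrow> 0"
    by (rule tendsto_enn2real) (use lim in simp_all)
  then have "(\<lambda>n. LINT x|lebesgue. norm (z n x)) \<longlonglongrightarrow> 0"
    using z0 zi by (simp add: integral_eq_nn_integral[OF borel_measurable_integrable[OF zi]])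
  from tendsto_L1_AE_subseq[of lebesgue z, OF zi this]
  obtain r :: "nat \<Rightarrow> nat" where r: "strict_mono r" "AE x in lebesgue. (\<lambda>n. z (r n) x) \<longlonglongrightarrow> 0" by blast
  from r(2) have "AE x in lebesgue. (\<lambda>n. v (r n) x) \<longlonglongrightarrow> u x"
  proof eventually_elim
    fix x assume "(\<lambda>n. z (r n) x) \<longlonglongrightarrow> 0"
    then have "(\<lambda>n. sqrt (z (r n) x / w x)) \<longlonglongrightarrow> sqrt (0 / w x)"
      using w(2)[of x] by (intro tendsto_intros) auto
    then have "(\<lambda>n. \<bar>v (r n) x - u x\<bar>) \<longlonglongrightarrow> 0" using w(2)[of x] by (simp add: z_def)
    then show "(\<lambda>n. v (r n) x) \<longlonglongrightarrow> u x" by (simp add: LIM_zero_iff tendsto_rabs_zero_iff)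
  qed
  with r(1) show ?thesis by (rule that)
qed

section \<open>The Coulomb energy\<close>

lemma emeasure_ball_le:
  assumes "0 \<le> r"
  shows "emeasure lebesgue (ball (x::R3) r) \<le> ennreal (8 * r ^ 3)"
proof -
  have "ball x r \<subseteq> cbox (\<chi> i. x $ i - r) (\<chi> i. x $ i + r)"
  proof
    fix y assume "y \<in> ball x r"
    then have "norm (y - x) \<le> r" by (simp add: dist_norm norm_minus_commute)
    then have "\<bar>y $ i - x $ i\<bar> \<le> r" for i
      using component_le_norm_cart[of "y - x" i] by (simp add: order_trans)
    then show "y \<in> cbox (\<chi> i. x $ i - r) (\<chi> i. x $ i + r)"
      by (simp add: mem_box_cart abs_le_iff algebra_simps)
  qed
  then have "emeasure lebesgue (ball x r) \<le> emeasure lborel (cbox (\<chi> i. x $ i - r) (\<chi> i. x $ i + r))"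
    using emeasure_mono[of "ball x r" "cbox (\<chi> i. x $ i - r) (\<chi> i. x $ i + r)" lborel] by simp
  also have "\<dots> = ennreal (8 * r ^ 3)"
  proof -
    have "((\<chi> i. x $ i + r) - (\<chi> i. x $ i - r) :: R3) \<bullet> j = 2 * r" "((\<chi> i. x $ i - r) :: R3) \<bullet> j \<le> (\<chi> i. x $ i + r) \<bullet> j" if "j \<in> Basis" for j
      using that assms by (auto simp: Basis_vec_def inner_axis)
    then show ?thesis by (simp add: emeasure_lborel_cbox_eq power_mult_distrib)
  qed
  finally show ?thesis .
qed

lemma measurable_norm_diff [measurable]: "(\<lambda>y. norm (x - y)) \<in> borel_measurable (lebesgue :: R3 measure)"
  by (intro borel_measurable_lebesgueI) measurable

text \<open>On the shell 2^-(k+1) <= |x - y| < 2^-k the kernel is at most 4^(k+1), and the ball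
  containing the shell has measure at most 8 * 8^-k. The products 32 * 2^-k sum to 64.\<close>

lemma kernel_square_integral:
  "(\<integral>\<^sup>+y. ennreal (indicator (ball x 1) y / (norm (x - y))\<^sup>2) \<partial>lebesgue) \<le> ennreal 64" for x :: R3
proof -
  have [measurable]: "ball x r \<in> sets lebesgue" for r by simp
  have "(\<integral>\<^sup>+y. ennreal (indicator (ball x 1) y / (norm (x - y))\<^sup>2) \<partial>lebesgue)
    \<le> (\<integral>\<^sup>+y. (\<Sum>k. ennreal (4 ^ Suc k) * indicator (ball x (1 / 2 ^ k)) y) \<partial>lebesgue)"
  proof (rule nn_integral_mono)
    fix y
    show "ennreal (indicator (ball x 1) y / (norm (x - y))\<^sup>2) \<le> (\<Sum>k. ennreal (4 ^ Suc k) * indicator (ball x (1 / 2 ^ k)) y)"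
    proof (cases "y \<in> ball x 1 \<and> y \<noteq> x")
      case True
      define s where "s = norm (x - y)"
      have s: "0 < s" "s < 1" using True by (auto simp: s_def dist_norm)
      have "\<exists>n. 1 / 2 ^ n \<le> s"
      proof -
        obtain n where "1 / s < 2 ^ n" using real_arch_pow[of 2] by auto
        then show ?thesis using s by (intro exI[of _ n]) (simp add: field_simps)
      qed
      then obtain n where n: "1 / 2 ^ n \<le> s" "\<And>m. m < n \<Longrightarrow> \<not> 1 / 2 ^ m \<le> s"
        using exists_least_iff[of "\<lambda>n. 1 / 2 ^ n \<le> s"] by auto
      then obtain k where k: "n = Suc k" using s(2) by (cases n) auto
      have "s < 1 / 2 ^ k" using n(2)[of k] k by simp
      then have yk: "y \<in> ball x (1 / 2 ^ k)" by (simp add: s_def dist_norm)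
      have "(1 / 2 ^ Suc k)\<^sup>2 \<le> s\<^sup>2" using n(1) k by (intro power_mono) auto
      then have "1 / s\<^sup>2 \<le> 4 ^ Suc k"
      proof -
        have "(1 / 2 ^ Suc k :: real)\<^sup>2 = 1 / 4 ^ Suc k"
          by (simp add: power_divide power_mult[symmetric] mult.commute) (simp add: power_mult power2_eq_square power_mult_distrib[symmetric])
        with \<open>(1 / 2 ^ Suc k)\<^sup>2 \<le> s\<^sup>2\<close> have "1 / 4 ^ Suc k \<le> s\<^sup>2" by simp
        then show ?thesis using s(1) by (simp add: field_simps)
      qed
      then have "ennreal (indicator (ball x 1) y / (norm (x - y))\<^sup>2) \<le> ennreal (4 ^ Suc k)"
        using True by (auto simp: s_def[symmetric] intro!: ennreal_leI)
      also have "\<dots> = ennreal (4 ^ Suc k) * indicator (ball x (1 / 2 ^ k)) y" using yk by simp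
      also have "\<dots> \<le> (\<Sum>k. ennreal (4 ^ Suc k) * indicator (ball x (1 / 2 ^ k)) y)"
        by (rule term_le_suminf_ennreal)
      finally show ?thesis .
    next
      \<comment> \<open>Either y lies outside the unit ball or y = x, where the kernel is 0 by the
        convention for division by zero.\<close>
      case False
      then have e: "indicator (ball x 1) y / (norm (x - y))\<^sup>2 = (0::real)" by (auto simp: indicator_def)
      show ?thesis unfolding e by simp
    qed
  qed
  also have "\<dots> = (\<Sum>k. \<integral>\<^sup>+y. ennreal (4 ^ Suc k) * indicator (ball x (1 / 2 ^ k)) y \<partial>lebesgue)"
    by (rule nn_integral_suminf) measurable
  also have "\<dots> \<le> (\<Sum>k. ennreal (32 * (1 / 2) ^ k))"
  proof (intro suminf_le summableI)
    fix k :: nat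
    have "(\<integral>\<^sup>+y. ennreal (4 ^ Suc k) * indicator (ball x (1 / 2 ^ k)) y \<partial>lebesgue) = ennreal (4 ^ Suc k) * emeasure lebesgue (ball x (1 / 2 ^ k))"
      by (rule nn_integral_cmult_indicator) measurable
    also have "\<dots> \<le> ennreal (4 ^ Suc k) * ennreal (8 * (1 / 2 ^ k) ^ 3)"
      by (intro mult_left_mono emeasure_ball_le) auto
    also have "\<dots> = ennreal (4 ^ Suc k * (8 * (1 / 2 ^ k) ^ 3))" by (rule ennreal_mult[symmetric]) auto
    also have "4 ^ Suc k * (8 * (1 / 2 ^ k) ^ 3) = 32 * (1 / 2 :: real) ^ k"
    proof -
      have "(4::real) ^ k = 2 ^ k * 2 ^ k" by (simp add: power_mult_distrib[symmetric])
      then show ?thesis by (simp add: power3_eq_cube power_one_over field_simps)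
    qed
    finally show "(\<integral>\<^sup>+y. ennreal (4 ^ Suc k) * indicator (ball x (1 / 2 ^ k)) y \<partial>lebesgue) \<le> ennreal (32 * (1 / 2) ^ k)" .
  qed
  also have "\<dots> = ennreal (\<Sum>k. 32 * (1 / 2) ^ k)"
    by (intro suminf_ennreal2 summable_mult summable_geometric) auto
  also have "(\<Sum>k. 32 * (1 / 2) ^ k) = (64::real)"
    by (simp add: suminf_mult summable_geometric suminf_geometric)
  finally show ?thesis .
qed

text \<open>The part away from the singularity contributes 1, the kernel integral 64/2 = 32, and the
  L^4 norm half of the Sobolev constant.\<close>

definition newton_const :: real where
  "newton_const = 33 + sobolev_const 4 / 2"

lemma newton_const_nonneg: "0 \<le> newton_const"
  using sobolev_const_nonneg[of 4] by (simp add: newton_const_def)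

text \<open>Off the unit ball around x the kernel is at most 1. On it, u^2/|x-y| <= u^4/(2K^2) +
  (K^2/2)/|x-y|^2, where the Sobolev inequality with exponent 4 bounds the first term and the square
  of the kernel is integrable in dimension 3. The weights in K keep the bound quadratic in
  K.\<close>

lemma newton_potential_bound:
  assumes u: "u \<in> H1" and K: "0 < K" "H1_energy u \<le> ennreal (K\<^sup>2)"
  shows "(\<integral>\<^sup>+y. ennreal ((u y)\<^sup>2 / norm (x - y)) \<partial>lebesgue) \<le> ennreal (newton_const * K\<^sup>2)"
proof -
  note uW = H1_W11loc[OF u]
  note [measurable] = W11loc_measurable(1)[OF uW]
  have [measurable]: "ball x r \<in> sets lebesgue" for r by simp
  define k where "k y = (indicator (ball x 1) y / (norm (x - y))\<^sup>2 :: real)" for y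
  have [measurable]: "k \<in> borel_measurable lebesgue" unfolding k_def by measurable
  have k0: "0 \<le> k y" for y by (simp add: k_def)
  have "(\<integral>\<^sup>+y. ennreal ((u y)\<^sup>2 / norm (x - y)) \<partial>lebesgue)
     \<le> (\<integral>\<^sup>+y. ennreal ((u y)\<^sup>2) + (ennreal (1 / (2 * K\<^sup>2)) * ennreal (\<bar>u y\<bar> powr 4) + ennreal (K\<^sup>2 / 2) * ennreal (k y)) \<partial>lebesgue)"
  proof (rule nn_integral_mono)
    fix y
    have "(u y)\<^sup>2 / norm (x - y) \<le> (u y)\<^sup>2 + (1 / (2 * K\<^sup>2) * \<bar>u y\<bar> powr 4 + K\<^sup>2 / 2 * k y)"
    proof (cases "y \<in> ball x 1")
      case False
      then have n: "1 \<le> norm (x - y)" by (simp add: dist_norm)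
      have "(u y)\<^sup>2 / norm (x - y) \<le> (u y)\<^sup>2 / 1"
        using n by (intro divide_left_mono) auto
      moreover have "0 \<le> 1 / (2 * K\<^sup>2) * \<bar>u y\<bar> powr 4 + K\<^sup>2 / 2 * k y"
        using k0[of y] by simp
      ultimately show ?thesis by simp
    next
      case True
      define s where "s = 1 / norm (x - y)"
      have ky: "k y = s\<^sup>2" using True by (simp add: k_def s_def power_divide)
      have p4: "\<bar>u y\<bar> powr 4 = ((u y)\<^sup>2)\<^sup>2"
        by (cases "u y = 0") (auto simp: powr_numeral power_even_abs power2_eq_square power4_eq_xxxx)
      have "0 \<le> ((u y)\<^sup>2 / K - K * s)\<^sup>2" by simp
      also have "\<dots> = ((u y)\<^sup>2)\<^sup>2 / K\<^sup>2 - 2 * ((u y)\<^sup>2 * s) + K\<^sup>2 * s\<^sup>2"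
        using K(1) by (simp add: power2_diff power_divide power_mult_distrib)
      finally have "(u y)\<^sup>2 * s \<le> 1 / (2 * K\<^sup>2) * ((u y)\<^sup>2)\<^sup>2 + K\<^sup>2 / 2 * s\<^sup>2" by simp
      then show ?thesis unfolding ky p4 by (simp add: s_def add_increasing)
    qed
    then have "ennreal ((u y)\<^sup>2 / norm (x - y)) \<le> ennreal ((u y)\<^sup>2 + (1 / (2 * K\<^sup>2) * \<bar>u y\<bar> powr 4 + K\<^sup>2 / 2 * k y))"
      by (rule ennreal_leI)
    also have "\<dots> = ennreal ((u y)\<^sup>2) + (ennreal (1 / (2 * K\<^sup>2)) * ennreal (\<bar>u y\<bar> powr 4) + ennreal (K\<^sup>2 / 2) * ennreal (k y))"
      using k0[of y] by (subst ennreal_lincomb) auto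
    finally show "ennreal ((u y)\<^sup>2 / norm (x - y)) \<le> ennreal ((u y)\<^sup>2) + (ennreal (1 / (2 * K\<^sup>2)) * ennreal (\<bar>u y\<bar> powr 4) + ennreal (K\<^sup>2 / 2) * ennreal (k y))" .
  qed
  also have "\<dots> = (\<integral>\<^sup>+y. ennreal ((u y)\<^sup>2) \<partial>lebesgue) + (ennreal (1 / (2 * K\<^sup>2)) * (\<integral>\<^sup>+y. ennreal (\<bar>u y\<bar> powr 4) \<partial>lebesgue) + ennreal (K\<^sup>2 / 2) * (\<integral>\<^sup>+y. ennreal (k y) \<partial>lebesgue))"
    by (simp add: nn_integral_add nn_integral_cmult)
  also have "\<dots> \<le> ennreal (K\<^sup>2) + (ennreal (1 / (2 * K\<^sup>2)) * ennreal (sobolev_const 4 * K powr 4) + ennreal (K\<^sup>2 / 2) * ennreal 64)"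
    using order_trans[OF H1_energy_ge(1)[OF uW] K(2)] sobolev_inequality[OF uW K, of 4] kernel_square_integral[of x]
    by (intro add_mono mult_left_mono) (auto simp: k_def)
  also have "\<dots> = ennreal (K\<^sup>2 + (1 / (2 * K\<^sup>2) * (sobolev_const 4 * K powr 4) + K\<^sup>2 / 2 * 64))"
  proof -
    have nn: "0 \<le> sobolev_const 4 * K powr 4" using sobolev_const_nonneg[of 4] by simp
    have "ennreal (1 / (2 * K\<^sup>2)) * ennreal (sobolev_const 4 * K powr 4) + ennreal (K\<^sup>2 / 2) * ennreal 64
        = ennreal (1 / (2 * K\<^sup>2) * (sobolev_const 4 * K powr 4) + K\<^sup>2 / 2 * 64)"
      by (rule ennreal_lincomb[OF nn]) auto
    then show ?thesis using nn by (simp only:) (intro ennreal_plus[symmetric] add_nonneg_nonneg mult_nonneg_nonneg nn; simp)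
  qed
  also have "K\<^sup>2 + (1 / (2 * K\<^sup>2) * (sobolev_const 4 * K powr 4) + K\<^sup>2 / 2 * 64) = newton_const * K\<^sup>2"
  proof -
    have "K powr 4 = K\<^sup>2 * K\<^sup>2" using K(1) by (simp add: powr_numeral power4_eq_xxxx power2_eq_square)
    then show ?thesis using K(1) by (simp add: newton_const_def field_simps)
  qed
  finally show ?thesis .
qed

section \<open>The Coulomb energy as a bilinear form of densities\<close>

definition potential :: "(R3 \<Rightarrow> real) \<Rightarrow> (R3 \<Rightarrow> real) \<Rightarrow> R3 \<Rightarrow> real" where
  "potential \<rho> g x = (LINT y|lebesgue. g y * \<rho> y / norm (x - y))"

text \<open>The arguments are densities, typically products of two \<open>H1\<close> functions, so
  that the energy, quartic in u, becomes a bilinear form evaluated at u^2 and its derivative is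
  again a value of the form.\<close>

definition coulomb_form :: "(R3 \<Rightarrow> real) \<Rightarrow> (R3 \<Rightarrow> real) \<Rightarrow> (R3 \<Rightarrow> real) \<Rightarrow> real" where
  "coulomb_form \<rho> f g = (LINT x|lebesgue. f x * \<rho> x * potential \<rho> g x)"

locale bounded_density =
  fixes \<rho> :: "R3 \<Rightarrow> real" and R :: real
  assumes rho_nonneg: "0 \<le> \<rho> x" and rho_le: "\<rho> x \<le> R" and rho_measurable [measurable]: "\<rho> \<in> borel_measurable lebesgue"
begin

lemma R_nonneg: "0 \<le> R"
  using rho_nonneg[of 0] rho_le[of 0] by simp

lemma measurable_kernel:
  assumes [measurable]: "g \<in> borel_measurable lebesgue"
  shows "(\<lambda>(x, y). g y * \<rho> y / norm (x - y)) \<in> borel_measurable (lebesgue \<Otimes>\<^sub>M lebesgue)"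
proof -
  have id: "(\<lambda>x. x) \<in> measurable (lebesgue :: R3 measure) borel"
    by (intro borel_measurable_lebesgueI) simp
  have [measurable]: "fst \<in> borel_measurable ((lebesgue :: R3 measure) \<Otimes>\<^sub>M (lebesgue :: R3 measure))"
    "snd \<in> borel_measurable ((lebesgue :: R3 measure) \<Otimes>\<^sub>M (lebesgue :: R3 measure))"
    by (rule measurable_compose[OF measurable_fst id] measurable_compose[OF measurable_snd id])+
  have [measurable]: "(\<lambda>z. g (snd z)) \<in> borel_measurable (lebesgue \<Otimes>\<^sub>M lebesgue)" "(\<lambda>z. \<rho> (snd z)) \<in> borel_measurable (lebesgue \<Otimes>\<^sub>M lebesgue)"
    by (rule measurable_compose[OF measurable_snd assms] measurable_compose[OF measurable_snd rho_measurable])+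
  show ?thesis unfolding split_beta' by measurable
qed

lemma measurable_potential:
  assumes "g \<in> borel_measurable lebesgue"
  shows "potential \<rho> g \<in> borel_measurable lebesgue"
  using sigma_finite_measure.borel_measurable_lebesgue_integral[OF sigma_finite_lebesgue measurable_kernel[OF assms]]
  unfolding potential_def .

lemma nn_potential_product:
  assumes a: "a \<in> H1" and b: "b \<in> H1" and K: "0 < K" "H1_energy a \<le> ennreal (K\<^sup>2)" "H1_energy b \<le> ennreal (K\<^sup>2)"
  shows "(\<integral>\<^sup>+y. ennreal (\<bar>a y * b y * \<rho> y / norm (x - y)\<bar>) \<partial>lebesgue) \<le> ennreal (R * newton_const * K\<^sup>2)"
proof -
  note [measurable] = W11loc_measurable(1)[OF H1_W11loc[OF a]] W11loc_measurable(1)[OF H1_W11loc[OF b]]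
  have "(\<integral>\<^sup>+y. ennreal (\<bar>a y * b y * \<rho> y / norm (x - y)\<bar>) \<partial>lebesgue)
     \<le> (\<integral>\<^sup>+y. ennreal (R / 2) * ennreal ((a y)\<^sup>2 / norm (x - y)) + ennreal (R / 2) * ennreal ((b y)\<^sup>2 / norm (x - y)) \<partial>lebesgue)"
  proof (rule nn_integral_mono)
    fix y
    have "2 * (\<bar>a y\<bar> * \<bar>b y\<bar>) \<le> (a y)\<^sup>2 + (b y)\<^sup>2"
      using sum_squares_bound[of "\<bar>a y\<bar>" "\<bar>b y\<bar>"] by (simp add: mult.assoc)
    then have "\<bar>a y\<bar> * \<bar>b y\<bar> * \<rho> y \<le> ((a y)\<^sup>2 + (b y)\<^sup>2) / 2 * R"
      using rho_nonneg[of y] rho_le[of y] by (intro mult_mono) auto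
    then have "\<bar>a y\<bar> * \<bar>b y\<bar> * \<rho> y / norm (x - y) \<le> ((a y)\<^sup>2 + (b y)\<^sup>2) / 2 * R / norm (x - y)"
      by (rule divide_right_mono) simp
    then have "\<bar>a y * b y * \<rho> y / norm (x - y)\<bar> \<le> R / 2 * ((a y)\<^sup>2 / norm (x - y)) + R / 2 * ((b y)\<^sup>2 / norm (x - y))"
      using rho_nonneg[of y] by (simp add: abs_mult add_divide_distrib algebra_simps)
    then show "ennreal (\<bar>a y * b y * \<rho> y / norm (x - y)\<bar>) \<le> ennreal (R / 2) * ennreal ((a y)\<^sup>2 / norm (x - y)) + ennreal (R / 2) * ennreal ((b y)\<^sup>2 / norm (x - y))"
      using R_nonneg by (subst ennreal_lincomb) (auto intro!: ennreal_leI simp del: ennreal_plus)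
  qed
  also have "\<dots> = ennreal (R / 2) * (\<integral>\<^sup>+y. ennreal ((a y)\<^sup>2 / norm (x - y)) \<partial>lebesgue) + ennreal (R / 2) * (\<integral>\<^sup>+y. ennreal ((b y)\<^sup>2 / norm (x - y)) \<partial>lebesgue)"
    by (simp add: nn_integral_add nn_integral_cmult)
  also have "\<dots> \<le> ennreal (R / 2) * ennreal (newton_const * K\<^sup>2) + ennreal (R / 2) * ennreal (newton_const * K\<^sup>2)"
    by (intro add_mono mult_left_mono newton_potential_bound a b K) auto
  also have "\<dots> = ennreal (R * newton_const * K\<^sup>2)"
    using R_nonneg newton_const_nonneg by (subst ennreal_lincomb) auto
  finally show ?thesis .
qed

lemma H1_common_bound:
  assumes "a \<in> H1" "b \<in> H1"
  obtains K where "0 < K" "H1_energy a \<le> ennreal (K\<^sup>2)" "H1_energy b \<le> ennreal (K\<^sup>2)"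
proof (rule that[of "sqrt (1 + H1_sq a + H1_sq b)"])
  have "(sqrt (1 + H1_sq a + H1_sq b))\<^sup>2 = 1 + H1_sq a + H1_sq b" by simp
  then show "H1_energy a \<le> ennreal ((sqrt (1 + H1_sq a + H1_sq b))\<^sup>2)" "H1_energy b \<le> ennreal ((sqrt (1 + H1_sq a + H1_sq b))\<^sup>2)"
    using H1_sq_eq_norm[OF assms(1)] H1_sq_eq_norm[OF assms(2)] by (metis enn2real_nonneg ennreal_leI add_increasing2 add_increasing order_refl zero_le_one add.commute)+
qed (simp add: add_pos_nonneg)

lemma integrable_potential_product:
  assumes a: "a \<in> H1" and b: "b \<in> H1"
  shows "integrable lebesgue (\<lambda>y. a y * b y * \<rho> y / norm (x - y))"
proof -
  obtain K where K: "0 < K" "H1_energy a \<le> ennreal (K\<^sup>2)" "H1_energy b \<le> ennreal (K\<^sup>2)"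
    using H1_common_bound[OF a b] by blast
  note [measurable] = W11loc_measurable(1)[OF H1_W11loc[OF a]] W11loc_measurable(1)[OF H1_W11loc[OF b]]
  show ?thesis
  proof (rule integrableI_bounded)
    show "(\<integral>\<^sup>+y. ennreal (norm (a y * b y * \<rho> y / norm (x - y))) \<partial>lebesgue) < \<infinity>"
      using nn_potential_product[OF a b K, of x] by (simp add: le_less_trans)
    show "(\<lambda>y. a y * b y * \<rho> y / norm (x - y)) \<in> borel_measurable lebesgue" by measurable
  qed
qed

lemma potential_product_bound:
  assumes a: "a \<in> H1" and b: "b \<in> H1" and K: "0 < K" "H1_energy a \<le> ennreal (K\<^sup>2)" "H1_energy b \<le> ennreal (K\<^sup>2)"
  shows "\<bar>potential \<rho> (\<lambda>y. a y * b y) x\<bar> \<le> R * newton_const * K\<^sup>2"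
proof -
  have "ennreal \<bar>potential \<rho> (\<lambda>y. a y * b y) x\<bar> \<le> ennreal (R * newton_const * K\<^sup>2)"
    unfolding potential_def
    using order_trans[OF integral_norm_bound_ennreal[OF integrable_potential_product[OF a b, of x]]] nn_potential_product[OF a b K, of x]
    by simp
  then show ?thesis using R_nonneg newton_const_nonneg by simp
qed

lemma integrable_H1_mult:
  assumes a: "a \<in> H1" and b: "b \<in> H1"
  shows "integrable lebesgue (\<lambda>x. a x * b x)"
proof -
  obtain K where K: "0 < K" "H1_energy a \<le> ennreal (K\<^sup>2)" "H1_energy b \<le> ennreal (K\<^sup>2)"
    using H1_common_bound[OF a b] by blast
  note m = W11loc_measurable(1)[OF H1_W11loc[OF a]] W11loc_measurable(1)[OF H1_W11loc[OF b]]
  have "(\<integral>\<^sup>+x. ennreal \<bar>a x * b x\<bar> \<partial>lebesgue) \<le> ennreal (K * K)"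
    by (rule nn_integral_abs_mult_le[OF m K(1) _ K(1)])
      (rule order_trans[OF H1_energy_ge(1)[OF H1_W11loc[OF a]] K(2)] order_trans[OF H1_energy_ge(1)[OF H1_W11loc[OF b]] K(3)])+
  then show ?thesis using m by (intro integrableI_bounded) (auto simp: le_less_trans)
qed

text \<open>The two slots are treated differently: the potential of c d is bounded uniformly, one
  factor R coming from each density, while a b enters only through its L^1 norm. The latter is what
  tends to 0 when the bound is applied to (v_n - u) u.\<close>

lemma coulomb_form_bound:
  assumes a: "a \<in> H1" and b: "b \<in> H1" and c: "c \<in> H1" and d: "d \<in> H1"
  shows "integrable lebesgue (\<lambda>x. a x * b x * \<rho> x * potential \<rho> (\<lambda>y. c y * d y) x)"
    "0 < K \<Longrightarrow> H1_energy c \<le> ennreal (K\<^sup>2) \<Longrightarrow> H1_energy d \<le> ennreal (K\<^sup>2) \<Longrightarrow>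
      \<bar>coulomb_form \<rho> (\<lambda>x. a x * b x) (\<lambda>x. c x * d x)\<bar> \<le> R * (R * newton_const * K\<^sup>2) * (LINT x|lebesgue. \<bar>a x * b x\<bar>)"
proof -
  note [measurable] = W11loc_measurable(1)[OF H1_W11loc[OF a]] W11loc_measurable(1)[OF H1_W11loc[OF b]]
    W11loc_measurable(1)[OF H1_W11loc[OF c]] W11loc_measurable(1)[OF H1_W11loc[OF d]]
  have [measurable]: "potential \<rho> (\<lambda>y. c y * d y) \<in> borel_measurable lebesgue"
    by (rule measurable_potential) measurable
  have pt: "\<bar>a x * b x * \<rho> x * potential \<rho> (\<lambda>y. c y * d y) x\<bar> \<le> R * (R * newton_const * L\<^sup>2) * \<bar>a x * b x\<bar>"
    if "0 < L" "H1_energy c \<le> ennreal (L\<^sup>2)" "H1_energy d \<le> ennreal (L\<^sup>2)" for x L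
  proof -
    have "\<bar>a x * b x\<bar> * (\<rho> x * \<bar>potential \<rho> (\<lambda>y. c y * d y) x\<bar>) \<le> \<bar>a x * b x\<bar> * (R * (R * newton_const * L\<^sup>2))"
      using rho_nonneg[of x] rho_le[of x] potential_product_bound[OF c d that, of x] R_nonneg
      by (intro mult_left_mono mult_mono) auto
    then show ?thesis using rho_nonneg[of x] by (simp add: abs_mult mult_ac)
  qed
  obtain L where L: "0 < L" "H1_energy c \<le> ennreal (L\<^sup>2)" "H1_energy d \<le> ennreal (L\<^sup>2)"
    using H1_common_bound[OF c d] by blast
  show i: "integrable lebesgue (\<lambda>x. a x * b x * \<rho> x * potential \<rho> (\<lambda>y. c y * d y) x)"
  proof (rule Bochner_Integration.integrable_bound)
    show "integrable lebesgue (\<lambda>x. R * (R * newton_const * L\<^sup>2) * \<bar>a x * b x\<bar>)"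
      by (intro integrable_mult_right integrable_abs integrable_H1_mult a b)
    show "AE x in lebesgue. norm (a x * b x * \<rho> x * potential \<rho> (\<lambda>y. c y * d y) x) \<le> norm (R * (R * newton_const * L\<^sup>2) * \<bar>a x * b x\<bar>)"
      by (intro AE_I2) (simp only: real_norm_def, rule order_trans[OF pt[OF L] abs_ge_self])
    show "(\<lambda>x. a x * b x * \<rho> x * potential \<rho> (\<lambda>y. c y * d y) x) \<in> borel_measurable lebesgue" by measurable
  qed
  assume K: "0 < K" "H1_energy c \<le> ennreal (K\<^sup>2)" "H1_energy d \<le> ennreal (K\<^sup>2)"
  have "\<bar>coulomb_form \<rho> (\<lambda>x. a x * b x) (\<lambda>x. c x * d x)\<bar> \<le> (LINT x|lebesgue. \<bar>a x * b x * \<rho> x * potential \<rho> (\<lambda>y. c y * d y) x\<bar>)"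
    unfolding coulomb_form_def by (rule integral_abs_bound)
  also have "\<dots> \<le> (LINT x|lebesgue. R * (R * newton_const * K\<^sup>2) * \<bar>a x * b x\<bar>)"
    by (rule integral_mono[OF integrable_abs[OF i] _ pt[OF K]]) (intro integrable_mult_right integrable_abs integrable_H1_mult a b)
  finally show "\<bar>coulomb_form \<rho> (\<lambda>x. a x * b x) (\<lambda>x. c x * d x)\<bar> \<le> R * (R * newton_const * K\<^sup>2) * (LINT x|lebesgue. \<bar>a x * b x\<bar>)"
    by simp
qed

text \<open>Fubini for the symmetric kernel. It merges the two mixed first-order terms in the
  expansion of the energy into one.\<close>

lemma coulomb_form_sym:
  assumes a: "a \<in> H1" and b: "b \<in> H1" and c: "c \<in> H1" and d: "d \<in> H1"
  shows "coulomb_form \<rho> (\<lambda>x. a x * b x) (\<lambda>x. c x * d x) = coulomb_form \<rho> (\<lambda>x. c x * d x) (\<lambda>x. a x * b x)"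
proof -
  note [measurable] = W11loc_measurable(1)[OF H1_W11loc[OF a]] W11loc_measurable(1)[OF H1_W11loc[OF b]]
    W11loc_measurable(1)[OF H1_W11loc[OF c]] W11loc_measurable(1)[OF H1_W11loc[OF d]]
  interpret pair_sigma_finite "lebesgue :: R3 measure" "lebesgue :: R3 measure"
    by (intro pair_sigma_finite.intro sigma_finite_lebesgue)
  obtain K where K: "0 < K" "H1_energy c \<le> ennreal (K\<^sup>2)" "H1_energy d \<le> ennreal (K\<^sup>2)"
    using H1_common_bound[OF c d] by blast
  define k where "k x y = a x * b x * \<rho> x * (c y * d y * \<rho> y / norm (x - y))" for x y
  have km: "(\<lambda>(x, y). k x y) \<in> borel_measurable (lebesgue \<Otimes>\<^sub>M lebesgue)"
  proof -
    have [measurable]: "(\<lambda>z. c (snd z) * d (snd z) * \<rho> (snd z) / norm (fst z - snd z)) \<in> borel_measurable (lebesgue \<Otimes>\<^sub>M lebesgue)"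
      using measurable_kernel[of "\<lambda>y. c y * d y"] by (simp add: split_beta')
    have [measurable]: "(\<lambda>z. a (fst z) * b (fst z) * \<rho> (fst z)) \<in> borel_measurable (lebesgue \<Otimes>\<^sub>M lebesgue)"
      by (rule measurable_compose[OF measurable_fst]) measurable
    show ?thesis unfolding k_def split_beta' by measurable
  qed
  have "integrable (lebesgue \<Otimes>\<^sub>M lebesgue) (\<lambda>(x, y). k x y)"
  proof (rule integrableI_bounded[OF km])
    have "(\<integral>\<^sup>+z. ennreal (norm (case z of (x, y) \<Rightarrow> k x y)) \<partial>(lebesgue \<Otimes>\<^sub>M lebesgue)) = (\<integral>\<^sup>+x. \<integral>\<^sup>+y. ennreal \<bar>k x y\<bar> \<partial>lebesgue \<partial>lebesgue)"
      using km by (subst sigma_finite_measure.nn_integral_fst[OF sigma_finite_lebesgue, symmetric]) auto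
    also have "\<dots> \<le> (\<integral>\<^sup>+x. ennreal (R * (R * newton_const * K\<^sup>2)) * ennreal \<bar>a x * b x\<bar> \<partial>lebesgue)"
    proof (rule nn_integral_mono)
      fix x
      have "(\<integral>\<^sup>+y. ennreal \<bar>k x y\<bar> \<partial>lebesgue) = (\<integral>\<^sup>+y. ennreal \<bar>a x * b x * \<rho> x\<bar> * ennreal \<bar>c y * d y * \<rho> y / norm (x - y)\<bar> \<partial>lebesgue)"
        by (simp add: k_def abs_mult ennreal_mult[symmetric])
      also have "\<dots> = ennreal \<bar>a x * b x * \<rho> x\<bar> * (\<integral>\<^sup>+y. ennreal \<bar>c y * d y * \<rho> y / norm (x - y)\<bar> \<partial>lebesgue)"
        by (rule nn_integral_cmult) measurable
      also have "\<dots> \<le> ennreal (R * \<bar>a x * b x\<bar>) * ennreal (R * newton_const * K\<^sup>2)"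
        using rho_nonneg[of x] rho_le[of x]
        by (intro mult_mono nn_potential_product c d K ennreal_leI) (auto simp: abs_mult mult_right_mono mult_ac intro!: mult_left_mono)
      also have "\<dots> = ennreal (R * (R * newton_const * K\<^sup>2)) * ennreal \<bar>a x * b x\<bar>"
        using R_nonneg newton_const_nonneg by (simp add: ennreal_mult[symmetric] mult_ac)
      finally show "(\<integral>\<^sup>+y. ennreal \<bar>k x y\<bar> \<partial>lebesgue) \<le> ennreal (R * (R * newton_const * K\<^sup>2)) * ennreal \<bar>a x * b x\<bar>" .
    qed
    also have "\<dots> = ennreal (R * (R * newton_const * K\<^sup>2)) * (\<integral>\<^sup>+x. ennreal \<bar>a x * b x\<bar> \<partial>lebesgue)"
      by (rule nn_integral_cmult) measurable
    also have "\<dots> < \<infinity>"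
      using integrable_H1_mult[OF a b] by (simp add: integrable_iff_bounded ennreal_mult_less_top)
    finally show "(\<integral>\<^sup>+z. ennreal (norm (case z of (x, y) \<Rightarrow> k x y)) \<partial>(lebesgue \<Otimes>\<^sub>M lebesgue)) < \<infinity>" .
  qed
  then have "(LINT y|lebesgue. LINT x|lebesgue. k x y) = (LINT x|lebesgue. LINT y|lebesgue. k x y)"
    by (rule Fubini_integral)
  moreover have "(LINT x|lebesgue. LINT y|lebesgue. k x y) = coulomb_form \<rho> (\<lambda>x. a x * b x) (\<lambda>x. c x * d x)"
    by (simp only: coulomb_form_def potential_def k_def integral_mult_right_zero)
  moreover have "(LINT x|lebesgue. k x y) = c y * d y * \<rho> y * potential \<rho> (\<lambda>x. a x * b x) y" for y
  proof -
    have "(LINT x|lebesgue. k x y) = (LINT x|lebesgue. (c y * d y * \<rho> y) * (a x * b x * \<rho> x / norm (y - x)))"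
      unfolding k_def by (intro Bochner_Integration.integral_cong) (auto simp: norm_minus_commute mult_ac)
    then show ?thesis by (simp only: potential_def integral_mult_right_zero)
  qed
  ultimately show ?thesis by (simp add: coulomb_form_def)
qed

text \<open>The bridge between extended nonnegative double integrals, in which the energy is defined
  and Fatou holds, and the real-valued form used in the algebra. Two functions are allowed because
  mixed energies of u and v_n occur.\<close>

lemma
  assumes a: "a \<in> H1" and b: "b \<in> H1"
  shows Coulomb_pair_eq: "(\<integral>\<^sup>+x. \<integral>\<^sup>+y. ennreal ((a x)\<^sup>2 * \<rho> x * (b y)\<^sup>2 * \<rho> y / norm (x - y)) \<partial>lebesgue \<partial>lebesgue)
    = ennreal (coulomb_form \<rho> (\<lambda>x. a x * a x) (\<lambda>x. b x * b x))"
    and coulomb_form_nonneg: "0 \<le> coulomb_form \<rho> (\<lambda>x. a x * a x) (\<lambda>x. b x * b x)"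
proof -
  note [measurable] = W11loc_measurable(1)[OF H1_W11loc[OF a]] W11loc_measurable(1)[OF H1_W11loc[OF b]]
  have p0: "0 \<le> potential \<rho> (\<lambda>y. b y * b y) x" for x
    unfolding potential_def using rho_nonneg by (intro Bochner_Integration.integral_nonneg) simp
  have "(\<integral>\<^sup>+y. ennreal ((a x)\<^sup>2 * \<rho> x * (b y)\<^sup>2 * \<rho> y / norm (x - y)) \<partial>lebesgue) = ennreal (a x * a x * \<rho> x * potential \<rho> (\<lambda>y. b y * b y) x)" for x
  proof -
    have "(\<integral>\<^sup>+y. ennreal ((a x)\<^sup>2 * \<rho> x * (b y)\<^sup>2 * \<rho> y / norm (x - y)) \<partial>lebesgue)
        = (\<integral>\<^sup>+y. ennreal (a x * a x * \<rho> x) * ennreal (b y * b y * \<rho> y / norm (x - y)) \<partial>lebesgue)"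
      using rho_nonneg by (intro nn_integral_cong) (simp add: ennreal_mult[symmetric] power2_eq_square mult_ac)
    also have "\<dots> = ennreal (a x * a x * \<rho> x) * (\<integral>\<^sup>+y. ennreal (b y * b y * \<rho> y / norm (x - y)) \<partial>lebesgue)"
      by (rule nn_integral_cmult) measurable
    also have "(\<integral>\<^sup>+y. ennreal (b y * b y * \<rho> y / norm (x - y)) \<partial>lebesgue) = ennreal (potential \<rho> (\<lambda>y. b y * b y) x)"
      unfolding potential_def using rho_nonneg by (intro nn_integral_eq_integral integrable_potential_product b) simp
    finally show ?thesis using rho_nonneg[of x] p0[of x] by (simp add: ennreal_mult[symmetric])
  qed
  then show "(\<integral>\<^sup>+x. \<integral>\<^sup>+y. ennreal ((a x)\<^sup>2 * \<rho> x * (b y)\<^sup>2 * \<rho> y / norm (x - y)) \<partial>lebesgue \<partial>lebesgue)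
    = ennreal (coulomb_form \<rho> (\<lambda>x. a x * a x) (\<lambda>x. b x * b x))"
    unfolding coulomb_form_def using rho_nonneg p0
    by simp (intro nn_integral_eq_integral coulomb_form_bound(1) a b AE_I2 mult_nonneg_nonneg zero_le_square rho_nonneg p0)
  show "0 \<le> coulomb_form \<rho> (\<lambda>x. a x * a x) (\<lambda>x. b x * b x)"
    unfolding coulomb_form_def
    by (intro Bochner_Integration.integral_nonneg mult_nonneg_nonneg zero_le_square rho_nonneg p0)
qed

lemma Coulomb_energy_eq: "u \<in> H1 \<Longrightarrow> Coulomb_energy \<rho> u = ennreal (coulomb_form \<rho> (\<lambda>x. u x * u x) (\<lambda>x. u x * u x))"
  unfolding Coulomb_energy_def by (rule Coulomb_pair_eq)

text \<open>Fatou twice, for the inner integral at almost every x and then for the outer one. One of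
  the two sequences may be constant, which gives the bound for mixed energies.\<close>

lemma coulomb_form_fatou:
  assumes a: "\<And>n::nat. a n \<in> H1" "a' \<in> H1" and b: "\<And>n. b n \<in> H1" "b' \<in> H1"
    and lim: "AE x in lebesgue. (\<lambda>n. a n x) \<longlonglongrightarrow> a' x" "AE x in lebesgue. (\<lambda>n. b n x) \<longlonglongrightarrow> b' x"
  shows "ennreal (coulomb_form \<rho> (\<lambda>x. a' x * a' x) (\<lambda>x. b' x * b' x))
    \<le> liminf (\<lambda>n. ennreal (coulomb_form \<rho> (\<lambda>x. a n x * a n x) (\<lambda>x. b n x * b n x)))"
proof -
  note [measurable] = W11loc_measurable(1)[OF H1_W11loc[OF a(1)]] W11loc_measurable(1)[OF H1_W11loc[OF b(1)]]
  define k where "k n x y = ennreal ((a n x)\<^sup>2 * \<rho> x * (b n y)\<^sup>2 * \<rho> y / norm (x - y))" for n x y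
  have inner: "AE x in lebesgue. (\<integral>\<^sup>+y. ennreal ((a' x)\<^sup>2 * \<rho> x * (b' y)\<^sup>2 * \<rho> y / norm (x - y)) \<partial>lebesgue) \<le> liminf (\<lambda>n. \<integral>\<^sup>+y. k n x y \<partial>lebesgue)"
    using lim(1)
  proof eventually_elim
    fix x assume ax: "(\<lambda>n. a n x) \<longlonglongrightarrow> a' x"
    have "(\<integral>\<^sup>+y. ennreal ((a' x)\<^sup>2 * \<rho> x * (b' y)\<^sup>2 * \<rho> y / norm (x - y)) \<partial>lebesgue) = (\<integral>\<^sup>+y. liminf (\<lambda>n. k n x y) \<partial>lebesgue)"
    proof (rule nn_integral_cong_AE)
      show "AE y in lebesgue. ennreal ((a' x)\<^sup>2 * \<rho> x * (b' y)\<^sup>2 * \<rho> y / norm (x - y)) = liminf (\<lambda>n. k n x y)"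
        using lim(2)
      proof eventually_elim
        fix y assume "(\<lambda>n. b n y) \<longlonglongrightarrow> b' y"
        with ax have "(\<lambda>n. (a n x)\<^sup>2 * \<rho> x * (b n y)\<^sup>2 * \<rho> y * (1 / norm (x - y))) \<longlonglongrightarrow> (a' x)\<^sup>2 * \<rho> x * (b' y)\<^sup>2 * \<rho> y * (1 / norm (x - y))"
          by (intro tendsto_mult tendsto_power tendsto_const)
        then have "(\<lambda>n. k n x y) \<longlonglongrightarrow> ennreal ((a' x)\<^sup>2 * \<rho> x * (b' y)\<^sup>2 * \<rho> y / norm (x - y))"
          unfolding k_def by (intro tendsto_ennrealI) simp
        then show "ennreal ((a' x)\<^sup>2 * \<rho> x * (b' y)\<^sup>2 * \<rho> y / norm (x - y)) = liminf (\<lambda>n. k n x y)"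
          by (simp only: lim_imp_Liminf[OF trivial_limit_sequentially])
      qed
    qed
    also have "\<dots> \<le> liminf (\<lambda>n. \<integral>\<^sup>+y. k n x y \<partial>lebesgue)"
      unfolding k_def by (rule nn_integral_liminf) measurable
    finally show "(\<integral>\<^sup>+y. ennreal ((a' x)\<^sup>2 * \<rho> x * (b' y)\<^sup>2 * \<rho> y / norm (x - y)) \<partial>lebesgue) \<le> liminf (\<lambda>n. \<integral>\<^sup>+y. k n x y \<partial>lebesgue)" .
  qed
  have km: "(\<lambda>x. \<integral>\<^sup>+y. k n x y \<partial>lebesgue) \<in> borel_measurable lebesgue" for n
  proof -
    have [measurable]: "(\<lambda>z. (b n (snd z))\<^sup>2 * \<rho> (snd z) / norm (fst z - snd z)) \<in> borel_measurable (lebesgue \<Otimes>\<^sub>M lebesgue)"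
      using measurable_kernel[of "\<lambda>y. (b n y)\<^sup>2"] by (simp add: split_beta')
    have [measurable]: "(\<lambda>z. (a n (fst z))\<^sup>2 * \<rho> (fst z)) \<in> borel_measurable (lebesgue \<Otimes>\<^sub>M lebesgue)"
      by (rule measurable_compose[OF measurable_fst]) measurable
    have "(\<lambda>z. ennreal (((a n (fst z))\<^sup>2 * \<rho> (fst z)) * ((b n (snd z))\<^sup>2 * \<rho> (snd z) / norm (fst z - snd z)))) \<in> borel_measurable (lebesgue \<Otimes>\<^sub>M lebesgue)"
      by measurable
    then have "(\<lambda>(x, y). k n x y) \<in> borel_measurable (lebesgue \<Otimes>\<^sub>M lebesgue)"
      by (simp add: k_def split_beta' mult.assoc)
    then show ?thesis by (rule sigma_finite_measure.borel_measurable_nn_integral[OF sigma_finite_lebesgue])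
  qed
  have "ennreal (coulomb_form \<rho> (\<lambda>x. a' x * a' x) (\<lambda>x. b' x * b' x)) \<le> (\<integral>\<^sup>+x. liminf (\<lambda>n. \<integral>\<^sup>+y. k n x y \<partial>lebesgue) \<partial>lebesgue)"
    unfolding Coulomb_pair_eq[OF a(2) b(2), symmetric] using inner by (rule nn_integral_mono_AE)
  also have "\<dots> \<le> liminf (\<lambda>n. \<integral>\<^sup>+x. \<integral>\<^sup>+y. k n x y \<partial>lebesgue \<partial>lebesgue)"
    by (rule nn_integral_liminf) (rule km)
  finally show ?thesis unfolding k_def Coulomb_pair_eq[OF a(1) b(1)] .
qed

lemma Coulomb_energy_le:
  assumes u: "u \<in> H1"
  shows "enn2real (Coulomb_energy \<rho> u) \<le> R * (R * newton_const) * (H1_sq u)\<^sup>2" "Coulomb_energy \<rho> u < \<infinity>"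
proof -
  let ?D = "coulomb_form \<rho> (\<lambda>x. u x * u x) (\<lambda>x. u x * u x)"
  have D: "enn2real (Coulomb_energy \<rho> u) = ?D" using coulomb_form_nonneg[OF u u] by (simp add: Coulomb_energy_eq[OF u])
  note m = W11loc_measurable(1)[OF H1_W11loc[OF u]]
  have l2: "(\<integral>\<^sup>+x. ennreal ((u x)\<^sup>2) \<partial>lebesgue) \<le> ennreal (H1_sq u)"
    using H1_energy_ge(1)[OF H1_W11loc[OF u]] H1_sq_eq_norm[OF u] by simp
  show "Coulomb_energy \<rho> u < \<infinity>" by (simp add: Coulomb_energy_eq[OF u])
  show "enn2real (Coulomb_energy \<rho> u) \<le> R * (R * newton_const) * (H1_sq u)\<^sup>2"
  \<comment> \<open>The potential bound is used with K equal to the \<open>H1\<close> norm and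
    requires K > 0, so the null case is separate.\<close>
  proof (cases "H1_sq u = 0")
    case True
    then have "(\<integral>\<^sup>+x. ennreal ((u x)\<^sup>2) \<partial>lebesgue) = 0" using l2 by simp
    then have "AE x in lebesgue. u x = 0" using m by (subst (asm) nn_integral_0_iff_AE) auto
    then have "?D = 0" unfolding coulomb_form_def by (intro integral_eq_zero_AE) auto
    then show ?thesis using D True by simp
  next
    case False
    then have K: "0 < sqrt (H1_sq u)" by (simp add: less_le)
    have "(LINT x|lebesgue. \<bar>u x * u x\<bar>) \<le> H1_sq u"
    proof -
      have "(LINT x|lebesgue. \<bar>u x * u x\<bar>) = enn2real (\<integral>\<^sup>+x. ennreal ((u x)\<^sup>2) \<partial>lebesgue)"
        using m by (subst integral_eq_nn_integral) (auto simp: power2_eq_square)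
      also have "\<dots> \<le> enn2real (ennreal (H1_sq u))" by (rule enn2real_mono[OF l2]) simp
      finally show ?thesis by simp
    qed
    then have "R * (R * newton_const * (sqrt (H1_sq u))\<^sup>2) * (LINT x|lebesgue. \<bar>u x * u x\<bar>) \<le> R * (R * newton_const * (sqrt (H1_sq u))\<^sup>2) * H1_sq u"
      using R_nonneg newton_const_nonneg by (intro mult_left_mono) auto
    moreover have "?D \<le> R * (R * newton_const * (sqrt (H1_sq u))\<^sup>2) * (LINT x|lebesgue. \<bar>u x * u x\<bar>)"
      using coulomb_form_bound(2)[OF u u u u K H1_energy_le_sqrt[OF u] H1_energy_le_sqrt[OF u]] by simp
    ultimately show ?thesis unfolding D by (simp add: power2_eq_square mult_ac)
  qed
qed

lemma potential_lincomb3: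
  assumes v: "v \<in> H1" and h: "h \<in> H1"
  shows "potential \<rho> (\<lambda>y. (v y + t * h y) * (v y + t * h y)) x
    = potential \<rho> (\<lambda>y. v y * v y) x + 2 * t * potential \<rho> (\<lambda>y. v y * h y) x + t\<^sup>2 * potential \<rho> (\<lambda>y. h y * h y) x"
proof -
  note i = integrable_potential_product[OF v v, of x] integrable_potential_product[OF v h, of x] integrable_potential_product[OF h h, of x]
  have "potential \<rho> (\<lambda>y. (v y + t * h y) * (v y + t * h y)) x
     = (LINT y|lebesgue. v y * v y * \<rho> y / norm (x - y) + (2 * t) * (v y * h y * \<rho> y / norm (x - y)) + t\<^sup>2 * (h y * h y * \<rho> y / norm (x - y)))"
    unfolding potential_def by (intro Bochner_Integration.integral_cong refl) (simp add: power2_eq_square add_divide_distrib algebra_simps)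
  also have "\<dots> = (LINT y|lebesgue. v y * v y * \<rho> y / norm (x - y)) + (2 * t) * (LINT y|lebesgue. v y * h y * \<rho> y / norm (x - y)) + t\<^sup>2 * (LINT y|lebesgue. h y * h y * \<rho> y / norm (x - y))"
    using i by (simp only: Bochner_Integration.integral_add integrable_mult_right Bochner_Integration.integrable_add integral_mult_right_zero)
  finally show ?thesis by (simp add: potential_def)
qed

text \<open>A polynomial of degree 4 in t. Only the linear coefficient enters the derivative, so the
  higher ones are left existential; symmetry of the form produces the factor 4.\<close>

lemma coulomb_form_expand:
  assumes v: "v \<in> H1" and h: "h \<in> H1"
  obtains c2 c3 c4 where "\<And>t. coulomb_form \<rho> (\<lambda>x. (v x + t * h x) * (v x + t * h x)) (\<lambda>x. (v x + t * h x) * (v x + t * h x))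
    = coulomb_form \<rho> (\<lambda>x. v x * v x) (\<lambda>x. v x * v x) + 4 * t * coulomb_form \<rho> (\<lambda>x. v x * h x) (\<lambda>x. v x * v x)
      + t\<^sup>2 * (c2 + t * c3 + t\<^sup>2 * c4)"
proof -
  define A :: "nat \<Rightarrow> R3 \<Rightarrow> real" where "A i x = (if i = 0 then v x * v x else if i = 1 then v x * h x else h x * h x)" for i x
  define J where "J i j = coulomb_form \<rho> (A i) (A j)" for i j
  have A: "A 0 = (\<lambda>x. v x * v x)" "A (Suc 0) = (\<lambda>x. v x * h x)" "A 2 = (\<lambda>x. h x * h x)" by (auto simp: A_def)
  have "integrable lebesgue (\<lambda>x. A i x * \<rho> x * potential \<rho> (A j) x)" if "i \<in> {0,1,2}" "j \<in> {0,1,2}" for i j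
    using that by (auto simp: A coulomb_form_bound(1)[OF v v] coulomb_form_bound(1)[OF v h] coulomb_form_bound(1)[OF h h] v h)
  then have i: "integrable lebesgue (\<lambda>x. c * (A i x * \<rho> x * potential \<rho> (A j) x))" if "i \<in> {0,1,2}" "j \<in> {0,1,2}" for i j c
    using that by (intro integrable_mult_right) auto
  \<comment> \<open>The coefficients of v^2, v h and h^2 in (v + t h)^2.\<close>
  define c where "c t i = (if i = 0 then 1 else if i = 1 then 2 * t else t\<^sup>2)" for t :: real and i :: nat
  let ?I = "{0, 1, 2::nat}"
  have "coulomb_form \<rho> (\<lambda>x. (v x + t * h x) * (v x + t * h x)) (\<lambda>x. (v x + t * h x) * (v x + t * h x))
     = (\<Sum>i\<in>?I. \<Sum>j\<in>?I. c t i * c t j * J i j)" for t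
  proof -
    have "coulomb_form \<rho> (\<lambda>x. (v x + t * h x) * (v x + t * h x)) (\<lambda>x. (v x + t * h x) * (v x + t * h x))
      = (LINT x|lebesgue. (\<Sum>i\<in>?I. \<Sum>j\<in>?I. c t i * c t j * (A i x * \<rho> x * potential \<rho> (A j) x)))"
      unfolding coulomb_form_def potential_lincomb3[OF v h]
      by (intro Bochner_Integration.integral_cong refl) (simp add: A c_def, simp add: power2_eq_square power4_eq_xxxx algebra_simps)
    also have "\<dots> = (\<Sum>i\<in>?I. LINT x|lebesgue. (\<Sum>j\<in>?I. c t i * c t j * (A i x * \<rho> x * potential \<rho> (A j) x)))"
      by (rule Bochner_Integration.integral_sum, rule Bochner_Integration.integrable_sum, rule i)
    also have "\<dots> = (\<Sum>i\<in>?I. \<Sum>j\<in>?I. LINT x|lebesgue. c t i * c t j * (A i x * \<rho> x * potential \<rho> (A j) x))"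
      by (intro sum.cong refl, rule Bochner_Integration.integral_sum, rule i)
    finally show ?thesis by (simp only: J_def coulomb_form_def integral_mult_right_zero)
  qed
  moreover have "J 0 1 = J 1 0" using coulomb_form_sym[OF v v v h] by (simp add: J_def A)
  ultimately show ?thesis
    by (intro that[of "J 0 2 + J 2 0 + 4 * J 1 1" "2 * J 1 2 + 2 * J 2 1" "J 2 2"])
      (simp add: c_def J_def A, simp add: power2_eq_square power4_eq_xxxx algebra_simps)
qed

end

section \<open>The derivative of the functional\<close>

lemma DERIV_abs_powr:
  assumes p: "1 < p"
  shows "((\<lambda>x::real. \<bar>x\<bar> powr p) has_field_derivative p * \<bar>a\<bar> powr (p - 2) * a) (at a)"
proof -
  consider "a > 0" | "a < 0" | "a = 0" by linarith
  then show ?thesis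
  proof cases
    case 1
    have "((\<lambda>x. x powr p) has_field_derivative p * a powr (p - 2) * a) (at a)"
    proof -
      have "a powr (p - 1) = a powr (p - 2) * a powr 1" by (simp only: powr_add[symmetric]) simp
      then show ?thesis using has_real_derivative_powr[OF 1, of p] 1 by (simp add: mult.assoc)
    qed
    then have "((\<lambda>x. \<bar>x\<bar> powr p) has_field_derivative p * a powr (p - 2) * a) (at a)"
      by (rule has_field_derivative_transform_within_open[of _ _ _ "{0<..}"]) (use 1 in auto)
    then show ?thesis using 1 by simp
  next
    case 2
    have "((\<lambda>x. (- x) powr p) has_field_derivative p * (- a) powr (p - 2) * a) (at a)"
    proof -
      have "(- a) powr (p - 1) = (- a) powr (p - 2) * (- a) powr 1" by (simp only: powr_add[symmetric]) simp
      moreover have "((\<lambda>x. (- x) powr p) has_field_derivative (p * (- a) powr (p - 1)) * (- 1)) (at a)"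
        by (rule DERIV_chain2[OF has_real_derivative_powr]) (use 2 in \<open>auto intro!: derivative_eq_intros\<close>)
      ultimately show ?thesis using 2 by (simp add: mult.assoc)
    qed
    then have "((\<lambda>x. \<bar>x\<bar> powr p) has_field_derivative p * (- a) powr (p - 2) * a) (at a)"
      by (rule has_field_derivative_transform_within_open[of _ _ _ "{..<0}"]) (use 2 in auto)
    then show ?thesis using 2 by simp
  next
    case 3
    have "((\<lambda>h::real. \<bar>h\<bar> powr (p - 1)) \<longlongrightarrow> \<bar>0\<bar> powr (p - 1)) (at 0)"
      using p by (intro tendsto_powr' tendsto_intros) auto
    then have l: "((\<lambda>h::real. \<bar>h\<bar> powr (p - 1)) \<longlongrightarrow> 0) (at 0)" by simp
    have "\<forall>\<^sub>F h in at 0. norm (\<bar>h\<bar> powr p / h) \<le> \<bar>h\<bar> powr (p - 1)"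
      unfolding eventually_at_filter
    proof (intro always_eventually allI impI)
      fix h :: real assume "h \<noteq> 0"
      have "\<bar>h\<bar> powr p = \<bar>h\<bar> powr (p - 1) * \<bar>h\<bar> powr 1" by (simp only: powr_add[symmetric]) simp
      then show "norm (\<bar>h\<bar> powr p / h) \<le> \<bar>h\<bar> powr (p - 1)" using \<open>h \<noteq> 0\<close> by (simp add: abs_mult)
    qed
    then have "((\<lambda>h::real. \<bar>h\<bar> powr p / h) \<longlongrightarrow> 0) (at 0)" using l by (rule Lim_null_comparison)
    then show ?thesis using 3 by (simp add: DERIV_def)
  qed
qed

text \<open>Mean value theorem. For 0 < s <= 1 the intermediate point stays below |a| + |b|, which
  gives a difference quotient bound independent of s.\<close>

lemma abs_powr_diff_le:
  fixes a b :: real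
  assumes p: "1 < p" and s: "0 < s" "s \<le> 1"
  shows "\<bar>\<bar>a + s * b\<bar> powr p - \<bar>a\<bar> powr p\<bar> \<le> s * (p * (\<bar>a\<bar> + \<bar>b\<bar>) powr p)"
proof -
  have der: "((\<lambda>t. \<bar>a + t * b\<bar> powr p) has_field_derivative (p * \<bar>a + t * b\<bar> powr (p - 2) * (a + t * b)) * b) (at t)" for t
    by (rule DERIV_chain2[OF DERIV_abs_powr[OF p]]) (auto intro!: derivative_eq_intros)
  obtain z where z: "0 < z" "z < s" "\<bar>a + s * b\<bar> powr p - \<bar>a + 0 * b\<bar> powr p = (s - 0) * ((p * \<bar>a + z * b\<bar> powr (p - 2) * (a + z * b)) * b)"
    using MVT2[OF s(1), of "\<lambda>t. \<bar>a + t * b\<bar> powr p" "\<lambda>t. (p * \<bar>a + t * b\<bar> powr (p - 2) * (a + t * b)) * b", OF der] by blast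
  define y where "y = \<bar>a + z * b\<bar>"
  have "\<bar>z * b\<bar> \<le> \<bar>b\<bar>" using z s by (simp add: abs_mult mult_left_le_one_le)
  then have y: "0 \<le> y" "y \<le> \<bar>a\<bar> + \<bar>b\<bar>" unfolding y_def by linarith+
  have "\<bar>(p * \<bar>a + z * b\<bar> powr (p - 2) * (a + z * b)) * b\<bar> = p * (y powr (p - 2) * y * \<bar>b\<bar>)"
    using p by (simp add: abs_mult y_def)
  also have "y powr (p - 2) * y = y powr (p - 1)"
  proof (cases "y = 0")
    case False
    have "y powr (p - 1) = y powr (p - 2) * y powr 1" by (simp only: powr_add[symmetric]) simp
    then show ?thesis using y(1) by simp
  qed simp
  also have "y powr (p - 1) * \<bar>b\<bar> \<le> (\<bar>a\<bar> + \<bar>b\<bar>) powr (p - 1) * (\<bar>a\<bar> + \<bar>b\<bar>)"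
    using y p by (intro mult_mono powr_mono2) auto
  also have "(\<bar>a\<bar> + \<bar>b\<bar>) powr (p - 1) * (\<bar>a\<bar> + \<bar>b\<bar>) = (\<bar>a\<bar> + \<bar>b\<bar>) powr p"
  proof -
    have "(\<bar>a\<bar> + \<bar>b\<bar>) powr p = (\<bar>a\<bar> + \<bar>b\<bar>) powr (p - 1) * (\<bar>a\<bar> + \<bar>b\<bar>) powr 1" by (simp only: powr_add[symmetric]) simp
    then show ?thesis by simp
  qed
  finally have "\<bar>(p * \<bar>a + z * b\<bar> powr (p - 2) * (a + z * b)) * b\<bar> \<le> p * (\<bar>a\<bar> + \<bar>b\<bar>) powr p" using p by simp
  then have "s * \<bar>(p * \<bar>a + z * b\<bar> powr (p - 2) * (a + z * b)) * b\<bar> \<le> s * (p * (\<bar>a\<bar> + \<bar>b\<bar>) powr p)"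
    using s by (intro mult_left_mono) auto
  moreover have "\<bar>\<bar>a + s * b\<bar> powr p - \<bar>a\<bar> powr p\<bar> = s * \<bar>(p * \<bar>a + z * b\<bar> powr (p - 2) * (a + z * b)) * b\<bar>"
    using z(3) s(1) by (simp add: abs_mult)
  ultimately show ?thesis by simp
qed

lemma powr_add_le:
  fixes a b :: real
  assumes "0 \<le> p"
  shows "(\<bar>a\<bar> + \<bar>b\<bar>) powr p \<le> 2 powr p * (\<bar>a\<bar> powr p + \<bar>b\<bar> powr p)"
proof -
  have "(\<bar>a\<bar> + \<bar>b\<bar>) powr p \<le> (2 * max \<bar>a\<bar> \<bar>b\<bar>) powr p" using assms by (intro powr_mono2) auto
  also have "\<dots> = 2 powr p * (max \<bar>a\<bar> \<bar>b\<bar>) powr p" by (simp add: powr_mult)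
  also have "(max \<bar>a\<bar> \<bar>b\<bar>) powr p \<le> \<bar>a\<bar> powr p + \<bar>b\<bar> powr p" by (simp add: max_def)
  finally show ?thesis by simp
qed

text \<open>Dominated convergence with the majorant from \<open>abs_powr_diff_le\<close>. The steps
  1/(n+1) suffice, as the formula is compared with a derivative that is given to exist.\<close>

lemma Lp_directional_derivative:
  assumes p: "1 < p" and [measurable]: "v \<in> borel_measurable M" "h \<in> borel_measurable M"
    and i: "integrable M (\<lambda>x. \<bar>v x\<bar> powr p)" "integrable M (\<lambda>x. \<bar>h x\<bar> powr p)"
  shows "(\<lambda>n. ((LINT x|M. \<bar>v x + 1 / real (Suc n) * h x\<bar> powr p) - (LINT x|M. \<bar>v x\<bar> powr p)) * real (Suc n))
    \<longlonglongrightarrow> p * (LINT x|M. \<bar>v x\<bar> powr (p - 2) * v x * h x)"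
proof -
  define s where "s n = 1 / real (Suc n)" for n
  have s: "0 < s n" "s n \<le> 1" for n by (auto simp: s_def)
  have s0: "s \<longlonglongrightarrow> 0" unfolding s_def using LIMSEQ_inverse_real_of_nat by (simp add: inverse_eq_divide)
  define B where "B x = p * (2 powr p * (\<bar>v x\<bar> powr p + \<bar>h x\<bar> powr p))" for x
  have B: "integrable M B" unfolding B_def by (intro integrable_mult_right Bochner_Integration.integrable_add i)
  define f where "f n x = (\<bar>v x + s n * h x\<bar> powr p - \<bar>v x\<bar> powr p) * real (Suc n)" for n x
  have bnd: "norm (f n x) \<le> B x" for n x
  proof -
    have "\<bar>\<bar>v x + s n * h x\<bar> powr p - \<bar>v x\<bar> powr p\<bar> \<le> s n * (p * (\<bar>v x\<bar> + \<bar>h x\<bar>) powr p)"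
      by (rule abs_powr_diff_le[OF p s])
    also have "\<dots> \<le> s n * B x"
      unfolding B_def using powr_add_le[of p "v x" "h x"] p s[of n] by (intro mult_left_mono) auto
    finally have "\<bar>\<bar>v x + s n * h x\<bar> powr p - \<bar>v x\<bar> powr p\<bar> * real (Suc n) \<le> s n * B x * real (Suc n)"
      by (rule mult_right_mono) simp
    also have "s n * B x * real (Suc n) = B x" by (simp add: s_def field_simps)
    finally show ?thesis by (simp add: f_def abs_mult)
  qed
  have fm: "f n \<in> borel_measurable M" for n unfolding f_def by measurable
  have fi: "integrable M (f n)" for n
    by (rule Bochner_Integration.integrable_bound[OF B fm]) (use bnd in \<open>auto intro: order_trans[OF _ abs_ge_self]\<close>)
  have vi: "integrable M (\<lambda>x. \<bar>v x + s n * h x\<bar> powr p)" for n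
  proof -
    have "integrable M (\<lambda>x. s n * f n x + \<bar>v x\<bar> powr p)" using fi i by simp
    moreover have "s n * f n x + \<bar>v x\<bar> powr p = \<bar>v x + s n * h x\<bar> powr p" for x by (simp add: f_def s_def)
    ultimately show ?thesis by simp
  qed
  have lim: "(\<lambda>n. f n x) \<longlonglongrightarrow> p * (\<bar>v x\<bar> powr (p - 2) * v x * h x)" for x
  proof -
    have "((\<lambda>t. \<bar>v x + t * h x\<bar> powr p) has_field_derivative (p * \<bar>v x + 0 * h x\<bar> powr (p - 2) * (v x + 0 * h x)) * h x) (at 0)"
      by (rule DERIV_chain2[OF DERIV_abs_powr[OF p]]) (auto intro!: derivative_eq_intros)
    then have "((\<lambda>t. (\<bar>v x + t * h x\<bar> powr p - \<bar>v x\<bar> powr p) / t) \<longlongrightarrow> p * (\<bar>v x\<bar> powr (p - 2) * v x * h x)) (at 0)"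
      by (simp add: DERIV_def mult.assoc)
    moreover have "filterlim s (at 0) sequentially"
      using s0 by (simp add: filterlim_at s_def)
    ultimately have "(\<lambda>n. (\<bar>v x + s n * h x\<bar> powr p - \<bar>v x\<bar> powr p) / s n) \<longlonglongrightarrow> p * (\<bar>v x\<bar> powr (p - 2) * v x * h x)"
      by (rule filterlim_compose)
    moreover have "f n x = (\<bar>v x + s n * h x\<bar> powr p - \<bar>v x\<bar> powr p) / s n" for n
      by (simp add: f_def s_def)
    ultimately show ?thesis by simp
  qed
  have "(\<lambda>n. LINT x|M. f n x) \<longlonglongrightarrow> (LINT x|M. p * (\<bar>v x\<bar> powr (p - 2) * v x * h x))"
    by (rule integral_dominated_convergence[where w = B]) (use B fm lim bnd in auto)
  moreover have "(LINT x|M. f n x) = ((LINT x|M. \<bar>v x + s n * h x\<bar> powr p) - (LINT x|M. \<bar>v x\<bar> powr p)) * real (Suc n)" for n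
    unfolding f_def integral_mult_left_zero by (subst Bochner_Integration.integral_diff[OF vi i(1)]) simp
  ultimately show ?thesis by (simp add: s_def)
qed

lemma integrable_H1_powr:
  assumes u: "u \<in> H1" and p: "2 \<le> p" "p < 6"
  shows "integrable lebesgue (\<lambda>x. \<bar>u x\<bar> powr p)"
proof -
  note [measurable] = W11loc_measurable(1)[OF H1_W11loc[OF u]]
  obtain K where K: "0 < K" "H1_energy u \<le> ennreal (K\<^sup>2)"
    using ennreal_finite_square_bound[OF H1_finite[OF u]] by blast
  show ?thesis
  proof (rule integrableI_nonneg)
    show "(\<integral>\<^sup>+x. ennreal (\<bar>u x\<bar> powr p) \<partial>lebesgue) < \<infinity>"
      using sobolev_inequality[OF H1_W11loc[OF u] K p] by (simp add: le_less_trans)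
    show "(\<lambda>x. \<bar>u x\<bar> powr p) \<in> borel_measurable lebesgue" by measurable
  qed simp
qed

lemma H1_sq_scale: "u \<in> H1 \<Longrightarrow> H1_sq (\<lambda>x. c * u x) = c\<^sup>2 * H1_sq u"
proof -
  assume u: "u \<in> H1"
  have c: "(\<lambda>x. c * u x) \<in> H1" using H1_lincomb[OF u u, of c 0] by simp
  have "H1_ip (\<lambda>x. c * u x) (\<lambda>x. c * u x) = c * H1_ip u (\<lambda>x. c * u x)"
    using H1.ip_lincomb[OF u u c, of c 0] by simp
  also have "H1_ip u (\<lambda>x. c * u x) = c * H1_ip u u"
    using H1.ip_lincomb_right[OF u u u, of c 0] by simp
  finally show ?thesis using H1_ip_self[OF c] H1_ip_self[OF u] by (simp add: power2_eq_square)
qed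

lemma H1_sq_add: 
  assumes u: "u \<in> H1" and h: "h \<in> H1"
  shows "H1_sq (\<lambda>x. u x + t * h x) = H1_sq u + 2 * t * H1_ip u h + t\<^sup>2 * H1_sq h"
proof -
  have w: "(\<lambda>x. u x + t * h x) \<in> H1" using H1_lincomb[OF u h, of 1 t] by simp
  have "H1_ip (\<lambda>x. u x + t * h x) (\<lambda>x. u x + t * h x) = H1_ip u (\<lambda>x. u x + t * h x) + t * H1_ip h (\<lambda>x. u x + t * h x)"
    using H1.ip_lincomb[OF u h w, of 1 t] by simp
  also have "\<dots> = H1_ip u u + t * H1_ip u h + t * (H1_ip h u + t * H1_ip h h)"
    using H1.ip_lincomb_right[OF u h u, of 1 t] H1.ip_lincomb_right[OF u h h, of 1 t] by simp
  also have "H1_ip h u = H1_ip u h" by (rule H1.ip_sym[OF h u])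
  finally show ?thesis using H1_ip_self[OF w] H1_ip_self[OF u] H1_ip_self[OF h] by (simp add: power2_eq_square algebra_simps)
qed

section \<open>The space \<open>E\<close>, its dual and the derivative of the functional in terms of
  \<open>H1\<close>\<close>

context bounded_density
begin

abbreviation "D_form u \<equiv> coulomb_form \<rho> (\<lambda>x. u x * u x) (\<lambda>x. u x * u x)"

lemma E_space_eq: "E_space \<rho> = H1"
  unfolding E_space_def using Coulomb_energy_le(2) by (auto simp: H1_def)

definition norm_const :: "real \<Rightarrow> real" where
  "norm_const lam = sqrt (1 + lam * sqrt (R * (R * newton_const)))"

lemma norm_const_ge: "0 < lam \<Longrightarrow> 1 \<le> norm_const lam"
  using R_nonneg newton_const_nonneg by (simp add: norm_const_def)

lemma E_norm_bounds:
  assumes lam: "0 < lam" and u: "u \<in> H1"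
  shows "sqrt (H1_sq u) \<le> E_norm \<rho> lam u" "E_norm \<rho> lam u \<le> norm_const lam * sqrt (H1_sq u)"
proof -
  show "sqrt (H1_sq u) \<le> E_norm \<rho> lam u"
    using lam unfolding E_norm_def by (intro real_sqrt_le_mono) simp
  have "sqrt (enn2real (Coulomb_energy \<rho> u)) \<le> sqrt (R * (R * newton_const) * (H1_sq u)\<^sup>2)"
    by (rule real_sqrt_le_mono[OF Coulomb_energy_le(1)[OF u]])
  also have "\<dots> = sqrt (R * (R * newton_const)) * H1_sq u" by (simp add: real_sqrt_mult)
  finally have "H1_sq u + lam * sqrt (enn2real (Coulomb_energy \<rho> u)) \<le> (1 + lam * sqrt (R * (R * newton_const))) * H1_sq u"
    using mult_left_mono[OF _ less_imp_le[OF lam]] by (fastforce simp: algebra_simps)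
  then show "E_norm \<rho> lam u \<le> norm_const lam * sqrt (H1_sq u)"
    unfolding E_norm_def norm_const_def real_sqrt_mult[symmetric] by (rule real_sqrt_le_mono)
qed

lemma E_norm_nonneg: "0 < lam \<Longrightarrow> u \<in> H1 \<Longrightarrow> 0 \<le> E_norm \<rho> lam u"
  by (rule order_trans[OF _ E_norm_bounds(1)]) auto

text \<open>Equivalent norms have the same bounded functionals; hence weak limits in
  \<open>E\<close> are exactly weak limits in \<open>H1\<close>.\<close>

lemma E_dual_iff: "0 < lam \<Longrightarrow> F \<in> E_dual \<rho> lam \<longleftrightarrow> H1.bounded_functional F"
proof
  assume lam: "0 < lam" and F: "F \<in> E_dual \<rho> lam"
  obtain C where C: "\<And>u. u \<in> H1 \<Longrightarrow> \<bar>F u\<bar> \<le> C * E_norm \<rho> lam u"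
    using F unfolding E_dual_def E_space_eq by blast
  have "\<bar>F u\<bar> \<le> (\<bar>C\<bar> * norm_const lam) * sqrt (H1_ip u u)" if u: "u \<in> H1" for u
  proof -
    have "C * E_norm \<rho> lam u \<le> \<bar>C\<bar> * (norm_const lam * sqrt (H1_sq u))"
      using E_norm_bounds(2)[OF lam u] E_norm_nonneg[OF lam u] by (intro mult_mono) auto
    then show ?thesis using C[OF u] by (simp add: H1_ip_self[OF u] mult.assoc)
  qed
  then show "H1.bounded_functional F"
    using F unfolding E_dual_def E_space_eq H1.bounded_functional_def by blast
next
  assume lam: "0 < lam" and F: "H1.bounded_functional F"
  obtain C where C: "\<And>u. u \<in> H1 \<Longrightarrow> \<bar>F u\<bar> \<le> C * sqrt (H1_ip u u)"
    using F unfolding H1.bounded_functional_def by blast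
  have "\<bar>F u\<bar> \<le> \<bar>C\<bar> * E_norm \<rho> lam u" if u: "u \<in> H1" for u
  proof -
    have "C * sqrt (H1_sq u) \<le> \<bar>C\<bar> * E_norm \<rho> lam u"
      using E_norm_bounds(1)[OF lam u] by (intro mult_mono) auto
    then show ?thesis using C[OF u] by (simp add: H1_ip_self[OF u])
  qed
  then show "F \<in> E_dual \<rho> lam"
    using F unfolding E_dual_def E_space_eq H1.bounded_functional_def by blast
qed

text \<open>Test the supremum with u / B. A positive upper bound \<open>B\<close> replaces the norm
  itself, which may vanish, and boundedness of the functional makes the real supremum
  meaningful.\<close>

lemma E_dual_norm_bound:
  assumes lam: "0 < lam" and F: "F \<in> E_dual \<rho> lam" and u: "u \<in> H1" and B: "0 < B" "norm_const lam * sqrt (H1_sq u) \<le> B"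
  shows "\<bar>F u\<bar> \<le> B * E_dual_norm \<rho> lam F"
proof -
  obtain C where C: "\<And>u. u \<in> H1 \<Longrightarrow> \<bar>F u\<bar> \<le> C * E_norm \<rho> lam u"
    using F unfolding E_dual_def E_space_eq by blast
  define w where "w = (\<lambda>x. 1 / B * u x)"
  have w: "w \<in> H1" using H1_lincomb[OF u u, of "1 / B" 0] by (simp add: w_def)
  have "E_norm \<rho> lam w \<le> norm_const lam * sqrt (H1_sq w)" by (rule E_norm_bounds(2)[OF lam w])
  also have "\<dots> = norm_const lam * sqrt (H1_sq u) / B"
    unfolding w_def H1_sq_scale[OF u] using B(1) by (simp add: real_sqrt_mult power_divide real_sqrt_divide)
  also have "\<dots> \<le> 1" using B by simp
  finally have "w \<in> {u \<in> E_space \<rho>. E_norm \<rho> lam u \<le> 1}" using w by (simp add: E_space_eq)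
  moreover have "bdd_above ((\<lambda>u. \<bar>F u\<bar>) ` {u \<in> E_space \<rho>. E_norm \<rho> lam u \<le> 1})"
  proof (rule bdd_aboveI2)
    fix u assume "u \<in> {u \<in> E_space \<rho>. E_norm \<rho> lam u \<le> 1}"
    then have u: "u \<in> H1" "E_norm \<rho> lam u \<le> 1" by (auto simp: E_space_eq)
    have "C * E_norm \<rho> lam u \<le> \<bar>C\<bar> * 1" using u E_norm_nonneg[OF lam u(1)] by (intro mult_mono) auto
    then show "\<bar>F u\<bar> \<le> \<bar>C\<bar>" using C[OF u(1)] by simp
  qed
  ultimately have "\<bar>F w\<bar> \<le> E_dual_norm \<rho> lam F"
    unfolding E_dual_norm_def by (rule cSUP_upper)
  moreover have "F w = 1 / B * F u"
    using H1.functional_lincomb[OF F[unfolded E_dual_iff[OF lam]] u u, of "1 / B" 0] by (simp add: w_def)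
  ultimately show ?thesis using B(1) by (simp add: abs_mult field_simps)
qed

lemma I_fun_eq:
  "u \<in> H1 \<Longrightarrow> I_fun \<rho> q lam u = 1 / 2 * H1_sq u + lam\<^sup>2 / 4 * (D_form u / omega) - 1 / (q + 1) * (LINT x|lebesgue. \<bar>u x\<bar> powr (q + 1))"
  unfolding I_fun_def by (simp add: Coulomb_energy_eq coulomb_form_nonneg)

text \<open>The difference quotients with steps 1/(n+1) have two limits: F h, by the Frechet
  property, and the explicit expression, from the quadratic expansion of the norm, the quartic
  expansion of the Coulomb energy and the derivative of the power term.\<close>

lemma E_derivative_formula:
  assumes lam: "0 < lam" and q: "3 < q" "q < 5" and v: "v \<in> H1" and h: "h \<in> H1"
    and F: "has_E_derivative \<rho> q lam v F"
  shows "F h = H1_ip v h + lam\<^sup>2 / omega * coulomb_form \<rho> (\<lambda>x. v x * h x) (\<lambda>x. v x * v x)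
    - (LINT x|lebesgue. \<bar>v x\<bar> powr (q - 1) * v x * h x)"
proof -
  define s where "s n = 1 / real (Suc n)" for n
  have s: "0 < s n" "s n * real (Suc n) = 1" for n by (auto simp: s_def)
  have s0: "s \<longlonglongrightarrow> 0" unfolding s_def using LIMSEQ_inverse_real_of_nat by (simp add: inverse_eq_divide)
  have vs: "(\<lambda>x. v x + s n * h x) \<in> H1" for n using H1_lincomb[OF v h, of 1 "s n"] by simp
  have hs: "(\<lambda>x. s n * h x) \<in> H1" for n using H1_lincomb[OF h h, of "s n" 0] by simp
  have Fd: "F \<in> E_dual \<rho> lam" using F by (simp add: has_E_derivative_def)
  have Fs: "F (\<lambda>x. s n * h x) = s n * F h" for n
    using H1.functional_lincomb[OF Fd[unfolded E_dual_iff[OF lam]] h h, of "s n" 0] by simp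
  let ?I = "I_fun \<rho> q lam"
  let ?N = "norm_const lam * sqrt (H1_sq h)"
  have Nn: "0 \<le> ?N" using norm_const_ge[OF lam] by simp
  have En: "E_norm \<rho> lam (\<lambda>x. s n * h x) \<le> s n * ?N" for n
    using E_norm_bounds(2)[OF lam hs[of n]] s(1)[of n] unfolding H1_sq_scale[OF h] by (simp add: real_sqrt_mult mult_ac)
  have 1: "(\<lambda>n. (?I (\<lambda>x. v x + s n * h x) - ?I v) * real (Suc n)) \<longlonglongrightarrow> F h"
  proof (rule LIMSEQ_I)
    fix e :: real assume e: "0 < e"
    define e' where "e' = e / (2 * (?N + 1))"
    have e': "0 < e'" using e Nn by (simp add: e'_def)
    obtain d where d: "0 < d" "\<And>k. k \<in> H1 \<Longrightarrow> E_norm \<rho> lam k < d \<Longrightarrow> \<bar>?I (\<lambda>x. v x + k x) - ?I v - F k\<bar> \<le> e' * E_norm \<rho> lam k"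
      using F e' unfolding has_E_derivative_def E_space_eq by blast
    have "(\<lambda>n. s n * ?N) \<longlonglongrightarrow> 0 * ?N" by (intro tendsto_mult s0 tendsto_const)
    then have "\<forall>\<^sub>F n in sequentially. s n * ?N < d" using d(1) by (intro order_tendstoD(2)) auto
    then obtain N where N: "\<And>n. N \<le> n \<Longrightarrow> s n * ?N < d" by (auto simp: eventually_sequentially)
    have "norm ((?I (\<lambda>x. v x + s n * h x) - ?I v) * real (Suc n) - F h) < e" if "N \<le> n" for n
    proof -
      have "\<bar>?I (\<lambda>x. v x + s n * h x) - ?I v - s n * F h\<bar> \<le> e' * E_norm \<rho> lam (\<lambda>x. s n * h x)"
        using d(2)[OF hs[of n] le_less_trans[OF En N[OF that]]] by (simp add: Fs)
      also have "\<dots> \<le> e' * (s n * ?N)" using En e' by (intro mult_left_mono) auto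
      finally have "\<bar>?I (\<lambda>x. v x + s n * h x) - ?I v - s n * F h\<bar> * real (Suc n) \<le> e' * (s n * ?N) * real (Suc n)"
        by (rule mult_right_mono) simp
      also have "e' * (s n * ?N) * real (Suc n) = e' * ?N * (s n * real (Suc n))" by (simp only: mult_ac)
      also have "\<dots> < e"
      proof -
        have "e' * ?N \<le> e' * (?N + 1)" using e' by simp
        also have "e' * (?N + 1) = e / 2" using Nn by (simp add: e'_def field_simps)
        finally show ?thesis using e by (simp add: s del: of_nat_Suc)
      qed
      also have "\<bar>?I (\<lambda>x. v x + s n * h x) - ?I v - s n * F h\<bar> * real (Suc n) = norm ((?I (\<lambda>x. v x + s n * h x) - ?I v - s n * F h) * real (Suc n))"
        by (simp add: abs_mult)
      also have "(?I (\<lambda>x. v x + s n * h x) - ?I v - s n * F h) * real (Suc n) = (?I (\<lambda>x. v x + s n * h x) - ?I v) * real (Suc n) - F h * (s n * real (Suc n))"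
        by (simp add: algebra_simps)
      finally show ?thesis by (simp only: s mult_1_right)
    qed
    then show "\<exists>no. \<forall>n\<ge>no. norm ((?I (\<lambda>x. v x + s n * h x) - ?I v) * real (Suc n) - F h) < e" by blast
  qed
  obtain c2 c3 c4 where c: "\<And>t. D_form (\<lambda>x. v x + t * h x) = D_form v + 4 * t * coulomb_form \<rho> (\<lambda>x. v x * h x) (\<lambda>x. v x * v x) + t\<^sup>2 * (c2 + t * c3 + t\<^sup>2 * c4)"
    by (rule coulomb_form_expand[OF v h]) blast
  define J where "J = coulomb_form \<rho> (\<lambda>x. v x * h x) (\<lambda>x. v x * v x)"
  define Lp where "Lp n = ((LINT x|lebesgue. \<bar>v x + s n * h x\<bar> powr (q + 1)) - (LINT x|lebesgue. \<bar>v x\<bar> powr (q + 1))) * real (Suc n)" for n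
  have "(\<lambda>n. Lp n) \<longlonglongrightarrow> (q + 1) * (LINT x|lebesgue. \<bar>v x\<bar> powr (q + 1 - 2) * v x * h x)"
    unfolding Lp_def s_def using q
    by (intro Lp_directional_derivative W11loc_measurable(1) H1_W11loc v h integrable_H1_powr) auto
  then have Lp: "Lp \<longlonglongrightarrow> (q + 1) * (LINT x|lebesgue. \<bar>v x\<bar> powr (q - 1) * v x * h x)" by simp
  have "(?I (\<lambda>x. v x + s n * h x) - ?I v) * real (Suc n)
    = (H1_ip v h + s n * H1_sq h / 2) + lam\<^sup>2 / (4 * omega) * (4 * J + s n * (c2 + s n * c3 + (s n)\<^sup>2 * c4)) - 1 / (q + 1) * Lp n" for n
  proof -
    have alg: "(a * C - b * X) * N = (a * N) * C - b * (X * N)" for a b C X N :: real by (simp add: algebra_simps)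
    have "?I (\<lambda>x. v x + s n * h x) - ?I v = s n * ((H1_ip v h + s n * H1_sq h / 2) + lam\<^sup>2 / (4 * omega) * (4 * J + s n * (c2 + s n * c3 + (s n)\<^sup>2 * c4)))
      - 1 / (q + 1) * ((LINT x|lebesgue. \<bar>v x + s n * h x\<bar> powr (q + 1)) - (LINT x|lebesgue. \<bar>v x\<bar> powr (q + 1)))"
      unfolding I_fun_eq[OF vs] I_fun_eq[OF v] H1_sq_add[OF v h] c J_def
      by (simp add: power2_eq_square omega_def algebra_simps add_divide_distrib)
    then have "(?I (\<lambda>x. v x + s n * h x) - ?I v) * real (Suc n) = (s n * real (Suc n)) * ((H1_ip v h + s n * H1_sq h / 2) + lam\<^sup>2 / (4 * omega) * (4 * J + s n * (c2 + s n * c3 + (s n)\<^sup>2 * c4)))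
      - 1 / (q + 1) * Lp n"
      unfolding Lp_def by (simp only: alg)
    then show ?thesis by (simp only: s mult_1_left)
  qed
  moreover have "(\<lambda>n. (H1_ip v h + s n * H1_sq h / 2) + lam\<^sup>2 / (4 * omega) * (4 * J + s n * (c2 + s n * c3 + (s n)\<^sup>2 * c4)) - 1 / (q + 1) * Lp n)
    \<longlonglongrightarrow> (H1_ip v h + 0 * H1_sq h / 2) + lam\<^sup>2 / (4 * omega) * (4 * J + 0 * (c2 + 0 * c3 + 0\<^sup>2 * c4)) - 1 / (q + 1) * ((q + 1) * (LINT x|lebesgue. \<bar>v x\<bar> powr (q - 1) * v x * h x))"
    by (intro tendsto_intros s0 Lp) auto
  ultimately have "(\<lambda>n. (?I (\<lambda>x. v x + s n * h x) - ?I v) * real (Suc n)) \<longlonglongrightarrow> H1_ip v h + lam\<^sup>2 / omega * J - (LINT x|lebesgue. \<bar>v x\<bar> powr (q - 1) * v x * h x)"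
    using q by simp
  from LIMSEQ_unique[OF 1 this] show ?thesis by (simp add: J_def)
qed

end

section \<open>Palais-Smale sequences\<close>

lemma H1_energy_leI: "u \<in> H1 \<Longrightarrow> H1_sq u \<le> k \<Longrightarrow> H1_energy u \<le> ennreal k"
  by (subst H1_sq_eq_norm) (auto intro: ennreal_leI)

context bounded_density
begin

section \<open>Limits of the lower-order terms tested with the weak limit\<close>

text \<open>Where |u| <= e |v_n| the integrand is at most e |v_n|^(q+1), which is absorbed by the
  bounded power integrals; elsewhere |v_n| < |u|/e and it is at most e^-q |u|^(q+1), a fixed
  integrable function. So no mass of the product can escape to infinity.\<close>

lemma integral_powr_mult_tendsto:
  assumes q: "3 < q" "q < 5" and v: "\<And>n::nat. v n \<in> H1" and u: "u \<in> H1" and K: "\<And>n. H1_sq (v n) \<le> K"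
    and lim: "AE x in lebesgue. (\<lambda>n. v n x) \<longlonglongrightarrow> u x"
  shows "(\<lambda>n. LINT x|lebesgue. \<bar>v n x\<bar> powr (q - 1) * v n x * u x) \<longlonglongrightarrow> (LINT x|lebesgue. \<bar>u x\<bar> powr (q + 1))"
proof -
  note [measurable] = W11loc_measurable(1)[OF H1_W11loc[OF v]] W11loc_measurable(1)[OF H1_W11loc[OF u]]
  define f where "f n x = \<bar>v n x\<bar> powr (q - 1) * v n x * u x" for n x
  define g where "g x = \<bar>u x\<bar> powr (q + 1)" for x
  have [measurable]: "f n \<in> borel_measurable lebesgue" "g \<in> borel_measurable lebesgue" for n
    unfolding f_def g_def by measurable
  have gi: "integrable lebesgue g" unfolding g_def using q by (intro integrable_H1_powr u) auto
  have powr_split: "\<bar>t\<bar> powr (q - 1) * \<bar>t\<bar> = \<bar>t\<bar> powr q" "\<bar>t\<bar> powr q * \<bar>t\<bar> = \<bar>t\<bar> powr (q + 1)" for t :: real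
  proof -
    have "\<bar>t\<bar> powr q = \<bar>t\<bar> powr (q - 1) * \<bar>t\<bar> powr 1" "\<bar>t\<bar> powr (q + 1) = \<bar>t\<bar> powr q * \<bar>t\<bar> powr 1"
      by (simp_all only: powr_add[symmetric]) simp
    then show "\<bar>t\<bar> powr (q - 1) * \<bar>t\<bar> = \<bar>t\<bar> powr q" "\<bar>t\<bar> powr q * \<bar>t\<bar> = \<bar>t\<bar> powr (q + 1)" by simp_all
  qed
  have fabs: "\<bar>f n x\<bar> = \<bar>v n x\<bar> powr q * \<bar>u x\<bar>" for n x
    by (simp add: f_def abs_mult powr_split)
  have young: "\<bar>f n x\<bar> \<le> e * \<bar>v n x\<bar> powr (q + 1) + e powr (- q) * g x" if e: "0 < e" for e n x
  proof (cases "\<bar>u x\<bar> \<le> e * \<bar>v n x\<bar>")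
    case True
    have "\<bar>f n x\<bar> \<le> \<bar>v n x\<bar> powr q * (e * \<bar>v n x\<bar>)" unfolding fabs using True by (intro mult_left_mono) auto
    also have "\<dots> = e * \<bar>v n x\<bar> powr (q + 1)" by (simp add: powr_split(2)[symmetric])
    finally show ?thesis by (simp add: g_def add_increasing2)
  next
    case False
    then have "\<bar>v n x\<bar> \<le> \<bar>u x\<bar> / e" using e by (simp add: field_simps)
    then have "\<bar>v n x\<bar> powr q \<le> (\<bar>u x\<bar> / e) powr q" using q by (intro powr_mono2) auto
    also have "\<dots> = e powr (- q) * \<bar>u x\<bar> powr q" using e by (simp add: powr_divide powr_minus_divide)
    finally have "\<bar>f n x\<bar> \<le> e powr (- q) * \<bar>u x\<bar> powr q * \<bar>u x\<bar>" unfolding fabs by (rule mult_right_mono) simp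
    also have "\<dots> = e powr (- q) * g x" by (simp add: g_def powr_split(2)[symmetric])
    finally show ?thesis using e by (simp add: add_increasing)
  qed
  have fi: "integrable lebesgue (f n)" for n
  proof (rule Bochner_Integration.integrable_bound)
    show "integrable lebesgue (\<lambda>x. 1 * \<bar>v n x\<bar> powr (q + 1) + 1 powr (- q) * g x)"
      using q gi by (intro Bochner_Integration.integrable_add integrable_mult_right integrable_H1_powr v) auto
    show "AE x in lebesgue. norm (f n x) \<le> norm (1 * \<bar>v n x\<bar> powr (q + 1) + 1 powr (- q) * g x)"
      using young[OF zero_less_one] by (intro AE_I2) (simp only: real_norm_def, rule order_trans[OF _ abs_ge_self])
  qed measurable
  have z: "(\<lambda>n. \<integral>\<^sup>+x. ennreal \<bar>f n x - g x\<bar> \<partial>lebesgue) \<longlonglongrightarrow> 0"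
  proof (rule nn_integral_tendsto_0_absorb[where s = "\<lambda>n x. \<bar>v n x\<bar> powr (q + 1)" and C = "sobolev_const (q + 1) * sqrt (\<bar>K\<bar> + 1) powr (q + 1)"])
    show "AE x in lebesgue. (\<lambda>n. \<bar>f n x - g x\<bar>) \<longlonglongrightarrow> 0"
      using lim
    proof eventually_elim
      fix x assume l: "(\<lambda>n. v n x) \<longlonglongrightarrow> u x"
      then have "(\<lambda>n. f n x) \<longlonglongrightarrow> \<bar>u x\<bar> powr (q - 1) * u x * u x"
        unfolding f_def using q by (intro tendsto_mult tendsto_powr' tendsto_rabs l tendsto_const) auto
      moreover have "\<bar>u x\<bar> powr (q - 1) * u x * u x = g x"
        unfolding g_def powr_split[symmetric] by (simp add: mult.assoc)
      ultimately show "(\<lambda>n. \<bar>f n x - g x\<bar>) \<longlonglongrightarrow> 0" by (simp add: tendsto_rabs_zero_iff LIM_zero_iff)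
    qed
    show "(\<integral>\<^sup>+x. ennreal (\<bar>v n x\<bar> powr (q + 1)) \<partial>lebesgue) \<le> ennreal (sobolev_const (q + 1) * sqrt (\<bar>K\<bar> + 1) powr (q + 1))" for n
    proof (rule sobolev_inequality[OF H1_W11loc[OF v]])
      have "H1_sq (v n) \<le> \<bar>K\<bar> + 1" using K[of n] by linarith
      then show "H1_energy (v n) \<le> ennreal ((sqrt (\<bar>K\<bar> + 1))\<^sup>2)"
        using H1_energy_leI[OF v] by (simp del: ennreal_plus)
    qed (use q in auto)
    show "\<exists>G. integrable lebesgue G \<and> (\<forall>n x. \<bar>f n x - g x\<bar> \<le> e * \<bar>v n x\<bar> powr (q + 1) + G x)" if e: "0 < e" for e
    proof (intro exI conjI allI)
      show "integrable lebesgue (\<lambda>x. e powr (- q) * g x + g x)" using gi by simp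
      fix n x
      have "\<bar>f n x - g x\<bar> \<le> \<bar>f n x\<bar> + g x" using abs_triangle_ineq4[of "f n x" "g x"] by (simp add: g_def)
      then show "\<bar>f n x - g x\<bar> \<le> e * \<bar>v n x\<bar> powr (q + 1) + (e powr (- q) * g x + g x)"
        using young[OF e, of n x] by linarith
    qed
  qed auto
  have "(\<lambda>n. (LINT x|lebesgue. f n x) - (LINT x|lebesgue. g x)) \<longlonglongrightarrow> 0"
  proof (rule Lim_null_comparison)
    show "(\<lambda>n. enn2real (\<integral>\<^sup>+x. ennreal \<bar>f n x - g x\<bar> \<partial>lebesgue)) \<longlonglongrightarrow> 0"
      by (rule tendsto_enn2real) (use z in simp_all)
    show "\<forall>\<^sub>F n in sequentially. norm ((LINT x|lebesgue. f n x) - (LINT x|lebesgue. g x)) \<le> enn2real (\<integral>\<^sup>+x. ennreal \<bar>f n x - g x\<bar> \<partial>lebesgue)"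
    proof (intro always_eventually allI)
      fix n
      have "norm ((LINT x|lebesgue. f n x) - (LINT x|lebesgue. g x)) = \<bar>LINT x|lebesgue. f n x - g x\<bar>"
        by (simp add: Bochner_Integration.integral_diff[OF fi gi])
      also have "\<dots> \<le> (LINT x|lebesgue. \<bar>f n x - g x\<bar>)" by (rule integral_abs_bound)
      also have "\<dots> = enn2real (\<integral>\<^sup>+x. ennreal \<bar>f n x - g x\<bar> \<partial>lebesgue)" by (rule integral_eq_nn_integral) auto
      finally show "norm ((LINT x|lebesgue. f n x) - (LINT x|lebesgue. g x)) \<le> enn2real (\<integral>\<^sup>+x. ennreal \<bar>f n x - g x\<bar> \<partial>lebesgue)" .
    qed
  qed
  then show ?thesis by (simp add: LIM_zero_iff f_def g_def)
qed

text \<open>The same dichotomy for quadratic terms: compare |u| with e |v_n - u|, the fixed factor u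
  supplying the dominating function.\<close>

lemma integral_weak_mult_tendsto_0:
  assumes v: "\<And>n::nat. v n \<in> H1" and u: "u \<in> H1" and K: "\<And>n. H1_sq (v n) \<le> K"
    and lim: "AE x in lebesgue. (\<lambda>n. v n x) \<longlonglongrightarrow> u x"
  shows "(\<lambda>n. LINT x|lebesgue. \<bar>(v n x - u x) * u x\<bar>) \<longlonglongrightarrow> 0"
proof -
  note [measurable] = W11loc_measurable(1)[OF H1_W11loc[OF v]] W11loc_measurable(1)[OF H1_W11loc[OF u]]
  have ui: "integrable lebesgue (\<lambda>x. (u x)\<^sup>2)" using integrable_H1_mult[OF u u] by (simp add: power2_eq_square)
  have "(\<lambda>n. \<integral>\<^sup>+x. ennreal \<bar>(v n x - u x) * u x\<bar> \<partial>lebesgue) \<longlonglongrightarrow> 0"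
  proof (rule nn_integral_tendsto_0_absorb[where s = "\<lambda>n x. (v n x - u x)\<^sup>2" and C = "2 * K + 2 * H1_sq u"])
    show "AE x in lebesgue. (\<lambda>n. \<bar>(v n x - u x) * u x\<bar>) \<longlonglongrightarrow> 0"
      using lim
    proof eventually_elim
      fix x assume "(\<lambda>n. v n x) \<longlonglongrightarrow> u x"
      then have "(\<lambda>n. \<bar>(v n x - u x) * u x\<bar>) \<longlonglongrightarrow> \<bar>(u x - u x) * u x\<bar>" by (intro tendsto_intros)
      then show "(\<lambda>n. \<bar>(v n x - u x) * u x\<bar>) \<longlonglongrightarrow> 0" by simp
    qed
    show "(\<integral>\<^sup>+x. ennreal ((v n x - u x)\<^sup>2) \<partial>lebesgue) \<le> ennreal (2 * K + 2 * H1_sq u)" for n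
    proof -
      have d: "(\<lambda>x. v n x - u x) \<in> H1" by (rule H1_diff[OF v u])
      have "H1_sq (\<lambda>x. v n x - u x) \<le> 2 * K + 2 * H1_sq u" using H1_sq_diff_le[OF v[of n] u] K[of n] by linarith
      then show ?thesis
        using order_trans[OF H1_energy_ge(1)[OF H1_W11loc[OF d]] H1_energy_leI[OF d]] by blast
    qed
    show "\<exists>G. integrable lebesgue G \<and> (\<forall>n x. \<bar>(v n x - u x) * u x\<bar> \<le> e * (v n x - u x)\<^sup>2 + G x)" if e: "0 < e" for e
    proof (intro exI conjI allI)
      show "integrable lebesgue (\<lambda>x. 1 / e * (u x)\<^sup>2)" using ui by simp
      fix n x
      define d where "d = \<bar>v n x - u x\<bar>"
      have "\<bar>u x\<bar> * d \<le> e * d\<^sup>2 + 1 / e * \<bar>u x\<bar>\<^sup>2"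
      proof (cases "\<bar>u x\<bar> \<le> e * d")
        case True
        have "\<bar>u x\<bar> * d \<le> (e * d) * d" using True by (rule mult_right_mono) (simp add: d_def)
        then show ?thesis using e by (simp add: power2_eq_square add_increasing2)
      next
        case False
        then have "d \<le> \<bar>u x\<bar> / e" using e by (simp add: field_simps)
        then have "\<bar>u x\<bar> * d \<le> \<bar>u x\<bar> * (\<bar>u x\<bar> / e)" by (rule mult_left_mono) simp
        moreover have "0 \<le> e * d\<^sup>2" using e by simp
        ultimately show ?thesis by (simp add: power2_eq_square)
      qed
      then show "\<bar>(v n x - u x) * u x\<bar> \<le> e * (v n x - u x)\<^sup>2 + 1 / e * (u x)\<^sup>2"
        by (simp add: d_def abs_mult mult.commute)
    qed
  qed auto
  then have "(\<lambda>n. enn2real (\<integral>\<^sup>+x. ennreal \<bar>(v n x - u x) * u x\<bar> \<partial>lebesgue)) \<longlonglongrightarrow> 0"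
    by (intro tendsto_enn2real) simp_all
  moreover have "(LINT x|lebesgue. \<bar>(v n x - u x) * u x\<bar>) = enn2real (\<integral>\<^sup>+x. ennreal \<bar>(v n x - u x) * u x\<bar> \<partial>lebesgue)" for n
    by (rule integral_eq_nn_integral) auto
  ultimately show ?thesis by simp
qed

lemma PS_subsequence:
  assumes "PS_sequence \<rho> q lam c v" "strict_mono s"
  shows "PS_sequence \<rho> q lam c (v \<circ> s)"
proof -
  obtain D where D: "\<And>n. has_E_derivative \<rho> q lam (v n) (D n)" "(\<lambda>n. E_dual_norm \<rho> lam (D n)) \<longlonglongrightarrow> 0"
    using assms(1) unfolding PS_sequence_def by blast
  have "(\<lambda>n. I_fun \<rho> q lam (v n)) \<longlonglongrightarrow> c" using assms(1) by (simp add: PS_sequence_def)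
  from LIMSEQ_subseq_LIMSEQ[OF this assms(2)] LIMSEQ_subseq_LIMSEQ[OF D(2) assms(2)] D(1) assms(1)
  show ?thesis unfolding PS_sequence_def by (auto simp: o_def intro!: exI[of _ "D \<circ> s"])
qed

text \<open>The Nehari combination \<open>I(v) - I'(v)v / (q + 1)\<close>, in which both coefficients are positive.\<close>

lemma Nehari_identity:
  assumes lam: "0 < lam" and q: "3 < q" "q < 5" and v: "v \<in> H1" and F: "has_E_derivative \<rho> q lam v F"
  shows "I_fun \<rho> q lam v - 1 / (q + 1) * F v = (1 / 2 - 1 / (q + 1)) * H1_sq v + lam\<^sup>2 / omega * (1 / 4 - 1 / (q + 1)) * D_form v"
proof -
  have "\<bar>t\<bar> powr (q - 1) * t * t = \<bar>t\<bar> powr (q + 1)" for t :: real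
  proof -
    have "\<bar>t\<bar> powr (q + 1) = \<bar>t\<bar> powr (q - 1) * \<bar>t\<bar> powr 2"
      by (simp only: powr_add[symmetric]) (simp add: add.commute)
    also have "\<bar>t\<bar> powr 2 = t * t" by (cases "t = 0") (auto simp: power2_eq_square)
    finally show ?thesis by simp
  qed
  then have F': "F v = H1_sq v + lam\<^sup>2 / omega * D_form v - (LINT x|lebesgue. \<bar>v x\<bar> powr (q + 1))"
    using E_derivative_formula[OF lam q v v F] H1_ip_self[OF v] by simp
  have alg: "(1 / 2 * H + k * (D / 4) - b * P) - b * (H + k * D - P) = (1 / 2 - b) * H + k * (1 / 4 - b) * D" for b k H D P :: real
    by (simp add: algebra_simps)
  have e: "lam\<^sup>2 / 4 * (D / omega) = lam\<^sup>2 / omega * (D / 4)" for D by simp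
  show ?thesis unfolding I_fun_eq[OF v] F' e by (rule alg)
qed

text \<open>The Nehari combination dominates a y^2, where y is the \<open>H1\<close> norm, while the
  level and the dual norm make it grow at most linearly in y.\<close>

lemma PS_bounded:
  assumes lam: "0 < lam" and q: "3 < q" "q < 5" and PS: "PS_sequence \<rho> q lam c v"
  obtains K where "\<And>n. H1_sq (v n) \<le> K"
proof -
  have v: "v n \<in> H1" for n using PS by (simp add: PS_sequence_def E_space_eq)
  obtain D where D: "\<And>n. has_E_derivative \<rho> q lam (v n) (D n)" "(\<lambda>n. E_dual_norm \<rho> lam (D n)) \<longlonglongrightarrow> 0"
    using PS unfolding PS_sequence_def by blast
  have "(\<lambda>n. I_fun \<rho> q lam (v n)) \<longlonglongrightarrow> c" using PS by (simp add: PS_sequence_def)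
  then have "Bseq (\<lambda>n. I_fun \<rho> q lam (v n))" by (rule convergentI[THEN convergent_imp_Bseq])
  then obtain M1 where M1: "0 < M1" "\<And>n. norm (I_fun \<rho> q lam (v n)) \<le> M1" by (auto simp: Bseq_def)
  have "Bseq (\<lambda>n. E_dual_norm \<rho> lam (D n))" using D(2) by (rule convergentI[THEN convergent_imp_Bseq])
  then obtain M2 where M2: "0 < M2" "\<And>n. norm (E_dual_norm \<rho> lam (D n)) \<le> M2" by (auto simp: Bseq_def)
  define a where "a = 1 / 2 - 1 / (q + 1)"
  have a: "0 < a" using q by (simp add: a_def field_simps)
  define N where "N = norm_const lam"
  have N: "0 \<le> N" using norm_const_ge[OF lam] by (simp add: N_def)
  \<comment> \<open>The quotient is where the linear bound meets a y^2; adding 1 ensures y >= 1 for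
    y > Y, so that constants are bounded by multiples of y.\<close>
  define Y where "Y = 1 + (M1 + M2 * (N + 1)) / a"
  have Y: "1 \<le> Y" using M1(1) M2(1) N a by (simp add: Y_def)
  have "sqrt (H1_sq (v n)) \<le> Y" for n
  proof (rule ccontr)
    define y where "y = sqrt (H1_sq (v n))"
    assume "\<not> sqrt (H1_sq (v n)) \<le> Y"
    then have y: "Y < y" by (simp add: y_def)
    have Dd: "D n \<in> E_dual \<rho> lam" using D(1)[of n] by (simp add: has_E_derivative_def)
    have "\<bar>D n (v n)\<bar> \<le> (N * y + 1) * E_dual_norm \<rho> lam (D n)"
      using N y Y by (intro E_dual_norm_bound[OF lam Dd v]) (auto simp: N_def y_def add_nonneg_pos)
    also have "\<dots> \<le> (N * y + 1) * M2"
      using M2(2)[of n] N y Y by (intro mult_left_mono) auto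
    also have "\<dots> \<le> (N * y + y) * M2" using y Y M2(1) by (intro mult_right_mono) auto
    finally have Dv: "\<bar>D n (v n)\<bar> \<le> M2 * (N + 1) * y" by (simp add: algebra_simps)
    have "a * y\<^sup>2 + lam\<^sup>2 / omega * (1 / 4 - 1 / (q + 1)) * D_form (v n) = I_fun \<rho> q lam (v n) - 1 / (q + 1) * D n (v n)"
      using Nehari_identity[OF lam q v D(1), of n] by (simp add: a_def y_def)
    moreover have "0 \<le> lam\<^sup>2 / omega * (1 / 4 - 1 / (q + 1)) * D_form (v n)"
      using q by (intro mult_nonneg_nonneg coulomb_form_nonneg v) (auto simp: omega_def field_simps)
    moreover have "- (1 / (q + 1) * D n (v n)) \<le> M2 * (N + 1) * y"
    proof -
      have "- (1 / (q + 1) * D n (v n)) \<le> \<bar>1 / (q + 1) * D n (v n)\<bar>" by (rule abs_ge_minus_self)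
      also have "\<dots> = 1 / (q + 1) * \<bar>D n (v n)\<bar>" using q by (simp add: abs_mult)
      also have "\<dots> \<le> 1 * \<bar>D n (v n)\<bar>" using q by (intro mult_right_mono) auto
      finally show ?thesis using Dv by simp
    qed
    moreover have "I_fun \<rho> q lam (v n) \<le> M1 * y"
    proof -
      have "I_fun \<rho> q lam (v n) \<le> M1 * 1" using M1(2)[of n] by simp
      also have "\<dots> \<le> M1 * y" using M1(1) y Y by (intro mult_left_mono) auto
      finally show ?thesis .
    qed
    ultimately have "a * y\<^sup>2 \<le> (M1 + M2 * (N + 1)) * y" by (simp add: algebra_simps)
    then have "a * y \<le> M1 + M2 * (N + 1)" using y Y by (simp add: power2_eq_square)
    then have "y \<le> (M1 + M2 * (N + 1)) / a" using a by (simp add: field_simps)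
    then show False using y by (simp add: Y_def)
  qed
  then have "H1_sq (v n) \<le> Y\<^sup>2" for n
    using real_sqrt_le_iff[of "H1_sq (v n)" "Y\<^sup>2"] Y by simp
  then show ?thesis by (rule that)
qed

text \<open>The cross energy of u^2 and v_n^2 links the two one-sided estimates: its limit is fixed
  by the equation, and Fatou bounds it below by D(u).\<close>

lemma PS_strong_subsequence:
  assumes lam: "0 < lam" and q: "3 < q" "q < 5" and PS: "PS_sequence \<rho> q lam c v"
    and a: "\<And>v u. PS_sequence \<rho> q lam c v \<Longrightarrow> E_weak_limit \<rho> lam v u \<Longrightarrow> I_fun \<rho> q lam u = c"
  obtains r u where "strict_mono (r :: nat \<Rightarrow> nat)" "u \<in> H1" "(\<lambda>n. H1_sq (\<lambda>x. v (r n) x - u x)) \<longlonglongrightarrow> 0"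
proof -
  have v0: "v n \<in> H1" for n using PS by (simp add: PS_sequence_def E_space_eq)
  obtain K where K0: "\<And>n. H1_sq (v n) \<le> K" by (rule PS_bounded[OF lam q PS]) blast
  obtain r1 u where r1: "strict_mono r1" "u \<in> H1" "\<And>F. H1.bounded_functional F \<Longrightarrow> (\<lambda>n. F (v (r1 n))) \<longlonglongrightarrow> F u"
    by (rule H1.weak_compactness[of v K, OF v0]) (use K0 in \<open>auto simp: H1_ip_self[OF v0]\<close>)
  obtain r2 where r2: "strict_mono r2" "AE x in lebesgue. (\<lambda>n. v (r1 (r2 n)) x) \<longlonglongrightarrow> u x"
    by (rule H1_weak_imp_AE_subseq[of "\<lambda>n. v (r1 n)" u K, OF v0 r1(2) K0 r1(3)]) blast
  define r where "r = r1 \<circ> r2"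
  define w where "w = v \<circ> r"
  have r: "strict_mono r" unfolding r_def using r1(1) r2(1) by (rule strict_mono_o)
  have w: "w n \<in> H1" "H1_sq (w n) \<le> K" for n using v0 K0 by (auto simp: w_def)
  have weak: "(\<lambda>n. F (w n)) \<longlonglongrightarrow> F u" if "H1.bounded_functional F" for F
    using LIMSEQ_subseq_LIMSEQ[OF r1(3)[OF that] r2(1)] by (simp add: w_def r_def o_def)
  have ae: "AE x in lebesgue. (\<lambda>n. w n x) \<longlonglongrightarrow> u x" using r2(2) by (simp add: w_def r_def)
  have PSw: "PS_sequence \<rho> q lam c w" unfolding w_def by (rule PS_subsequence[OF PS r])
  note u = r1(2)
  have Iu: "I_fun \<rho> q lam u = c"
    by (rule a[OF PSw]) (use u weak in \<open>auto simp: E_weak_limit_def E_space_eq E_dual_iff[OF lam]\<close>)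
  have Ilim: "(\<lambda>n. I_fun \<rho> q lam (w n)) \<longlonglongrightarrow> c" using PSw by (simp add: PS_sequence_def)
  obtain F where F: "\<And>n. has_E_derivative \<rho> q lam (w n) (F n)" "(\<lambda>n. E_dual_norm \<rho> lam (F n)) \<longlonglongrightarrow> 0"
    using PSw unfolding PS_sequence_def by blast
  have Fd: "F n \<in> E_dual \<rho> lam" for n using F(1)[of n] by (simp add: has_E_derivative_def)
  have Nn: "0 \<le> norm_const lam" using norm_const_ge[OF lam] by simp
  have small: "(\<lambda>n. F n (h n)) \<longlonglongrightarrow> 0" if h: "\<And>n. h n \<in> H1" "\<And>n. H1_sq (h n) \<le> L" for h L
  proof (rule Lim_null_comparison)
    define B where "B = norm_const lam * sqrt L + 1"
    have L: "0 \<le> L" using h(2)[of 0] enn2real_nonneg order_trans by blast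
    have "\<bar>F n (h n)\<bar> \<le> B * E_dual_norm \<rho> lam (F n)" for n
    proof (rule E_dual_norm_bound[OF lam Fd h(1)])
      show "0 < B" using Nn L by (simp add: B_def add_nonneg_pos)
      have "norm_const lam * sqrt (H1_sq (h n)) \<le> norm_const lam * sqrt L"
        using Nn h(2)[of n] by (intro mult_left_mono) auto
      then show "norm_const lam * sqrt (H1_sq (h n)) \<le> B" by (simp add: B_def)
    qed
    then show "\<forall>\<^sub>F n in sequentially. norm (F n (h n)) \<le> B * E_dual_norm \<rho> lam (F n)" by simp
    show "(\<lambda>n. B * E_dual_norm \<rho> lam (F n)) \<longlonglongrightarrow> 0"
      using tendsto_mult[OF tendsto_const F(2), of B] by simp
  qed
  define P where "P = (LINT x|lebesgue. \<bar>u x\<bar> powr (q + 1))"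
  define k where "k = lam\<^sup>2 / omega"
  have k: "0 < k" using lam by (simp add: k_def omega_def)
  \<comment> \<open>The value forced on the cross energy in the limit: I'(w_n)(u) -> 0 reads ||u||^2
    + k j - P = 0.\<close>
  define j where "j = (P - H1_sq u) / k"
  let ?U = "\<lambda>n. coulomb_form \<rho> (\<lambda>x. u x * u x) (\<lambda>x. w n x * w n x)"
  \<comment> \<open>The derivative contains the density w_n u, which has no sign. Replacing it by
    u^2 costs the form of (w_n - u) u, which tends to 0 in L^1, and makes both densities
    nonnegative, as Fatou requires.\<close>
  have Ulim: "?U \<longlonglongrightarrow> j"
  proof -
    let ?W = "\<lambda>n. coulomb_form \<rho> (\<lambda>x. w n x * u x) (\<lambda>x. w n x * w n x)"
    let ?E = "\<lambda>n. coulomb_form \<rho> (\<lambda>x. (w n x - u x) * u x) (\<lambda>x. w n x * w n x)"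
    have ip: "(\<lambda>n. H1_ip (w n) u) \<longlonglongrightarrow> H1_sq u"
      using weak[OF H1.bounded_functional_ip[OF u]] by (simp add: H1.ip_sym[OF w(1) u] H1_ip_self[OF u])
    have "(\<lambda>n. (F n u - H1_ip (w n) u + (LINT x|lebesgue. \<bar>w n x\<bar> powr (q - 1) * w n x * u x)) / k) \<longlonglongrightarrow> (0 - H1_sq u + P) / k"
      unfolding P_def
      by (intro tendsto_intros ip small[of "\<lambda>_. u" "H1_sq u"] integral_powr_mult_tendsto[OF q w(1) u w(2) ae] u) (use k in auto)
    moreover have "(F n u - H1_ip (w n) u + (LINT x|lebesgue. \<bar>w n x\<bar> powr (q - 1) * w n x * u x)) / k = ?W n" for n
      unfolding E_derivative_formula[OF lam q w(1) u F(1)] k_def[symmetric] using k by simp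
    ultimately have W: "?W \<longlonglongrightarrow> j" by (simp add: j_def)
    have d: "(\<lambda>x. w n x - u x) \<in> H1" for n by (rule H1_diff[OF w(1) u])
    define L where "L = sqrt (\<bar>K\<bar> + 1)"
    have L: "0 < L" "H1_energy (w n) \<le> ennreal (L\<^sup>2)" for n
    proof -
      show "0 < L" by (simp add: L_def)
      have "H1_sq (w n) \<le> \<bar>K\<bar> + 1" using w(2)[of n] by linarith
      then show "H1_energy (w n) \<le> ennreal (L\<^sup>2)" using H1_energy_leI[OF w(1)] by (simp add: L_def del: ennreal_plus)
    qed
    have E: "?E \<longlonglongrightarrow> 0"
    proof (rule Lim_null_comparison)
      show "\<forall>\<^sub>F n in sequentially. norm (?E n) \<le> R * (R * newton_const * L\<^sup>2) * (LINT x|lebesgue. \<bar>(w n x - u x) * u x\<bar>)"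
        unfolding real_norm_def
        by (intro always_eventually allI coulomb_form_bound(2)[OF d u w(1) w(1) L(1) L(2) L(2)])
      show "(\<lambda>n. R * (R * newton_const * L\<^sup>2) * (LINT x|lebesgue. \<bar>(w n x - u x) * u x\<bar>)) \<longlonglongrightarrow> 0"
        using tendsto_mult[OF tendsto_const integral_weak_mult_tendsto_0[OF w(1) u w(2) ae], of "R * (R * newton_const * L\<^sup>2)"] by simp
    qed
    have "?U n = ?W n - ?E n" for n
    proof -
      have "?W n - ?E n = (LINT x|lebesgue. w n x * u x * \<rho> x * potential \<rho> (\<lambda>x. w n x * w n x) x - (w n x - u x) * u x * \<rho> x * potential \<rho> (\<lambda>x. w n x * w n x) x)"
        unfolding coulomb_form_def
        by (rule Bochner_Integration.integral_diff[symmetric]) (rule coulomb_form_bound(1)[OF w(1) u w(1) w(1)] coulomb_form_bound(1)[OF d u w(1) w(1)])+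
      also have "\<dots> = ?U n"
        unfolding coulomb_form_def by (intro Bochner_Integration.integral_cong refl) (simp add: algebra_simps)
      finally show ?thesis by simp
    qed
    then show ?thesis using tendsto_diff[OF W E] by simp
  qed
  have Dj: "D_form u \<le> j"
  proof -
    have "ennreal (D_form u) \<le> liminf (\<lambda>n. ennreal (?U n))"
      by (rule coulomb_form_fatou[OF u u w(1) u _ ae]) simp
    also have "\<dots> = ennreal j" using Ulim by (intro lim_imp_Liminf tendsto_ennrealI) simp_all
    finally show ?thesis
      using LIMSEQ_le_const[OF Ulim, of 0] coulomb_form_nonneg[OF u w(1)] by simp
  qed
  define a0 where "a0 = 1 / 2 - 1 / (q + 1)"
  define b0 where "b0 = k * (1 / 4 - 1 / (q + 1))"
  \<comment> \<open>q > 3 is what gives 1/4 - 1/(q+1) > 0.\<close>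
  have ab: "0 < a0" "0 \<le> b0" using q k by (simp_all add: a0_def b0_def field_simps)
  have cle: "c \<le> a0 * H1_sq u + b0 * D_form u"
  proof -
    have "H1_sq u + k * D_form u \<le> P" using Dj k by (simp add: j_def field_simps)
    then have "1 / (q + 1) * (H1_sq u + k * D_form u) \<le> 1 / (q + 1) * P" using q by (intro mult_left_mono) auto
    moreover have "c = 1 / 2 * H1_sq u + k / 4 * D_form u - 1 / (q + 1) * P"
      using Iu unfolding I_fun_eq[OF u] P_def k_def by simp
    ultimately show ?thesis by (simp add: a0_def b0_def algebra_simps)
  qed
  define S where "S n = a0 * H1_sq (w n) + b0 * D_form (w n)" for n
  have S: "S \<longlonglongrightarrow> c"
  proof -
    have "(\<lambda>n. I_fun \<rho> q lam (w n) - 1 / (q + 1) * F n (w n)) \<longlonglongrightarrow> c - 1 / (q + 1) * 0"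
      by (intro tendsto_intros Ilim small[of w K] w)
    then show ?thesis
      unfolding Nehari_identity[OF lam q w(1) F(1)] by (simp add: S_def[abs_def] a0_def b0_def k_def)
  qed
  have "(\<lambda>n. H1_sq (\<lambda>x. w n x - u x)) \<longlonglongrightarrow> 0"
  proof (rule LIMSEQ_I)
    fix e :: real assume e: "0 < e"
    \<comment> \<open>The final estimate collects d from S, 2 * (d/2) from the weak limit and b0 d
      from the Coulomb energy; dividing (2 + b0) d = e a0 by a0 leaves e.\<close>
    define d where "d = e * a0 / (2 + b0)"
    have d: "0 < d" "(2 + b0) * d = e * a0" using e ab by (simp_all add: d_def add_pos_nonneg)
    have "\<forall>\<^sub>F n in sequentially. D_form u - d < D_form (w n)"
    \<comment> \<open>Fatou is available for extended nonnegative values only; a negative threshold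
      lies below every energy anyway.\<close>
    proof (cases "0 \<le> D_form u - d")
      case True
      have "ennreal (D_form u - d) < ennreal (D_form u)" using True d by (intro ennreal_lessI) auto
      also have "\<dots> \<le> liminf (\<lambda>n. ennreal (D_form (w n)))"
        by (rule coulomb_form_fatou[OF w(1) u w(1) u ae ae])
      finally have "\<forall>\<^sub>F n in sequentially. ennreal (D_form u - d) < ennreal (D_form (w n))" by (rule less_LiminfD)
      then show ?thesis by eventually_elim (use True in \<open>simp add: ennreal_less_iff\<close>)
    next
      case False
      have "D_form u - d < D_form (w n)" for n using False coulomb_form_nonneg[OF w(1) w(1), of n n] by linarith
      then show ?thesis by simp
    qed
    moreover have "\<forall>\<^sub>F n in sequentially. S n < c + d" using S d by (intro order_tendstoD(2)) auto
    moreover have "\<forall>\<^sub>F n in sequentially. H1_sq u - d / (2 * a0) < H1_ip u (w n)"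
      using weak[OF H1.bounded_functional_ip[OF u]] d ab by (intro order_tendstoD(1)) (auto simp: H1_ip_self[OF u])
    ultimately have "\<forall>\<^sub>F n in sequentially. norm (H1_sq (\<lambda>x. w n x - u x) - 0) < e"
    proof eventually_elim
      case (elim n)
      have 1: "b0 * (D_form u - d) \<le> b0 * D_form (w n)" using elim(1) ab by (intro mult_left_mono) auto
      have 2: "a0 * H1_sq (w n) + b0 * D_form (w n) < c + d" using elim(2) by (simp add: S_def)
      have "a0 * (H1_sq u - d / (2 * a0)) < a0 * H1_ip u (w n)" using elim(3) ab by (intro mult_strict_left_mono) auto
      moreover have "a0 * (H1_sq u - d / (2 * a0)) = a0 * H1_sq u - d / 2" using ab by (simp add: field_simps)
      ultimately have 3: "a0 * H1_sq u - d / 2 < a0 * H1_ip u (w n)" by simp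
      have "H1_sq (\<lambda>x. w n x - u x) = H1_sq (w n) - 2 * H1_ip u (w n) + H1_sq u"
        using H1.ip_diff_diff[OF w(1)[of n] u] H1.ip_sym[OF w(1)[of n] u] by (simp add: H1_ip_self w u H1_diff)
      then have "a0 * H1_sq (\<lambda>x. w n x - u x) = a0 * (H1_sq (w n) - 2 * H1_ip u (w n) + H1_sq u)" by simp
      also have "\<dots> = a0 * H1_sq (w n) - 2 * (a0 * H1_ip u (w n)) + a0 * H1_sq u"
        by (simp add: algebra_simps)
      also have "\<dots> < 2 * d + b0 * d" using 1 2 3 cle by (simp add: algebra_simps)
      also have "\<dots> = e * a0" using d(2) by (simp add: algebra_simps)
      finally show ?case using ab by (simp add: mult.commute)
    qed
    then show "\<exists>no. \<forall>n\<ge>no. norm (H1_sq (\<lambda>x. w n x - u x) - 0) < e" by (simp add: eventually_sequentially)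
  qed
  then show ?thesis using that[OF r u] by (simp add: w_def)
qed

end

section \<open>Relative compactness and the theorem\<close>

text \<open>The covering argument selects points v (s k) with arbitrary, possibly repeating indices,
  whereas the Palais-Smale property passes only to increasing ones. If some value is attained
  infinitely often, a constant subsequence converges trivially; otherwise the values are unbounded
  along every tail and can be chosen increasing.\<close>

lemma subsequence_index_cases:
  fixes s :: "nat \<Rightarrow> nat"
  obtains (const) r :: "nat \<Rightarrow> nat" and m where "strict_mono r" "\<And>n. s (r n) = m"
    | (mono) r :: "nat \<Rightarrow> nat" where "strict_mono r" "strict_mono (s \<circ> r)"
proof (cases "\<exists>m. infinite {n. s n = m}")
  case True
  then obtain m where m: "infinite {n. s n = m}" by blast
  from infinite_enumerate[OF m] obtain r :: "nat \<Rightarrow> nat" where "strict_mono r \<and> (\<forall>n. r n \<in> {n. s n = m})" ..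
  then show ?thesis by (intro const[of r m]) auto
next
  case False
  have "\<exists>n>a. b < s n" for a b
  proof -
    have "finite ({..a} \<union> (\<Union>m\<le>b. {n. s n = m}))" using False by auto
    then obtain n where "n \<notin> {..a} \<union> (\<Union>m\<le>b. {n. s n = m})" using ex_new_if_finite infinite_UNIV_nat by blast
    then show ?thesis by (intro exI[of _ n]) (auto simp: not_le)
  qed
  then have "\<exists>r. \<forall>n. True \<and> (r n < r (Suc n) \<and> s (r n) < s (r (Suc n)))"
    by (intro dependent_nat_choice) auto
  then obtain r where "\<And>n. r n < r (Suc n)" "\<And>n. s (r n) < s (r (Suc n))" by blast
  then show ?thesis by (intro mono[of r]) (auto simp: strict_mono_Suc_iff)
qed

text \<open>A quasi-metric version of "relatively sequentially compact implies relatively compact":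
  a Lebesgue number for the cover exists along the sequence, and the sequence is totally bounded.\<close>

lemma quasi_metric_compactin_closure:
  fixes d :: "'a \<Rightarrow> 'a \<Rightarrow> real" and v :: "nat \<Rightarrow> 'a"
  assumes T: "\<And>U. openin T U \<longleftrightarrow> U \<subseteq> X \<and> (\<forall>u\<in>U. \<exists>r>0. \<forall>w\<in>X. d u w < r \<longrightarrow> w \<in> U)"
    and refl: "\<And>u. u \<in> X \<Longrightarrow> d u u = 0" and sym: "\<And>u w. u \<in> X \<Longrightarrow> w \<in> X \<Longrightarrow> d u w = d w u"
    and tri: "\<And>u w z. u \<in> X \<Longrightarrow> w \<in> X \<Longrightarrow> z \<in> X \<Longrightarrow> d u z \<le> 2 * d u w + 2 * d w z"
    and v: "\<And>n. v n \<in> X"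
    and sub: "\<And>s :: nat \<Rightarrow> nat. \<exists>r u. strict_mono (r :: nat \<Rightarrow> nat) \<and> u \<in> X \<and> (\<lambda>n. d u (v (s (r n)))) \<longlonglongrightarrow> 0"
  shows "compactin T (T closure_of range v)"
proof -
  have top: "topspace T = X"
  proof
    show "topspace T \<subseteq> X" using T[of "topspace T"] by simp
    have "openin T X" unfolding T using zero_less_one by blast
    then show "X \<subseteq> topspace T" by (rule openin_subset)
  qed
  have ball_nbhd: "\<exists>U. openin T U \<and> w \<in> U \<and> (\<forall>x\<in>U. d w x < r)" if w: "w \<in> X" and r: "0 < r" for w r
  proof (intro exI conjI)
    \<comment> \<open>Balls of a quasi-metric need not be open, so the interior of the ball is
      taken: points having some ball inside it. With the constant 2 in the triangle inequality,
      radii s/4 give 2 s/4 + 2 s/4 = s.\<close>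
    let ?U = "{u\<in>X. \<exists>s>0. \<forall>x\<in>X. d u x < s \<longrightarrow> d w x < r}"
    show "openin T ?U" unfolding T
    proof (intro conjI ballI)
      fix u assume "u \<in> ?U"
      then obtain s where u: "u \<in> X" and s: "0 < s" "\<And>x. x \<in> X \<Longrightarrow> d u x < s \<Longrightarrow> d w x < r" by blast
      have "x \<in> ?U" if x: "x \<in> X" "d u x < s / 4" for x
      proof -
        have "d w z < r" if z: "z \<in> X" "d x z < s / 4" for z
          using tri[OF u x(1) z(1)] x(2) z by (intro s(2)) auto
        then show ?thesis using x(1) s(1) by (auto intro!: exI[of _ "s / 4"])
      qed
      then show "\<exists>r>0. \<forall>w\<in>X. d u w < r \<longrightarrow> w \<in> ?U" using s(1) by (intro exI[of _ "s / 4"]) auto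
    qed blast
    show "w \<in> ?U" using w r by blast
    show "\<forall>x\<in>?U. d w x < r" using refl by fastforce
  qed
  have near: "\<exists>n. d w (v n) < r" if w: "w \<in> T closure_of range v" and r: "0 < r" for w r
  proof -
    have wX: "w \<in> X" using w closure_of_subset_topspace top by fastforce
    obtain U where "openin T U" "w \<in> U" "\<forall>x\<in>U. d w x < r" using ball_nbhd[OF wX r] by blast
    then show ?thesis using w unfolding in_closure_of by blast
  qed
  have limit_in: "u \<in> T closure_of range v" if u: "u \<in> X" "(\<lambda>n. d u (v (p n))) \<longlonglongrightarrow> 0" for u p
    unfolding in_closure_of top
  proof (intro conjI allI impI u)
    fix U assume U: "u \<in> U \<and> openin T U"
    then obtain r where r: "0 < r" "\<And>w. w \<in> X \<Longrightarrow> d u w < r \<Longrightarrow> w \<in> U" unfolding T by blast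
    have "\<forall>\<^sub>F n in sequentially. d u (v (p n)) < r" using u(2) r(1) by (rule order_tendstoD(2))
    then obtain n where "d u (v (p n)) < r" by (auto simp: eventually_sequentially)
    then show "\<exists>y. y \<in> range v \<and> y \<in> U" using r(2)[OF v] by blast
  qed
  show ?thesis unfolding compactin_def
  proof (intro conjI allI impI)
    show "T closure_of range v \<subseteq> topspace T" by (rule closure_of_subset_topspace)
    fix \<U> assume cover: "Ball \<U> (openin T) \<and> T closure_of range v \<subseteq> \<Union>\<U>"
    have "\<exists>e>0. \<forall>n. \<exists>U\<in>\<U>. \<forall>x\<in>X. d (v n) x < e \<longrightarrow> x \<in> U"
    proof (rule ccontr)
      assume *: "\<not> ?thesis"
      have "\<exists>n. \<forall>U\<in>\<U>. \<exists>x\<in>X. d (v n) x < 1 / real (Suc k) \<and> x \<notin> U" for k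
        using * by (metis of_nat_0_less_iff zero_less_Suc zero_less_divide_1_iff)
      then obtain s where s: "\<And>k U. U \<in> \<U> \<Longrightarrow> \<exists>x\<in>X. d (v (s k)) x < 1 / real (Suc k) \<and> x \<notin> U" by metis
      obtain r u where r: "strict_mono (r :: nat \<Rightarrow> nat)" "u \<in> X" "(\<lambda>n. d u (v (s (r n)))) \<longlonglongrightarrow> 0" using sub[of s] by blast
      have "u \<in> T closure_of range v" by (rule limit_in[OF r(2,3)])
      then obtain U where U: "U \<in> \<U>" "u \<in> U" using cover by blast
      then have "openin T U" using cover by blast
      then obtain e where e: "0 < e" "\<And>x. x \<in> X \<Longrightarrow> d u x < e \<Longrightarrow> x \<in> U" using U(2) unfolding T by blast
      have "\<forall>\<^sub>F n in sequentially. d u (v (s (r n))) < e / 4" using e(1) by (intro order_tendstoD(2)[OF r(3)]) simp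
      then obtain N where N: "\<And>n. N \<le> n \<Longrightarrow> d u (v (s (r n))) < e / 4" by (auto simp: eventually_sequentially)
      obtain N2 where N2: "1 / real (Suc N2) < e / 4" using nat_approx_posE[of "e / 4"] e(1) by auto
      define n where "n = max N N2"
      obtain x where x: "x \<in> X" "d (v (s (r n))) x < 1 / real (Suc (r n))" "x \<notin> U" using s[OF U(1)] by blast
      have "N2 \<le> r n" using strict_mono_imp_increasing[OF r(1), of n] by (simp add: n_def)
      then have "1 / real (Suc (r n)) \<le> 1 / real (Suc N2)" by (intro divide_left_mono) auto
      then have "d (v (s (r n))) x < e / 4" using x(2) N2 by linarith
      moreover have "d u (v (s (r n))) < e / 4" by (rule N) (simp add: n_def)
      ultimately have "d u x < e" using tri[OF r(2) v x(1), of "s (r n)"] by linarith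
      then show False using e(2) x by blast
    qed
    then obtain e where e: "0 < e" "\<And>n. \<exists>U\<in>\<U>. \<forall>x\<in>X. d (v n) x < e \<longrightarrow> x \<in> U" by blast
    have "\<exists>A. finite A \<and> (\<forall>n. \<exists>m\<in>A. d (v m) (v n) < e / 4)"
    proof (rule ccontr)
      assume *: "\<not> ?thesis"
      have "\<exists>n. \<forall>m\<in>set ms. e / 4 \<le> d (v m) (v n)" for ms :: "nat list"
        using * by (metis List.finite_set not_le)
      then obtain f where f: "\<And>ms m. m \<in> set ms \<Longrightarrow> e / 4 \<le> d (v m) (v (f ms))" by metis
      \<comment> \<open>\<open>L k\<close> lists the points chosen so far, each new one at distance
        at least e/4 from all of them. Two terms of a convergent subsequence within e/16 of the
        limit contradict this, as 2 e/16 + 2 e/16 = e/4.\<close>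
      define L where "L = rec_nat [] (\<lambda>_ ms. f ms # ms)"
      have L_Suc: "L (Suc k) = f (L k) # L k" for k by (simp add: L_def)
      define s where "s k = f (L k)" for k
      have sL: "s i \<in> set (L k)" if "i < k" for i k
        using that by (induction k) (auto simp: L_Suc s_def less_Suc_eq)
      obtain r u where r: "strict_mono (r :: nat \<Rightarrow> nat)" "u \<in> X" "(\<lambda>n. d u (v (s (r n)))) \<longlonglongrightarrow> 0" using sub[of s] by blast
      have "\<forall>\<^sub>F n in sequentially. d u (v (s (r n))) < e / 16" using e(1) by (intro order_tendstoD(2)[OF r(3)]) simp
      then obtain N where N: "\<And>n. N \<le> n \<Longrightarrow> d u (v (s (r n))) < e / 16" by (auto simp: eventually_sequentially)
      have "r N < r (Suc N)" using r(1) by (simp add: strict_mono_Suc_iff)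
      then have "e / 4 \<le> d (v (s (r N))) (v (s (r (Suc N))))" using f[OF sL] by (simp add: s_def[of "r (Suc N)"])
      moreover have "d (v (s (r N))) (v (s (r (Suc N)))) \<le> 2 * d (v (s (r N))) u + 2 * d u (v (s (r (Suc N))))"
        by (intro tri v r)
      moreover have "d (v (s (r N))) u = d u (v (s (r N)))" by (intro sym v r)
      ultimately show False using N[of N] N[of "Suc N"] by simp
    qed
    then obtain A where A: "finite A" "\<And>n. \<exists>m\<in>A. d (v m) (v n) < e / 4" by blast
    obtain g where g: "\<And>n. g n \<in> \<U>" "\<And>n x. x \<in> X \<Longrightarrow> d (v n) x < e \<Longrightarrow> x \<in> g n" using e(2) by metis
    show "\<exists>\<F>. finite \<F> \<and> \<F> \<subseteq> \<U> \<and> T closure_of range v \<subseteq> \<Union>\<F>"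
    proof (intro exI conjI subsetI)
      show "finite (g ` A)" using A(1) by simp
      show "x \<in> \<U>" if "x \<in> g ` A" for x using that g(1) by blast
      fix w assume w: "w \<in> T closure_of range v"
      have wX: "w \<in> X" using w closure_of_subset_topspace top by fastforce
      obtain n where n: "d w (v n) < e / 4" using near[OF w, of "e / 4"] e(1) by auto
      obtain m where m: "m \<in> A" "d (v m) (v n) < e / 4" using A(2) by blast
      \<comment> \<open>A point of the closure is near some v n, which is near one of finitely many
        v m; the distances e/4 keep it inside the e-ball, hence inside the cover member attached to
        v m.\<close>
      have "d (v m) w \<le> 2 * d (v m) (v n) + 2 * d (v n) w" by (intro tri v wX)
      then have "d (v m) w < e" using n m(2) sym[OF v wX, of n] by simp
      then show "w \<in> \<Union>(g ` A)" using g(2)[OF wX] m(1) by blast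
    qed
  qed
qed

section \<open>Transfer to the topology of \<open>E\<close> and conclusion\<close>

context bounded_density
begin

text \<open>Norm equivalence lets neighbourhoods be measured by \<open>H1_sq\<close>, for which the
  parallelogram identity gives the quasi-triangle inequality with constant 2 that the covering
  argument uses.\<close>

lemma openin_E_topology_H1:
  assumes lam: "0 < lam"
  shows "openin (E_topology \<rho> lam) U \<longleftrightarrow> U \<subseteq> H1 \<and> (\<forall>u\<in>U. \<exists>r>0. \<forall>v\<in>H1. H1_sq (\<lambda>x. v x - u x) < r \<longrightarrow> v \<in> U)"
proof -
  define N where "N = norm_const lam"
  have N: "0 < N" using norm_const_ge[OF lam] by (simp add: N_def)
  have "(\<exists>r>0. \<forall>v\<in>H1. E_norm \<rho> lam (\<lambda>x. v x - u x) < r \<longrightarrow> v \<in> U) \<longleftrightarrow> (\<exists>r>0. \<forall>v\<in>H1. H1_sq (\<lambda>x. v x - u x) < r \<longrightarrow> v \<in> U)"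
    if u: "u \<in> H1" for u
  proof
    assume "\<exists>r>0. \<forall>v\<in>H1. E_norm \<rho> lam (\<lambda>x. v x - u x) < r \<longrightarrow> v \<in> U"
    then obtain r where r: "0 < r" "\<And>v. v \<in> H1 \<Longrightarrow> E_norm \<rho> lam (\<lambda>x. v x - u x) < r \<Longrightarrow> v \<in> U" by blast
    have "v \<in> U" if v: "v \<in> H1" "H1_sq (\<lambda>x. v x - u x) < (r / N)\<^sup>2" for v
    proof (rule r(2)[OF v(1)])
      have "sqrt (H1_sq (\<lambda>x. v x - u x)) < r / N" using r(1) N by (intro real_less_lsqrt v(2)) auto
      then have "N * sqrt (H1_sq (\<lambda>x. v x - u x)) < r" using N by (simp add: field_simps)
      then show "E_norm \<rho> lam (\<lambda>x. v x - u x) < r"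
        using E_norm_bounds(2)[OF lam H1_diff[OF v(1) u]] by (simp add: N_def)
    qed
    then show "\<exists>r>0. \<forall>v\<in>H1. H1_sq (\<lambda>x. v x - u x) < r \<longrightarrow> v \<in> U"
      using r(1) N by (intro exI[of _ "(r / N)\<^sup>2"]) simp
  next
    assume "\<exists>r>0. \<forall>v\<in>H1. H1_sq (\<lambda>x. v x - u x) < r \<longrightarrow> v \<in> U"
    then obtain r where r: "0 < r" "\<And>v. v \<in> H1 \<Longrightarrow> H1_sq (\<lambda>x. v x - u x) < r \<Longrightarrow> v \<in> U" by blast
    have "v \<in> U" if v: "v \<in> H1" "E_norm \<rho> lam (\<lambda>x. v x - u x) < sqrt r" for v
    proof (rule r(2)[OF v(1)])
      have "sqrt (H1_sq (\<lambda>x. v x - u x)) < sqrt r"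
        using E_norm_bounds(1)[OF lam H1_diff[OF v(1) u]] v(2) by linarith
      then show "H1_sq (\<lambda>x. v x - u x) < r" by simp
    qed
    then show "\<exists>r>0. \<forall>v\<in>H1. E_norm \<rho> lam (\<lambda>x. v x - u x) < r \<longrightarrow> v \<in> U"
      using r(1) by (intro exI[of _ "sqrt r"]) simp
  qed
  then show ?thesis unfolding openin_E_topology E_space_eq by blast
qed

lemma PS_condition_if_weak_limits_critical:
  assumes lam: "0 < lam" and q: "3 < q" "q < 5"
    and a: "\<And>v u. PS_sequence \<rho> q lam c v \<Longrightarrow> E_weak_limit \<rho> lam v u \<Longrightarrow> I_fun \<rho> q lam u = c"
  shows "PS_condition \<rho> q lam c"
  unfolding PS_condition_def
proof (intro allI impI)
  fix v assume PS: "PS_sequence \<rho> q lam c v"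
  have v: "v n \<in> H1" for n using PS by (simp add: PS_sequence_def E_space_eq)
  have zero: "H1_sq (\<lambda>x. u x - u x) = 0" if "u \<in> H1" for u
    using H1_sq_scale[OF that, of 0] by simp
  have sym: "H1_sq (\<lambda>x. w x - u x) = H1_sq (\<lambda>x. u x - w x)" if "u \<in> H1" "w \<in> H1" for u w
    using H1_sq_scale[OF H1_diff[OF that], of "-1"] by simp
  show "compactin (E_topology \<rho> lam) (E_topology \<rho> lam closure_of range v)"
  proof (rule quasi_metric_compactin_closure[where X = H1 and d = "\<lambda>u w. H1_sq (\<lambda>x. w x - u x)", OF openin_E_topology_H1[OF lam] zero sym _ v])
    fix u w z assume uwz: "u \<in> H1" "w \<in> H1" "z \<in> H1"
    have "H1_sq (\<lambda>x. (z x - w x) - (u x - w x)) \<le> 2 * H1_sq (\<lambda>x. z x - w x) + 2 * H1_sq (\<lambda>x. u x - w x)"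
      by (intro H1_sq_diff_le H1_diff uwz)
    then show "H1_sq (\<lambda>x. z x - u x) \<le> 2 * H1_sq (\<lambda>x. w x - u x) + 2 * H1_sq (\<lambda>x. z x - w x)"
      using sym[OF uwz(1,2)] by simp
  next
    fix s :: "nat \<Rightarrow> nat"
    show "\<exists>r u. strict_mono (r :: nat \<Rightarrow> nat) \<and> u \<in> H1 \<and> (\<lambda>n. H1_sq (\<lambda>x. v (s (r n)) x - u x)) \<longlonglongrightarrow> 0"
    proof (cases rule: subsequence_index_cases[of s])
      case (const r m)
      then show ?thesis using v zero[OF v] by (intro exI[of _ r] exI[of _ "v m"]) simp
    next
      case (mono r)
      have PS': "PS_sequence \<rho> q lam c (v \<circ> (s \<circ> r))" by (rule PS_subsequence[OF PS mono(2)])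
      obtain r' u where r': "strict_mono (r' :: nat \<Rightarrow> nat)" "u \<in> H1" "(\<lambda>n. H1_sq (\<lambda>x. (v \<circ> (s \<circ> r)) (r' n) x - u x)) \<longlonglongrightarrow> 0"
        by (rule PS_strong_subsequence[OF lam q PS' a]) blast+
      then show ?thesis using strict_mono_o[OF mono(1) r'(1)]
        by (intro exI[of _ "r \<circ> r'"] exI[of _ u]) (simp add: o_def)
    qed
  qed
qed

end

lemma bounded_if_locally_bounded_tendsto:
  fixes \<rho> :: "R3 \<Rightarrow> real"
  assumes "\<And>K. compact K \<Longrightarrow> bounded (\<rho> ` K)" and "(\<rho> \<longlongrightarrow> l) at_infinity"
  obtains R where "\<And>x. \<rho> x \<le> R"
proof -
  have "\<forall>\<^sub>F x in at_infinity. dist (\<rho> x) l < 1" using assms(2) by (rule tendstoD) simp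
  then obtain b where b: "\<And>x. b \<le> norm x \<Longrightarrow> dist (\<rho> x) l < 1" unfolding eventually_at_infinity by blast
  obtain B where B: "\<And>x. x \<in> cball 0 b \<Longrightarrow> norm (\<rho> x) \<le> B"
    using assms(1)[OF compact_cball[of 0 b]] unfolding bounded_iff by blast
  have "\<rho> x \<le> \<bar>B\<bar> + \<bar>l\<bar> + 1" for x
  proof (cases "norm x \<le> b")
    case True
    then show ?thesis using B[of x] by simp
  next
    case False
    then show ?thesis using b[of x] by (simp add: dist_real_def)
  qed
  then show ?thesis by (rule that)
qed

theorem proposition7:
  fixes \<rho> :: "real ^ 3 \<Rightarrow> real" and q M \<rho>_inf lam0 lam1 :: real
  assumes "3 < q" and "q < 5"
    and "\<And>x. 0 \<le> \<rho> x"
    and "\<rho> \<in> borel_measurable lebesgue"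
    and "\<And>K. compact K \<Longrightarrow> bounded (\<rho> ` K)"
    and "interior (\<rho> -` {0}) \<noteq> {}"
    and "0 < M" and "emeasure lebesgue {x. \<rho> x \<le> M} < \<infinity>"
    and "(\<rho> \<longlongrightarrow> \<rho>_inf) at_infinity" and "M < \<rho>_inf"
    and "0 < lam0" and "0 < lam1"
    and "\<exists>\<alpha>0>0. \<forall>lam\<ge>lam0. \<forall>v u.
           PS_sequence \<rho> q lam (mp_level \<rho> q lam) v \<longrightarrow> E_weak_limit \<rho> lam v u \<longrightarrow>
           (LINT x|lebesgue. \<bar>u x\<bar> ^ 3) > \<alpha>0"
    and "\<forall>lam\<ge>max lam0 lam1. \<forall>v u.
           PS_sequence \<rho> q lam (mp_level \<rho> q lam) v \<longrightarrow> E_weak_limit \<rho> lam v u \<longrightarrow>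
           \<not> (AE x in lebesgue. u x = 0) \<longrightarrow>
           I_fun \<rho> q lam u = mp_level \<rho> q lam"
  shows "\<forall>lam\<ge>max lam0 lam1. PS_condition \<rho> q lam (mp_level \<rho> q lam)"
proof (intro allI impI)
  fix lam assume lam: "max lam0 lam1 \<le> lam"
  obtain R where R: "\<And>x. \<rho> x \<le> R"
    by (rule bounded_if_locally_bounded_tendsto[OF assms(5,9)]) blast+
  interpret bounded_density \<rho> R
    by unfold_locales (rule assms(3) R assms(4))+
  show "PS_condition \<rho> q lam (mp_level \<rho> q lam)"
  proof (rule PS_condition_if_weak_limits_critical[OF _ assms(1,2)])
    show "0 < lam" using lam assms(11) by simp
    fix v u assume v: "PS_sequence \<rho> q lam (mp_level \<rho> q lam) v" "E_weak_limit \<rho> lam v u"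
    \<comment> \<open>The uniform lower bound on the cubic integral excludes a null weak limit,
      which makes the energy identity for nontrivial weak limits applicable.\<close>
    have "0 < (LINT x|lebesgue. \<bar>u x\<bar> ^ 3)"
      using assms(13) v lam by (meson less_trans max.boundedE)
    moreover have "(LINT x|lebesgue. \<bar>u x\<bar> ^ 3) = 0" if "AE x in lebesgue. u x = 0"
      by (rule integral_eq_zero_AE) (use that in eventually_elim, simp)
    ultimately have "\<not> (AE x in lebesgue. u x = 0)" by fastforce
    then show "I_fun \<rho> q lam u = mp_level \<rho> q lam" using assms(14) lam v by blast
  qed
qed

end
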